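(* For all positive integers $a, b$ with $a\ge 3$, \[ \sum_{1\le x\le b}\left\lfloor \frac{x^2}{a}\right\rfloor =\sum_{1\le x\le b}\left(\frac{x^2}{a}-\frac12\right) +O\left(\sqrt{a}\,\log a+b\,a^{-\frac12+\frac{2+o(1)}{\sqrt{\log a}\,\log\log a}}\right), \] where the sums run over positive integers $x\le b$, the implied constant is absolute, and $o(1)$ denotes a function of $a$ only that tends to $0$ as $a\to\infty$.
   Context: $\lfloor t\rfloor$ denotes the greatest integer not exceeding $t$, and $\log$ is the natural logarithm. The notation $f=O(g)$ means that there is a constant $C$ with $|f|\le C|g|$ for all admissible values of the parameters (here all positive integers $a\ge 3$ and $b\ge 1$). *)

theory Defs
  imports Complex_Main
begin

end

theory Submission
  imports Defs "HOL-Complex_Analysis.Complex_Analysis" "HOL-Number_Theory.Number_Theory"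
begin

text \<open>
  Expanding \<open>(m mod a) / a\<close> in a finite Fourier series over \<open>\<int>/a\<int>\<close> turns the defect into
  \<open>\<Sum> c\<^sub>h S\<^sub>h\<close> with \<open>c\<^sub>h = O(1/h)\<close> and \<open>S\<^sub>h\<close> the incomplete Gauss sum of \<open>e(h x\<^sup>2 / a)\<close>. With
  \<open>d = gcd h a\<close> and \<open>q = a/d\<close>, Dirichlet approximation of \<open>h/a\<close> by \<open>u/v\<close> with \<open>v = O(b)\<close>, completion modulo
  \<open>v\<close> and the Kusmin--Landau inequality give
  \<open>S\<^sub>h = O(b / \<surd>q + \<surd>q + \<surd>(min b q) log q)\<close>. The absence of a logarithm at \<open>\<surd>q\<close> is essential;
  the logarithm in the last term only matters for \<open>b > a / log\<^sup>2 a\<close>, where the second error term of the theorem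
  absorbs it. Summation over \<open>h\<close> leaves \<open>\<surd>a log a + b a\<^bsup>-1/2\<^esup> F(a) log\<^sup>4 a\<close> with
  \<open>F(a) = \<Sum>\<^bsub>d | a\<^esub> d\<^bsup>-1/2\<^esup>\<close>.

  Since \<open>log F(a) \<le> \<Sum>\<^bsub>p | a\<^esub> (p\<^bsup>-1/2\<^esup> + 4/p)\<close> is largest for primorials, the constant \<open>2\<close> in the exponent requires
  the upper half \<open>\<theta>(x) \<le> (1 + o(1)) x\<close> of the prime number theorem. It follows from the nonvanishing of
  \<open>\<zeta>\<close> on \<open>Re s = 1\<close> by a one-sided Wiener--Ikehara argument: smoothing with the Fejer kernel \<open>K\<close>,
  \<open>\<Sum> (\<Lambda>(n) - 1) n\<^sup>-\<^sup>1 K(y - log n)\<close> is the Fourier integral at \<open>y\<close> of a continuous function with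
  compact support, hence tends to \<open>0\<close>, while the sum without \<open>\<Lambda>\<close> is a Riemann sum for \<open>\<integral> K\<close>.
\<close>

section \<open>Exponential sums\<close>

text \<open>The weights 1/h already cost one factor ln a, so a second logarithm at sqrt a cannot be
  afforded for small b, and completion modulo q itself would attach one to sqrt q. A denominator v =
  O(b) confines the logarithm to sqrt v. The zero frequency contributes the sum with phase \<beta>
  x^2 divided by sqrt v, where \<beta> = h/q - u/v is a nonzero fraction with denominator q v. That
  sum is therefore O(sqrt (q v)), v cancels, and sqrt q is left without a logarithm. On the
  arithmetic side the exponent asks for ln F(a) <= (2 + o(1)) sqrt L / ln L with L = ln a. The prime
  factors of a satisfy sum ln p <= L, and under this constraint the sum of p^(-1/2) is governed by
  theta(x) up to x = L. A Chebyshev bound theta(x) <= c x would give 1 + c instead of 2 in this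
  argument, while powers of L such as ln^4 a only affect the o(1). Since theta enters from above
  only, the Tauberian step can discard nonnegative terms and pass to the line Re s = 1 on finite
  sums.\<close>

definition e1 :: "real \<Rightarrow> complex" where "e1 t = cis (2 * pi * t)"

lemma e1_add: "e1 (x + y) = e1 x * e1 y"
  by (simp add: e1_def cis_mult distrib_left)

lemma e1_0 [simp]: "e1 0 = 1" by (simp add: e1_def)

lemma norm_e1 [simp]: "norm (e1 x) = 1" by (simp add: e1_def)

lemma e1_nonzero [simp]: "e1 x \<noteq> 0" by (simp add: e1_def)

lemma e1_minus: "e1 (- x) = inverse (e1 x)"
  by (simp add: e1_def)

lemma cnj_e1: "cnj (e1 x) = e1 (- x)"
  by (simp add: e1_def cis_cnj)

lemma e1_int: "x \<in> \<int> \<Longrightarrow> e1 x = 1"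
  by (simp add: e1_def cis_multiple_2pi)

lemma e1_add_int: "n \<in> \<int> \<Longrightarrow> e1 (x + n) = e1 x"
  by (simp add: e1_add e1_int)

lemma e1_power: "e1 x ^ n = e1 (real n * x)"
  unfolding e1_def Complex.DeMoivre by (simp add: mult_ac)

lemma norm_1_minus_e1: "norm (1 - e1 t) = 2 * \<bar>sin (pi * t)\<bar>"
proof -
  have "(norm (1 - e1 t))\<^sup>2 = (1 - cos (2 * (pi * t)))\<^sup>2 + (sin (2 * (pi * t)))\<^sup>2"
    by (simp add: cmod_power2 e1_def mult.assoc)
  also have "\<dots> = 2 - 2 * cos (2 * (pi * t))"
    using sin_cos_squared_add[of "2 * (pi * t)"] by (simp add: power2_eq_square algebra_simps)
  also have "\<dots> = (2 * \<bar>sin (pi * t)\<bar>)\<^sup>2"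
    by (simp add: cos_double_sin power_mult_distrib)
  finally show ?thesis
    by (rule power2_eq_imp_eq) auto
qed

lemma sin_ge_mult_cos: "0 \<le> x \<Longrightarrow> x \<le> pi \<Longrightarrow> x * cos x \<le> sin x" for x :: real
proof -
  assume x: "0 \<le> x" "x \<le> pi"
  have "(\<lambda>x. sin x - x * cos x) 0 \<le> (\<lambda>x. sin x - x * cos x) x"
  proof (rule DERIV_nonneg_imp_nondecreasing[OF x(1)])
    fix y assume y: "0 \<le> y" "y \<le> x"
    show "\<exists>d. ((\<lambda>x. sin x - x * cos x) has_real_derivative d) (at y) \<and> 0 \<le> d"
      using y x by (intro exI[of _ "y * sin y"] conjI mult_nonneg_nonneg sin_ge_zero)
        (auto intro!: derivative_eq_intros)
  qed
  thus ?thesis by simp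
qed

text \<open>Halving the angle makes \<open>sin_ge_mult_cos\<close> effective up to pi/2: sin x = 2
  sin(x/2) cos(x/2) >= x cos(x/2)^2, and cos(x/2)^2 >= 1/2 as long as cos x >= 0.\<close>

lemma sin_ge_half: "0 \<le> x \<Longrightarrow> x \<le> pi / 2 \<Longrightarrow> x / 2 \<le> sin x" for x :: real
proof -
  assume x: "0 \<le> x" "x \<le> pi / 2"
  have c0: "0 \<le> cos (x / 2)" using x by (intro cos_ge_zero) auto
  have "0 \<le> cos x" using x by (intro cos_ge_zero) auto
  hence c: "1 / 2 \<le> cos (x/2) * cos (x/2)"
    using cos_double_cos[of "x/2"] by (simp add: power2_eq_square)
  have "x / 2 \<le> 2 * ((x / 2) * (cos (x/2) * cos (x/2)))"
    using mult_left_mono[OF c x(1)] by simp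
  also have "\<dots> = 2 * (((x / 2) * cos (x/2)) * cos (x/2))" by simp
  also have "\<dots> \<le> 2 * (sin (x/2) * cos (x/2))"
    using x c0 by (intro mult_left_mono mult_right_mono sin_ge_mult_cos) auto
  also have "\<dots> = sin x" using sin_double[of "x/2"] by simp
  finally show ?thesis .
qed

text \<open>The symmetry t -> 1 - t reduces to t <= 1/2, where 2 sin(pi t) >= pi t. The constant 3
  is a rational stand-in for pi.\<close>

lemma norm_1_minus_e1_ge:
  assumes "0 \<le> d" "d \<le> t" "t \<le> 1 - d"
  shows "3 * d \<le> norm (1 - e1 t)"
proof -
  have 1: "3 * u \<le> 2 * sin (pi * u)" if "0 \<le> u" "u \<le> 1/2" for u
  proof -
    have "3 * u \<le> pi * u" using that pi_gt3 by (intro mult_right_mono) auto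
    moreover have "pi * u / 2 \<le> sin (pi * u)"
      using that mult_left_mono[of u "1/2" pi] by (intro sin_ge_half) auto
    ultimately show ?thesis by simp
  qed
  show ?thesis
  proof (cases "t \<le> 1/2")
    case True
    thus ?thesis using assms 1[of t] by (simp add: norm_1_minus_e1)
  next
    case False
    have "sin (pi * (1 - t)) = sin (pi * t)"
      using sin_pi_minus[of "pi * t"] by (simp add: algebra_simps)
    thus ?thesis using assms 1[of "1 - t"] False by (simp add: norm_1_minus_e1)
  qed
qed

lemma e1_eq_1_iff_frac: "0 < t \<Longrightarrow> t < 1 \<Longrightarrow> e1 t \<noteq> 1"
  using norm_1_minus_e1[of t] sin_gt_zero[of "pi * t"] by auto

section \<open>Finite Fourier analysis modulo a\<close>

lemma sum_e1_roots:
  fixes a :: nat and m :: int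
  assumes a: "a > 0"
  shows "(\<Sum>h<a. e1 (real h * real_of_int m / real a)) = (if int a dvd m then of_nat a else 0)"
proof (cases "int a dvd m")
  case True
  then obtain k where "m = int a * k" by auto
  hence "real h * real_of_int m / real a = real_of_int (int h * k)" for h
    using a by simp
  hence "e1 (real h * real_of_int m / real a) = 1" for h
    by (metis Ints_of_int e1_int)
  thus ?thesis using True by simp
next
  case False
  define z where "z = e1 (real_of_int m / real a)"
  have zne: "z \<noteq> 1"
  proof -
    define r where "r = m mod int a"
    have "r \<noteq> 0" using False unfolding r_def by (metis dvd_eq_mod_eq_0)
    hence r: "0 < r" "r < int a" using a pos_mod_sign[of "int a" m] pos_mod_bound[of "int a" m]
      unfolding r_def by linarith+
    have "real_of_int m / real a = real_of_int r / real a + real_of_int (m div int a)"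
    proof -
      have "m = int a * (m div int a) + r" by (simp add: r_def)
      hence "real_of_int m = real_of_int (int a * (m div int a) + r)" by presburger
      hence "real_of_int m = real a * real_of_int (m div int a) + real_of_int r" by simp
      thus ?thesis using a by (simp only: add_divide_distrib) simp
    qed
    hence "z = e1 (real_of_int r / real a)"
      unfolding z_def by (metis Ints_of_int e1_add_int)
    thus ?thesis using r a e1_eq_1_iff_frac[of "real_of_int r / real a"] by simp
  qed
  have "(\<Sum>h<a. e1 (real h * real_of_int m / real a)) = (\<Sum>h<a. z ^ h)"
    by (simp add: z_def e1_power)
  also have "\<dots> = (z ^ a - 1) / (z - 1)" using zne by (simp add: geometric_sum)
  also have "z ^ a = 1" using a by (simp add: z_def e1_power e1_int)
  finally show ?thesis using False by simp
qed

text \<open>Telescoping in m avoids evaluating any Fourier coefficient. The denominators e(-h/a) - 1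
  cancel in f m - f (m + 1), which orthogonality then evaluates; so f grows by 1 at each step inside
  a period, and its vanishing mean over a period fixes the constant.\<close>

lemma sawtooth_fourier:
  fixes a m :: nat
  assumes a: "a > 0"
  shows "of_nat (m mod a) = (of_nat a - 1) / 2 +
     (\<Sum>h=1..<a. e1 (real h * real m / real a) / (e1 (- real h / real a) - 1))"
proof -
  define f where "f m = (\<Sum>h=1..<a. e1 (real h * real m / real a) / (e1 (- real h / real a) - 1))" for m
  have ne: "e1 (- real h / real a) \<noteq> 1" if "h \<in> {1..<a}" for h
  proof -
    have "e1 (real h / real a) \<noteq> 1" using that by (intro e1_eq_1_iff_frac) auto
    thus ?thesis by (simp add: e1_minus)
  qed
  have split0: "(\<Sum>h<a. F h) = F 0 + (\<Sum>h=1..<a. F h)" for F :: "nat \<Rightarrow> complex"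
    using a by (simp add: lessThan_atLeast0 sum.atLeast_Suc_lessThan)
  have step: "f m - f (Suc m) = (if a dvd Suc m then of_nat a else 0) - 1" for m
  proof -
    have "f m - f (Suc m) = (\<Sum>h=1..<a. e1 (real h * real_of_int (int (Suc m)) / real a))"
      unfolding f_def sum_subtractf [symmetric]
    proof (rule sum.cong)
      fix h assume h: "h \<in> {1..<a}"
      have "e1 (real h * real m / real a) = e1 (real h * real (Suc m) / real a) * e1 (- real h / real a)"
        by (subst e1_add [symmetric]) (simp add: field_simps add_divide_distrib)
      thus "e1 (real h * real m / real a) / (e1 (- real h / real a) - 1) -
         e1 (real h * real (Suc m) / real a) / (e1 (- real h / real a) - 1) =
         e1 (real h * real_of_int (int (Suc m)) / real a)"
        using ne[OF h] by (simp add: divide_simps) (simp add: algebra_simps)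
    qed simp
    also have "\<dots> = (\<Sum>h<a. e1 (real h * real_of_int (int (Suc m)) / real a)) - 1"
      by (subst split0) simp
    also have "\<dots> = (if a dvd Suc m then of_nat a else 0) - 1"
      by (subst sum_e1_roots[OF a]) (simp only: of_nat_dvd_iff)
    finally show ?thesis .
  qed
  have lin: "f m = f 0 + of_nat m" if "m < a" for m
    using that
  proof (induction m)
    case (Suc m)
    have "\<not> a dvd Suc m" using Suc.prems by (auto dest: dvd_imp_le)
    with step[of m] Suc show ?case by (simp add: algebra_simps)
  qed simp
  have "(\<Sum>m<a. f m) = 0"
  proof -
    have "(\<Sum>m<a. f m) = (\<Sum>h=1..<a. (\<Sum>m<a. e1 (real m * real_of_int (int h) / real a)) / (e1 (- real h / real a) - 1))"
      unfolding f_def by (subst sum.swap) (simp add: sum_divide_distrib mult.commute)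
    also have "\<dots> = 0"
    proof (intro sum.neutral ballI)
      fix h assume "h \<in> {1..<a}"
      hence "\<not> int a dvd int h" by (auto dest: dvd_imp_le)
      thus "(\<Sum>m<a. e1 (real m * real_of_int (int h) / real a)) / (e1 (- real h / real a) - 1) = 0"
        by (subst sum_e1_roots[OF a]) simp
    qed
    finally show ?thesis .
  qed
  moreover have "(\<Sum>m<a. f m) = of_nat a * f 0 + of_nat a * (of_nat a - 1) / 2"
  proof -
    have "(\<Sum>m<a. f m) = (\<Sum>m<a. f 0 + of_nat m)" by (intro sum.cong refl lin) auto
    also have "\<dots> = of_nat a * f 0 + (\<Sum>m<a. of_nat m)" by (simp add: sum.distrib)
    also have "(\<Sum>m<a. of_nat m :: complex) = of_nat a * (of_nat a - 1) / 2"
      by (induction a) (simp_all add: field_simps)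
    finally show ?thesis .
  qed
  ultimately have "of_nat a * (f 0 + (of_nat a - 1) / 2) = 0" by (simp add: distrib_left)
  hence f0: "f 0 = - ((of_nat a - 1) / 2)"
    using a by (metis add_eq_0_iff2 mult_eq_0_iff of_nat_0_eq_iff less_numeral_extra(3))
  have per: "f (m + a * k) = f m" for m k
  proof -
    have "e1 (real h * real (m + a * k) / real a) = e1 (real h * real m / real a)" for h
    proof -
      have "real h * real (m + a * k) / real a = real h * real m / real a + real (h * k)"
        using a by (simp add: distrib_left add_divide_distrib)
      thus ?thesis by (metis Ints_of_nat e1_add_int)
    qed
    thus ?thesis by (simp add: f_def)
  qed
  have "f m = f (m mod a)" using per[of "m mod a" "m div a"] by simp
  also have "\<dots> = f 0 + of_nat (m mod a)" using a by (intro lin) auto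
  finally have "of_nat (m mod a) = - f 0 + f m" by simp
  thus ?thesis unfolding f0 by (simp add: f_def)
qed

section \<open>The Kusmin--Landau inequality\<close>

lemma cot_antimono:
  fixes x y :: real
  assumes "0 < x" "x \<le> y" "y < pi"
  shows "cos y / sin y \<le> cos x / sin x"
proof -
  have "0 \<le> sin (y - x)" using assms by (intro sin_ge_zero) auto
  moreover have "0 < sin x" "0 < sin y" using assms by (auto intro!: sin_gt_zero)
  ultimately show ?thesis by (simp add: sin_diff field_simps)
qed

lemma inverse_1_minus_e1:
  assumes "0 < t" "t < 1"
  shows "1 / (1 - e1 t) = Complex (1/2) (cos (pi * t) / sin (pi * t) / 2)"
proof -
  have s: "sin (pi * t) > 0" using assms by (intro sin_gt_zero) auto
  have "Complex (1/2) (cos (pi * t) / sin (pi * t) / 2) * (1 - e1 t) = 1"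
  proof -
    have c: "cos (2 * pi * t) = 1 - 2 * sin (pi*t) * sin (pi*t)"
      using cos_double_sin[of "pi*t"] by (simp add: power2_eq_square mult.assoc)
    have d: "sin (2 * pi * t) = 2 * sin (pi*t) * cos (pi*t)"
      using sin_double[of "pi*t"] by (simp add: mult.assoc)
    define S C where "S = sin (pi * t)" and "C = cos (pi * t)"
    have q: "C * C = 1 - S * S" using sin_cos_squared_add[of "pi*t"]
      by (simp add: S_def C_def power2_eq_square algebra_simps)
    have "1 - e1 t = Complex (2 * S * S) (- 2 * S * C)"
      by (simp add: complex_eq_iff e1_def c d S_def C_def)
    moreover have "Complex (1/2) (C / S / 2) * Complex (2 * S * S) (- 2 * S * C) = 1"
      using s q by (simp add: complex_eq_iff S_def [symmetric])
    ultimately show ?thesis by (simp add: S_def C_def)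
  qed
  moreover have "1 - e1 t \<noteq> 0" using e1_eq_1_iff_frac[OF assms] by simp
  ultimately show ?thesis by (simp add: field_simps)
qed

lemma abel_sum_diff:
  fixes c E :: "nat \<Rightarrow> complex"
  shows "(\<Sum>n<Suc N. c n * (E n - E (Suc n))) =
    c 0 * E 0 - c N * E (Suc N) + (\<Sum>n<N. (c (Suc n) - c n) * E (Suc n))"
  by (induction N) (auto simp: algebra_simps)

text \<open>The Abel coefficients \<open>1 / (1 - e(g))\<close> have real part \<open>1/2\<close> and imaginary part
  \<open>cot (\<pi> g) / 2\<close>, so their total variation telescopes.\<close>
lemma kusmin_landau:
  fixes f :: "nat \<Rightarrow> real"
  assumes mono: "(\<forall>n<N. \<forall>m<N. n \<le> m \<longrightarrow> f (Suc n) - f n \<le> f (Suc m) - f m) \<or>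
                 (\<forall>n<N. \<forall>m<N. n \<le> m \<longrightarrow> f (Suc m) - f m \<le> f (Suc n) - f n)"
    and d: "0 < d" "\<And>n. n < N \<Longrightarrow> d \<le> f (Suc n) - f n" "\<And>n. n < N \<Longrightarrow> f (Suc n) - f n \<le> 1 - d"
  shows "norm (\<Sum>n<N. e1 (f n)) \<le> 2 / d"
proof (cases N)
  case 0
  thus ?thesis using d by simp
next
  case (Suc M)
  define g where "g n = f (Suc n) - f n" for n
  define c where "c n = 1 / (1 - e1 (g n))" for n
  have g: "0 < g n" "g n < 1" "d \<le> g n" "g n \<le> 1 - d" if "n < N" for n
    using d(1) d(2,3)[OF that] by (auto simp: g_def)
  have cn: "norm (c n) \<le> 1 / (3 * d)" if "n < N" for n
    using norm_1_minus_e1_ge[of d "g n"] g[OF that] d(1)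
    unfolding c_def norm_divide by (simp add: divide_simps)
  have cc: "c n = Complex (1/2) (cos (pi * g n) / sin (pi * g n) / 2)" if "n < N" for n
    unfolding c_def using g[OF that] by (intro inverse_1_minus_e1) auto
  define k where "k n = cos (pi * g n) / sin (pi * g n) / 2" for n
  have kd: "norm (c (Suc n) - c n) = \<bar>k (Suc n) - k n\<bar>" if "Suc n < N" for n
    using cc[of n] cc[of "Suc n"] that by (simp add: k_def cmod_def)
  have kn: "\<bar>k n\<bar> \<le> 1 / (3 * d)" if "n < N" for n
  proof -
    have "\<bar>Im (c n)\<bar> \<le> norm (c n)" by (rule abs_Im_le_cmod)
    thus ?thesis using cn[OF that] cc[OF that] by (simp add: k_def)
  qed
  have kle: "k m \<le> k n" if "g n \<le> g m" "n < N" "m < N" for n m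
    unfolding k_def using that g by (intro divide_right_mono cot_antimono) auto
  have var: "(\<Sum>n<M. \<bar>k (Suc n) - k n\<bar>) = \<bar>k M - k 0\<bar>"
    using mono
  proof
    assume "\<forall>n<N. \<forall>m<N. n \<le> m \<longrightarrow> f (Suc n) - f n \<le> f (Suc m) - f m"
    hence "k m \<le> k n" if "n \<le> m" "m < N" for n m using that by (intro kle) (auto simp: g_def)
    hence "(\<Sum>n<M. \<bar>k (Suc n) - k n\<bar>) = (\<Sum>n<M. - (k (Suc n) - k n))" "k M \<le> k 0"
      using Suc by (simp_all add: abs_of_nonpos abs_of_nonneg)
    thus ?thesis using sum_lessThan_telescope[of k M] by (simp only: sum_negf)
  next
    assume "\<forall>n<N. \<forall>m<N. n \<le> m \<longrightarrow> f (Suc m) - f m \<le> f (Suc n) - f n"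
    hence "k n \<le> k m" if "n \<le> m" "m < N" for n m using that by (intro kle) (auto simp: g_def)
    hence "(\<Sum>n<M. \<bar>k (Suc n) - k n\<bar>) = (\<Sum>n<M. (k (Suc n) - k n))" "k 0 \<le> k M"
      using Suc by (simp_all add: abs_of_nonpos abs_of_nonneg)
    thus ?thesis using sum_lessThan_telescope[of k M] by simp
  qed
  \<comment> \<open>Since e(f (n + 1)) = e(f n) e(g n), each term is c n times a difference of
    consecutive values, which is the shape needed for partial summation.\<close>
  have "(\<Sum>n<N. e1 (f n)) = (\<Sum>n<Suc M. c n * (e1 (f n) - e1 (f (Suc n))))"
    unfolding Suc
  proof (rule sum.cong)
    fix n assume "n \<in> {..<Suc M}"
    hence n: "n < N" using Suc by simp
    have "e1 (f (Suc n)) = e1 (f n) * e1 (g n)"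
      by (subst e1_add [symmetric]) (simp add: g_def)
    moreover have "1 - e1 (g n) \<noteq> 0" using e1_eq_1_iff_frac[of "g n"] g[OF n] by simp
    ultimately show "e1 (f n) = c n * (e1 (f n) - e1 (f (Suc n)))"
      by (simp add: c_def field_simps)
  qed simp
  also have "\<dots> = c 0 * e1 (f 0) - c M * e1 (f (Suc M)) + (\<Sum>n<M. (c (Suc n) - c n) * e1 (f (Suc n)))"
    by (rule abel_sum_diff)
  also have "norm \<dots> \<le> norm (c 0) + norm (c M) + (\<Sum>n<M. norm (c (Suc n) - c n))"
    by (intro order.trans[OF norm_triangle_ineq] add_mono order.trans[OF norm_triangle_ineq4] order.trans[OF norm_sum])
      (auto simp: norm_mult)
  also have "(\<Sum>n<M. norm (c (Suc n) - c n)) = \<bar>k M - k 0\<bar>"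
    unfolding var[symmetric] using Suc by (intro sum.cong kd) auto
  \<comment> \<open>The two boundary coefficients give 2/(3d), and the total variation of
    \<open>k\<close> at most another 2/(3d).\<close>
  also have "norm (c 0) + norm (c M) + \<bar>k M - k 0\<bar> \<le> 4 * (1 / (3 * d))"
    using cn[of 0] cn[of M] kn[of 0] kn[of M] Suc by linarith
  also have "\<dots> \<le> 2 / d" using d(1) by (simp add: field_simps)
  finally show ?thesis .
qed

section \<open>Complete Gauss sums\<close>

lemma periodic_sum_shift:
  fixes F :: "nat \<Rightarrow> 'a::ab_group_add"
  assumes "\<And>k. F (k + v) = F k"
  shows "(\<Sum>k<v. F (s + k)) = (\<Sum>k<v. F k)"
proof (induction s)
  case (Suc s)
  have "(\<Sum>k<v. F (Suc s + k)) = (\<Sum>k<v. F (s + Suc k))" by simp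
  also have "\<dots> = (\<Sum>k<Suc v. F (s + k)) - F s"
    by (subst sum.lessThan_Suc_shift) simp
  also have "\<dots> = (\<Sum>k<v. F (s + k))" using assms[of s] by simp
  finally show ?case using Suc by simp
qed simp

text \<open>Squaring and substituting r = s + k makes the sum over s geometric with frequency 2 u k;
  the linear term b only rotates F k. At most the shifts k = 0 and k = v/2 survive, and the second
  one, for even v, accounts for the factor 2.\<close>

lemma gauss_sum_bound:
  fixes u b :: int and v :: nat
  assumes v: "v > 0" and cop: "coprime u (int v)"
  shows "norm (\<Sum>r<v. e1 ((real_of_int u * (real r)\<^sup>2 + real_of_int b * real r) / real v)) \<le> sqrt (2 * real v)"
proof -
  define F where "F r = e1 ((real_of_int u * (real r)\<^sup>2 + real_of_int b * real r) / real v)" for r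
  define G where "G = (\<Sum>r<v. F r)"
  have per: "F (k + v) = F k" for k
  proof -
    have "(real_of_int u * (real (k + v))\<^sup>2 + real_of_int b * real (k + v)) / real v =
      (real_of_int u * (real k)\<^sup>2 + real_of_int b * real k) / real v + real_of_int (2 * u * int k + u * int v + b)"
      using v by (simp add: field_simps power2_eq_square)
    thus ?thesis unfolding F_def by (metis Ints_of_int e1_add_int)
  qed
  have shift: "F (s + k) * cnj (F s) = F k * e1 (real s * real_of_int (2 * u * int k) / real v)" for s k
    unfolding F_def cnj_e1 e1_add[symmetric] using v
    by (intro arg_cong[where f = e1]) (simp add: field_simps power2_eq_square)
  have "G * cnj G = (\<Sum>s<v. (\<Sum>k<v. F (s + k)) * cnj (F s))"
    using periodic_sum_shift[of F v, OF per] by (simp add: G_def sum_distrib_left)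
  also have "\<dots> = (\<Sum>s<v. \<Sum>k<v. F k * e1 (real s * real_of_int (2 * u * int k) / real v))"
    by (simp only: sum_distrib_right shift)
  also have "\<dots> = (\<Sum>k<v. F k * (\<Sum>s<v. e1 (real s * real_of_int (2 * u * int k) / real v)))"
    by (subst sum.swap) (simp only: sum_distrib_left)
  also have "\<dots> = (\<Sum>k<v. if int v dvd 2 * u * int k then F k * of_nat v else 0)"
    unfolding sum_e1_roots[OF v] by (intro sum.cong) auto
  finally have eq: "G * cnj G = (\<Sum>k<v. if int v dvd 2 * u * int k then F k * of_nat v else 0)" .
  have "(norm G)\<^sup>2 = norm (G * cnj G)" by (simp add: norm_mult power2_eq_square)
  also have "\<dots> \<le> (\<Sum>k<v. if int v dvd 2 * u * int k then real v else 0)"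
    unfolding eq by (intro order.trans[OF norm_sum] sum_mono) (auto simp: norm_mult F_def)
  also have "\<dots> = (\<Sum>k\<in>{k\<in>{..<v}. int v dvd 2 * u * int k}. real v)"
    by (subst sum.inter_filter) auto
  \<comment> \<open>Coprimality leaves v | 2k with k < v, so 2k is 0 or v. For odd v the set on the
    right is merely too large.\<close>
  also have "\<dots> \<le> (\<Sum>k\<in>{0, v div 2}. real v)"
  proof (intro sum_mono2)
    show "{k \<in> {..<v}. int v dvd 2 * u * int k} \<subseteq> {0, v div 2}"
    proof
      fix k assume "k \<in> {k \<in> {..<v}. int v dvd 2 * u * int k}"
      hence k: "k < v" "int v dvd u * (2 * int k)" by (auto simp: mult_ac)
      from k(2) cop have "int v dvd 2 * int k"
        by (metis coprime_commute coprime_dvd_mult_right_iff)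
      hence "int v dvd int (2 * k)" by simp
      hence "v dvd 2 * k" by (simp only: of_nat_dvd_iff)
      then obtain j where j: "2 * k = v * j" by auto
      have "v * j < v * 2" using k(1) j by linarith
      hence "j < 2" using v by (metis mult_less_cancel1)
      hence "j = 0 \<or> j = 1" by auto
      thus "k \<in> {0, v div 2}" using j by auto
    qed
  qed auto
  also have "\<dots> \<le> 2 * real v" by (simp add: card_insert_if)
  finally show ?thesis
    unfolding G_def F_def by (intro real_le_rsqrt)
qed

section \<open>Incomplete quadratic exponential sums\<close>

lemma sum_inverse_le':
  assumes "n \<ge> 1"
  shows "(\<Sum>h=1..n. 1 / real h) \<le> 1 + ln (real n)"
  using assms
proof (induction n rule: nat_induct_at_least)
  case (Suc n)
  have "ln (real n / real (Suc n)) \<le> real n / real (Suc n) - 1"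
    using Suc by (intro ln_le_minus_one) auto
  also have "\<dots> = - (1 / real (Suc n))" by (simp add: field_simps)
  finally have "1 / real (Suc n) \<le> ln (real (Suc n)) - ln (real n)"
    using Suc by (simp add: ln_div)
  thus ?case using Suc by simp
qed simp

lemma sum_inverse_le:
  assumes "n \<ge> 1"
  shows "(\<Sum>h=1..<n. 1 / real h) \<le> 1 + ln (real n)"
  by (rule order.trans[OF sum_mono2 sum_inverse_le'[OF assms]]) auto

text \<open>The phase increments \<beta>(2n + 3) grow linearly and stay at most 1/2. About 1/(2 sqrt
  \<beta>) terms are bounded trivially, until the increments reach sqrt \<beta>; from there on
  Kusmin--Landau gives 2 / sqrt \<beta>.\<close>

lemma norm_sum_quadratic_pos:
  fixes \<beta> :: real
  assumes b: "0 < \<beta>" "\<beta> * (2 * real N + 1) \<le> 1/2"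
  shows "norm (\<Sum>x<N. e1 (\<beta> * (real x + 1)\<^sup>2)) \<le> 4 / sqrt \<beta> + 1"
proof (cases "N = 0")
  case True
  thus ?thesis using b by simp
next
  case False
  define d where "d = sqrt \<beta>"
  have "\<beta> * 3 \<le> \<beta> * (2 * real N + 1)" using False b by (intro mult_left_mono) auto
  hence "\<beta> \<le> 1 / 4" using b by linarith
  hence "\<beta> \<le> (1/2)\<^sup>2" by (simp add: power2_eq_square)
  \<comment> \<open>With d <= 1/2, increments bounded by 1/2 meet the upper requirement 1 - d of
    \<open>kusmin_landau\<close>.\<close>
  hence "d \<le> 1/2" unfolding d_def by (rule real_le_lsqrt[rotated -1]) (use b in auto)
  moreover have dpos: "0 < d" using b by (simp add: d_def)
  ultimately have d: "0 < d" "d \<le> 1/2" by auto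
  have db: "d * d = \<beta>" using b by (simp add: d_def)
  define M where "M = min N (nat \<lceil>1 / (2 * d)\<rceil>)"
  have M: "M \<le> N" "real M \<le> 1 / (2 * d) + 1"
  proof -
    have "real (nat \<lceil>1 / (2 * d)\<rceil>) \<le> 1 / (2 * d) + 1"
      using d by (simp add: of_nat_nat)
    moreover have "real M \<le> real (nat \<lceil>1 / (2 * d)\<rceil>)" by (simp add: M_def)
    ultimately show "real M \<le> 1 / (2 * d) + 1" by linarith
  qed (simp add: M_def)
  define f where "f n = \<beta> * (real (n + M) + 1)\<^sup>2" for n
  have inc: "f (Suc n) - f n = \<beta> * (2 * real (n + M) + 3)" for n
    by (simp add: f_def power2_eq_square algebra_simps)
  have 2: "norm (\<Sum>n<N - M. e1 (f n)) \<le> 2 / d"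
  proof (rule kusmin_landau)
    fix n assume n: "n < N - M"
    hence MM: "M = nat \<lceil>1 / (2 * d)\<rceil>" by (auto simp: M_def min_def split: if_splits)
    have "1 / (2 * d) \<le> real M" unfolding MM by (rule real_nat_ceiling_ge)
    hence "1 \<le> real M * (2 * d)" using d by (simp add: field_simps)
    also have "\<dots> \<le> (2 * real (n + M) + 3) * d" using d by (simp add: algebra_simps)
    finally have "d * 1 \<le> d * ((2 * real (n + M) + 3) * d)" using d by (intro mult_left_mono) auto
    thus "d \<le> f (Suc n) - f n" unfolding inc by (simp add: db[symmetric] mult_ac)
    have "\<beta> * (2 * real (n + M) + 3) \<le> \<beta> * (2 * real N + 1)"
      using n b by (intro mult_left_mono) auto
    thus "f (Suc n) - f n \<le> 1 - d" unfolding inc using b d by linarith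
  next
    show "(\<forall>n<N - M. \<forall>m<N - M. n \<le> m \<longrightarrow> f (Suc n) - f n \<le> f (Suc m) - f m) \<or>
      (\<forall>n<N - M. \<forall>m<N - M. n \<le> m \<longrightarrow> f (Suc m) - f m \<le> f (Suc n) - f n)"
      unfolding inc using b by (intro disjI1) auto
  qed (use d in auto)
  have "(\<Sum>x<N. e1 (\<beta> * (real x + 1)\<^sup>2)) = (\<Sum>x<M. e1 (\<beta> * (real x + 1)\<^sup>2)) + (\<Sum>x\<in>{M..<N}. e1 (\<beta> * (real x + 1)\<^sup>2))"
    using M(1) by (simp add: sum.union_disjoint[symmetric] ivl_disj_un_one(2) lessThan_atLeast0 ivl_disj_un_two(3))
  also have "(\<Sum>x\<in>{M..<N}. e1 (\<beta> * (real x + 1)\<^sup>2)) = (\<Sum>n<N - M. e1 (f n))"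
    using M(1) by (intro sum.reindex_bij_witness[of _ "\<lambda>n. n + M" "\<lambda>x. x - M"]) (auto simp: f_def)
  also have "norm ((\<Sum>x<M. e1 (\<beta> * (real x + 1)\<^sup>2)) + (\<Sum>n<N - M. e1 (f n))) \<le> real M + 2 / d"
    by (intro order.trans[OF norm_triangle_ineq] add_mono 2 order.trans[OF norm_sum]) simp
  also have "\<dots> \<le> 4 / d + 1" using M(2) d divide_pos_pos[of 1 d] by (simp add: divide_simps)
  finally show ?thesis by (simp add: d_def)
qed

lemma norm_sum_quadratic:
  fixes \<beta> :: real
  assumes b: "\<beta> \<noteq> 0" "\<bar>\<beta>\<bar> * (2 * real N + 1) \<le> 1/2"
  shows "norm (\<Sum>x<N. e1 (\<beta> * (real x + 1)\<^sup>2)) \<le> 4 / sqrt \<bar>\<beta>\<bar> + 1"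
proof (cases "\<beta> > 0")
  case True
  thus ?thesis using norm_sum_quadratic_pos[of \<beta> N] b by simp
next
  case False
  have "norm (\<Sum>x<N. e1 (\<beta> * (real x + 1)\<^sup>2)) = norm (cnj (\<Sum>x<N. e1 (\<beta> * (real x + 1)\<^sup>2)))"
    by (rule complex_mod_cnj [symmetric])
  also have "cnj (\<Sum>x<N. e1 (\<beta> * (real x + 1)\<^sup>2)) = (\<Sum>x<N. e1 ((- \<beta>) * (real x + 1)\<^sup>2))"
    by (simp add: cnj_e1)
  finally show ?thesis using norm_sum_quadratic_pos[of "- \<beta>" N] b False by simp
qed

lemma sqrt2_le: "sqrt 2 \<le> 3/2" by (intro real_le_lsqrt) (auto simp: power2_eq_square)

lemma sum_inverse_sym_le:
  assumes "v \<ge> 1"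
  shows "(\<Sum>b=1..<v. 1 / real b + 1 / real (v - b)) \<le> 2 * (1 + ln (real v))"
proof -
  have "(\<Sum>b=1..<v. 1 / real (v - b)) = (\<Sum>b=1..<v. 1 / real b)"
    by (rule sum.reindex_bij_witness[of _ "\<lambda>b. v - b" "\<lambda>b. v - b"]) auto
  thus ?thesis using sum_inverse_le[OF assms] by (simp add: sum.distrib)
qed

lemma inverse_min_le: "0 < b \<Longrightarrow> b < v \<Longrightarrow> 1 / real (min b (v - b)) \<le> 1 / real b + 1 / real (v - b)"
  by (auto simp: min_def)

text \<open>Completing the factor \<open>e(u x\<^sup>2 / v)\<close> gives Gauss sums; every frequency \<open>b \<noteq> 0\<close> is then
  bounded by Kusmin--Landau.\<close>
lemma weyl_sum_near_rational:
  fixes u :: int and v N :: nat and \<beta> B :: real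
  assumes v: "v > 0" and cop: "coprime u (int v)"
    and beta: "\<bar>\<beta>\<bar> * (2 * real N + 1) \<le> 1 / (2 * real v)"
    and B: "norm (\<Sum>x<N. e1 (\<beta> * (real x + 1)\<^sup>2)) \<le> B"
  shows "norm (\<Sum>x<N. e1 ((real_of_int u / real v + \<beta>) * (real x + 1)\<^sup>2)) \<le>
    sqrt 2 * B / sqrt (real v) + 12 * sqrt (real v) * (1 + ln (real v))"
proof -
  define G where "G b = (\<Sum>r<v. e1 ((real_of_int u * (real r)\<^sup>2 + real_of_int (- int b) * real r) / real v))" for b :: nat
  define T where "T b = (\<Sum>x<N. e1 (\<beta> * (real x + 1)\<^sup>2 + real b * (real x + 1) / real v))" for b :: nat
  have G: "norm (G b) \<le> sqrt (2 * real v)" for b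
    unfolding G_def by (rule gauss_sum_bound[OF v cop])
  have T0: "norm (T 0) \<le> B" using B by (simp add: T_def)
  \<comment> \<open>The \<beta>-part moves the increment by at most 1/(2v), half the spacing of the
    fractions b/v. The increment therefore keeps distance at least m/(2v) from the integers, with m
    = min(b, v - b).\<close>
  have Tb: "norm (T b) \<le> 4 * real v * (1 / real b + 1 / real (v - b))" if b: "b \<in> {1..<v}" for b
  proof -
    define m where "m = real (min b (v - b))"
    have m: "m > 0" "m \<le> real b" "m \<le> real v - real b" "1 \<le> real b" using b by (auto simp: m_def min_def)
    have "norm (T b) \<le> 2 / (m / (2 * real v))"
      unfolding T_def
    proof (rule kusmin_landau)
      let ?f = "\<lambda>x. \<beta> * (real x + 1)\<^sup>2 + real b * (real x + 1) / real v"
      have inc: "?f (Suc n) - ?f n = \<beta> * (2 * real n + 3) + real b / real v" for n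
        using v by (simp add: field_simps power2_eq_square)
      show "(\<forall>n<N. \<forall>m<N. n \<le> m \<longrightarrow> ?f (Suc n) - ?f n \<le> ?f (Suc m) - ?f m) \<or>
        (\<forall>n<N. \<forall>m<N. n \<le> m \<longrightarrow> ?f (Suc m) - ?f m \<le> ?f (Suc n) - ?f n)"
        unfolding inc by (cases "\<beta> \<ge> 0") (auto intro: mult_left_mono mult_left_mono_neg)
      fix n assume n: "n < N"
      have "\<bar>\<beta> * (2 * real n + 3)\<bar> \<le> \<bar>\<beta>\<bar> * (2 * real N + 1)"
        unfolding abs_mult using n by (intro mult_left_mono) auto
      with beta have small: "\<bar>\<beta> * (2 * real n + 3)\<bar> \<le> 1 / (2 * real v)" by linarith
      have "m + 1 \<le> 2 * real b" using m by linarith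
      hence b1: "m / (2 * real v) \<le> real b / real v - 1 / (2 * real v)"
        using v by (simp add: field_simps)
      have "real b + 1 \<le> real v" using b by auto
      hence "(2 * real b + 1 + m) / (2 * real v) \<le> 1" using m v by (simp add: divide_le_eq)
      moreover have "real b / real v + 1 / (2 * real v) + m / (2 * real v) = (2 * real b + 1 + m) / (2 * real v)"
        using v by (simp add: field_simps)
      ultimately have b2: "real b / real v + 1 / (2 * real v) \<le> 1 - m / (2 * real v)" by linarith
      show "m / (2 * real v) \<le> ?f (Suc n) - ?f n" unfolding inc using b1 small by linarith
      show "?f (Suc n) - ?f n \<le> 1 - m / (2 * real v)" unfolding inc using b2 small by linarith
    qed (use m v in auto)
    also have "\<dots> = 4 * real v * (1 / m)" using v m by (simp add: field_simps)
    also have "\<dots> \<le> 4 * real v * (1 / real b + 1 / real (v - b))"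
      unfolding m_def using b by (intro mult_left_mono inverse_min_le) auto
    finally show ?thesis .
  qed
  \<comment> \<open>Discrete Fourier inversion modulo v: the phase depends only on the residue
    \<open>r0\<close> of x + 1, and the sign of the linear term in \<open>G\<close> makes G b the
    coefficient of e(b (x + 1)/v).\<close>
  have ex: "of_nat v * e1 (real_of_int u / real v * (real x + 1)\<^sup>2) = (\<Sum>b<v. G b * e1 (real b * (real x + 1) / real v))" for x :: nat
  proof -
    define r0 where "r0 = Suc x mod v"
    have r0: "r0 < v" using v by (simp add: r0_def)
    have "(\<Sum>b<v. G b * e1 (real b * (real x + 1) / real v)) =
      (\<Sum>b<v. \<Sum>r<v. e1 (real_of_int u * (real r)\<^sup>2 / real v) * e1 (real b * real_of_int (int (Suc x) - int r) / real v))"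
      unfolding G_def sum_distrib_right e1_add[symmetric] using v
      by (intro sum.cong refl arg_cong[where f = e1]) (simp add: field_simps)
    also have "\<dots> = (\<Sum>r<v. e1 (real_of_int u * (real r)\<^sup>2 / real v) * (\<Sum>b<v. e1 (real b * real_of_int (int (Suc x) - int r) / real v)))"
      by (subst sum.swap) (simp only: sum_distrib_left)
    also have "\<dots> = (\<Sum>r<v. if r = r0 then e1 (real_of_int u * (real r)\<^sup>2 / real v) * of_nat v else 0)"
    proof (intro sum.cong refl)
      fix r assume "r \<in> {..<v}"
      hence "int v dvd (int (Suc x) - int r) \<longleftrightarrow> r = r0"
        unfolding r0_def by (metis mod_eq_dvd_iff zmod_int lessThan_iff mod_less of_nat_eq_iff)
      thus "e1 (real_of_int u * (real r)\<^sup>2 / real v) * (\<Sum>b<v. e1 (real b * real_of_int (int (Suc x) - int r) / real v)) =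
         (if r = r0 then e1 (real_of_int u * (real r)\<^sup>2 / real v) * of_nat v else 0)"
        unfolding sum_e1_roots[OF v] by simp
    qed
    also have "\<dots> = of_nat v * e1 (real_of_int u * (real r0)\<^sup>2 / real v)"
      using r0 by (simp add: sum.delta)
    also have "e1 (real_of_int u * (real r0)\<^sup>2 / real v) = e1 (real_of_int u / real v * (real x + 1)\<^sup>2)"
    proof -
      define k where "k = Suc x div v"
      have "Suc x = k * v + r0" by (simp add: k_def r0_def)
      hence xk: "real x + 1 = real k * real v + real r0"
        by (metis of_nat_Suc of_nat_add of_nat_mult add.commute)
      have "real_of_int u / real v * (real x + 1)\<^sup>2 = real_of_int u * (real r0)\<^sup>2 / real v
          + real_of_int (u * (int k * int k * int v + 2 * int k * int r0))"
        unfolding xk using v by (simp add: field_simps power2_eq_square)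
      thus ?thesis by (metis Ints_of_int e1_add_int)
    qed
    finally show ?thesis by simp
  qed
  have "of_nat v * (\<Sum>x<N. e1 ((real_of_int u / real v + \<beta>) * (real x + 1)\<^sup>2)) =
     (\<Sum>x<N. (of_nat v * e1 (real_of_int u / real v * (real x + 1)\<^sup>2)) * e1 (\<beta> * (real x + 1)\<^sup>2))"
    by (simp add: sum_distrib_left distrib_right e1_add mult.assoc)
  also have "\<dots> = (\<Sum>x<N. \<Sum>b<v. G b * e1 (\<beta> * (real x + 1)\<^sup>2 + real b * (real x + 1) / real v))"
    unfolding ex by (simp add: sum_distrib_left sum_distrib_right e1_add mult_ac)
  also have "\<dots> = (\<Sum>b<v. G b * T b)"
    by (subst sum.swap) (simp add: T_def sum_distrib_left)
  also have "norm \<dots> \<le> (\<Sum>b<v. sqrt (2 * real v) * norm (T b))"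
    by (intro order.trans[OF norm_sum] sum_mono) (auto simp: norm_mult intro!: mult_right_mono G)
  also have "\<dots> = sqrt (2 * real v) * (norm (T 0) + (\<Sum>b=1..<v. norm (T b)))"
    using v by (simp add: lessThan_atLeast0 sum.atLeast_Suc_lessThan sum_distrib_left[symmetric] distrib_left)
  \<comment> \<open>Frequency 0 keeps the \<beta>-sum alone, hence B; the other frequencies produce
    the logarithm.\<close>
  also have "\<dots> \<le> sqrt (2 * real v) * (B + (\<Sum>b=1..<v. 4 * real v * (1 / real b + 1 / real (v - b))))"
    by (intro mult_left_mono add_mono T0 sum_mono Tb) auto
  also have "\<dots> \<le> sqrt (2 * real v) * (B + 4 * real v * (2 * (1 + ln (real v))))"
    using v unfolding sum_distrib_left[symmetric]
    by (intro mult_left_mono add_left_mono sum_inverse_sym_le) auto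
  finally have "real v * norm (\<Sum>x<N. e1 ((real_of_int u / real v + \<beta>) * (real x + 1)\<^sup>2)) \<le>
     sqrt (2 * real v) * (B + 4 * real v * (2 * (1 + ln (real v))))"
    by (simp add: norm_mult)
  hence "norm (\<Sum>x<N. e1 ((real_of_int u / real v + \<beta>) * (real x + 1)\<^sup>2)) \<le>
     sqrt (2 * real v) * (B + 4 * real v * (2 * (1 + ln (real v)))) / real v"
    using v by (simp add: field_simps)
  also have "\<dots> = sqrt 2 * B / sqrt (real v) + 8 * sqrt 2 * sqrt (real v) * (1 + ln (real v))"
  proof -
    have "sqrt (2 * real v) / real v = sqrt 2 / sqrt (real v)"
      using v by (simp add: real_sqrt_mult field_simps)
    hence "sqrt (2 * real v) * (B + 4 * real v * (2 * (1 + ln (real v)))) / real v =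
      sqrt 2 / sqrt (real v) * (B + 4 * real v * (2 * (1 + ln (real v))))" by (metis times_divide_eq_left mult.commute)
    also have "\<dots> = sqrt 2 * B / sqrt (real v) + 8 * sqrt 2 * (real v / sqrt (real v)) * (1 + ln (real v))"
      by (simp add: distrib_left add_divide_distrib mult_ac)
    also have "real v / sqrt (real v) = sqrt (real v)" by (simp add: real_div_sqrt)
    finally show ?thesis .
  qed
  also have "8 * sqrt 2 * sqrt (real v) * (1 + ln (real v)) \<le> 12 * sqrt (real v) * (1 + ln (real v))"
    using sqrt2_le v by (intro mult_right_mono) auto
  finally show ?thesis by simp
qed

text \<open>For q <= 6N the approximation is h/q itself, with \<beta> = 0 and the trivial B = N;
  this is the source of the term 2N / sqrt q. The other case produces 8 sqrt q.\<close>

lemma incomplete_gauss_sum_bound: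
  fixes h q N :: nat
  assumes q: "q > 0" and cop: "coprime h q" and N: "N > 0"
  shows "norm (\<Sum>x<N. e1 (real h / real q * (real x + 1)\<^sup>2)) \<le>
    2 * real N / sqrt (real q) + 8 * sqrt (real q) + 12 * sqrt (real (min (6 * N) q)) * (1 + ln (real q))"
proof (cases "q \<le> 6 * N")
  case True
  have "norm (\<Sum>x<N. e1 ((real_of_int (int h) / real q + 0) * (real x + 1)\<^sup>2)) \<le>
    sqrt 2 * real N / sqrt (real q) + 12 * sqrt (real q) * (1 + ln (real q))"
    using q cop by (intro weyl_sum_near_rational) auto
  also have "sqrt 2 * real N / sqrt (real q) \<le> 2 * real N / sqrt (real q)"
    using sqrt2_le by (intro divide_right_mono mult_right_mono) auto
  finally have "norm (\<Sum>x<N. e1 (real h / real q * (real x + 1)\<^sup>2)) \<le>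
    2 * real N / sqrt (real q) + 12 * sqrt (real q) * (1 + ln (real q))" by simp
  moreover have "0 \<le> 8 * sqrt (real q)" by simp
  moreover have "min (6 * N) q = q" using True by simp
  ultimately show ?thesis unfolding \<open>min (6 * N) q = q\<close> by linarith
next
  case False
  \<comment> \<open>The bound 6N for the denominator makes |\<beta>| (2N + 1) <= 3N / (6 N v) =
    1/(2v), as completion requires.\<close>
  have "6 * N > 0" using N by simp
  then obtain u v0 where uv: "coprime u v0" "0 < v0" "v0 \<le> int (6 * N)"
      "\<bar>real_of_int v0 * (real h / real q) - real_of_int u\<bar> < 1 / real (6 * N)"
    by (rule Dirichlet_approx_coprime[of "6 * N" "real h / real q"])
  define v where "v = nat v0"
  have v: "v > 0" "v \<le> 6 * N" "v0 = int v" "v < q" "coprime u (int v)"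
    using uv False by (auto simp: v_def)
  define \<beta> where "\<beta> = real h / real q - real_of_int u / real v"
  have bN: "\<bar>\<beta>\<bar> \<le> 1 / (6 * real N * real v)"
  proof -
    have "real v * \<bar>\<beta>\<bar> = \<bar>real v * \<beta>\<bar>" by (simp add: abs_mult)
    also have "\<dots> = \<bar>real_of_int v0 * (real h / real q) - real_of_int u\<bar>"
      using v by (simp add: \<beta>_def right_diff_distrib)
    finally have "real v * \<bar>\<beta>\<bar> \<le> 1 / real (6 * N)" using uv(4) by simp
    thus ?thesis using v N by (simp add: field_simps)
  qed
  have b2: "\<bar>\<beta>\<bar> * (2 * real N + 1) \<le> 1 / (2 * real v)"
  proof -
    have "\<bar>\<beta>\<bar> * (2 * real N + 1) \<le> 1 / (6 * real N * real v) * (3 * real N)"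
      using N by (intro mult_mono bN) auto
    also have "\<dots> = 1 / (2 * real v)" using N v by (simp add: field_simps)
    finally show ?thesis .
  qed
  \<comment> \<open>h v - u q is a nonzero integer: q divides h v only if it divides v, which is
    impossible for 0 < v < q.\<close>
  have bl: "\<bar>\<beta>\<bar> \<ge> 1 / (real q * real v)"
  proof -
    have "int h * int v - u * int q \<noteq> 0"
    proof
      assume "int h * int v - u * int q = 0"
      hence "int q dvd int h * int v" by simp
      hence "q dvd h * v" by (simp only: of_nat_mult[symmetric] of_nat_dvd_iff)
      hence "q dvd v" using cop by (simp add: coprime_commute coprime_dvd_mult_right_iff)
      thus False using v by (auto dest: dvd_imp_le)
    qed
    hence "\<bar>int h * int v - u * int q\<bar> \<ge> 1" by linarith
    hence "\<bar>real_of_int (int h * int v - u * int q)\<bar> \<ge> 1" by linarith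
    moreover have "\<beta> = real_of_int (int h * int v - u * int q) / (real q * real v)"
      using q v by (simp add: \<beta>_def field_simps)
    ultimately show ?thesis using q v by (simp add: abs_mult divide_right_mono)
  qed
  moreover have "1 / (real q * real v) > 0" using q v by simp
  ultimately have b0: "\<beta> \<noteq> 0" by force
  have half: "1 / (2 * real v) \<le> 1/2" using v by (simp add: field_simps)
  have B: "norm (\<Sum>x<N. e1 (\<beta> * (real x + 1)\<^sup>2)) \<le> 5 * (sqrt (real q) * sqrt (real v))"
  proof -
    have "norm (\<Sum>x<N. e1 (\<beta> * (real x + 1)\<^sup>2)) \<le> 4 / sqrt \<bar>\<beta>\<bar> + 1"
      using b2 half by (intro norm_sum_quadratic b0) linarith
    also have "4 / sqrt \<bar>\<beta>\<bar> \<le> 4 / sqrt (1 / (real q * real v))"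
      using bl q v b0 by (intro divide_left_mono mult_pos_pos) auto
    also have "\<dots> = 4 * (sqrt (real q) * sqrt (real v))"
      by (simp add: real_sqrt_divide real_sqrt_mult)
    also have "1 \<le> sqrt (real q) * sqrt (real v)"
      using q v mult_mono[of 1 "sqrt (real q)" 1 "sqrt (real v)"] by simp
    finally show ?thesis by simp
  qed
  have "norm (\<Sum>x<N. e1 ((real_of_int u / real v + \<beta>) * (real x + 1)\<^sup>2)) \<le>
    sqrt 2 * (5 * (sqrt (real q) * sqrt (real v))) / sqrt (real v) + 12 * sqrt (real v) * (1 + ln (real v))"
    by (rule weyl_sum_near_rational[OF v(1) v(5) b2 B])
  also have "sqrt 2 * (5 * (sqrt (real q) * sqrt (real v))) / sqrt (real v) = 5 * sqrt 2 * sqrt (real q)"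
    using v by simp
  also have "\<dots> \<le> 8 * sqrt (real q)"
    using sqrt2_le by (intro mult_right_mono) auto
  also have "12 * sqrt (real v) * (1 + ln (real v)) \<le> 12 * sqrt (real (min (6 * N) q)) * (1 + ln (real q))"
    using v by (intro mult_mono add_mono) auto
  finally have "norm (\<Sum>x<N. e1 ((real_of_int u / real v + \<beta>) * (real x + 1)\<^sup>2)) \<le>
     8 * sqrt (real q) + 12 * sqrt (real (min (6 * N) q)) * (1 + ln (real q))" by simp
  moreover have eq: "real_of_int u / real v + \<beta> = real h / real q" by (simp add: \<beta>_def)
  moreover have "0 \<le> 2 * real N / sqrt (real q)" by simp
  ultimately show ?thesis unfolding eq by linarith
qed

section \<open>Reduction to a divisor sum\<close>

text \<open>The divisor function sigma of order -1/2. It enters through the sum of sqrt(gcd(h, a))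
  with weights 1/h.\<close>

definition inv_sqrt_divisor_sum :: "nat \<Rightarrow> real" where
  "inv_sqrt_divisor_sum a = (\<Sum>d | d dvd a. 1 / sqrt (real d))"

text \<open>sqrt(gcd(h, a)) is one of the terms sqrt d over the common divisors d of h and a, hence
  at most their sum. Writing h = d k turns sqrt d / h into d^(-1/2) / k.\<close>

lemma sum_sqrt_gcd_le:
  fixes a :: nat
  assumes a: "a > 0"
  shows "(\<Sum>h=1..<a. sqrt (real (gcd h a)) / real h) \<le> inv_sqrt_divisor_sum a * (1 + ln (real a))"
proof -
  have fin: "finite {d. d dvd a}" using a by simp
  have "(\<Sum>h=1..<a. sqrt (real (gcd h a)) / real h) \<le> (\<Sum>h=1..<a. \<Sum>d | d dvd a. if d dvd h then sqrt (real d) / real h else 0)"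
  proof (rule sum_mono)
    fix h
    have "sqrt (real (gcd h a)) / real h = (\<Sum>d\<in>{gcd h a}. if d dvd h then sqrt (real d) / real h else 0)"
      by simp
    also have "\<dots> \<le> (\<Sum>d | d dvd a. if d dvd h then sqrt (real d) / real h else 0)"
      by (intro sum_mono2 fin) auto
    finally show "sqrt (real (gcd h a)) / real h \<le> \<dots>" .
  qed
  also have "\<dots> = (\<Sum>d | d dvd a. \<Sum>h\<in>{h\<in>{1..<a}. d dvd h}. sqrt (real d) / real h)"
    by (subst sum.swap) (simp add: sum.inter_filter[symmetric])
  also have "\<dots> \<le> (\<Sum>d | d dvd a. 1 / sqrt (real d) * (1 + ln (real a)))"
  proof (rule sum_mono)
    fix d assume "d \<in> {d. d dvd a}"
    hence d: "d > 0" using a by (auto intro: Nat.gr0I)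
    have "(\<Sum>h\<in>{h\<in>{1..<a}. d dvd h}. sqrt (real d) / real h) \<le> (\<Sum>h\<in>(\<lambda>k. d * k) ` {1..<a}. sqrt (real d) / real h)"
    proof (rule sum_mono2)
      show "{h \<in> {1..<a}. d dvd h} \<subseteq> (\<lambda>k. d * k) ` {1..<a}"
      proof
        fix h assume "h \<in> {h \<in> {1..<a}. d dvd h}"
        then obtain k where k: "h = d * k" "1 \<le> h" "h < a" by (auto simp: dvd_def)
        have "k \<le> d * k" using d by simp
        hence "k < a" using k by linarith
        hence "k \<in> {1..<a}" using k by (auto simp: Suc_le_eq)
        thus "h \<in> (\<lambda>k. d * k) ` {1..<a}" using k by auto
      qed
    qed auto
    also have "\<dots> = (\<Sum>k=1..<a. sqrt (real d) / real (d * k))"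
      using d by (subst sum.reindex) (auto simp: inj_on_def)
    also have "\<dots> = 1 / sqrt (real d) * (\<Sum>k=1..<a. 1 / real k)"
    proof -
      have "sqrt (real d) / real (d * k) = 1 / sqrt (real d) * (1 / real k)" for k
      proof -
        have "real (d * k) = sqrt (real d) * (sqrt (real d) * real k)" by simp
        thus ?thesis using d by (simp only:) simp
      qed
      thus ?thesis by (simp add: sum_distrib_left)
    qed
    also have "\<dots> \<le> 1 / sqrt (real d) * (1 + ln (real a))"
      using a by (intro mult_left_mono sum_inverse_le) auto
    finally show "(\<Sum>h\<in>{h\<in>{1..<a}. d dvd h}. sqrt (real d) / real h) \<le> 1 / sqrt (real d) * (1 + ln (real a))" .
  qed
  finally show ?thesis unfolding inv_sqrt_divisor_sum_def sum_distrib_right .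
qed

lemma inv_sqrt_divisor_sum_ge_1:
  assumes "a > 0" shows "1 \<le> inv_sqrt_divisor_sum a"
proof -
  have "1 = (\<Sum>d\<in>{1::nat}. 1 / sqrt (real d))" by simp
  also have "\<dots> \<le> inv_sqrt_divisor_sum a"
    unfolding inv_sqrt_divisor_sum_def using assms by (intro sum_mono2) auto
  finally show ?thesis .
qed

section \<open>Fourier expansion of the defect\<close>

definition floor_defect :: "nat \<Rightarrow> nat \<Rightarrow> real" where
  "floor_defect a b = (\<Sum>x=1..b. real_of_int \<lfloor>(real x)\<^sup>2 / real a\<rfloor>) - (\<Sum>x=1..b. ((real x)\<^sup>2 / real a - 1 / 2))"

text \<open>The mean of (m mod a)/a over a period is 1/2 - 1/(2a) rather than 1/2; the discrepancy
  is the term N/(2a).\<close>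

lemma floor_defect_fourier:
  assumes a: "a > 0"
  shows "complex_of_real (floor_defect a N) = of_nat N / (2 * of_nat a) -
    (\<Sum>h=1..<a. (\<Sum>x<N. e1 (real h / real a * (real x + 1)\<^sup>2)) / (of_nat a * (e1 (- real h / real a) - 1)))"
proof -
  have fl: "real_of_int \<lfloor>(real x)\<^sup>2 / real a\<rfloor> = (real x)\<^sup>2 / real a - real (x\<^sup>2 mod a) / real a" for x
  proof -
    have "\<lfloor>(real x)\<^sup>2 / real a\<rfloor> = int (x\<^sup>2 div a)"
      by (metis floor_divide_of_nat_eq of_nat_power)
    moreover have "real (x\<^sup>2) = real (x\<^sup>2 div a * a + x\<^sup>2 mod a)" by simp
    hence "(real x)\<^sup>2 = real (x\<^sup>2 div a) * real a + real (x\<^sup>2 mod a)"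
      by (simp only: of_nat_add of_nat_mult of_nat_power)
    ultimately show ?thesis using a by (simp add: field_simps)
  qed
  have "floor_defect a N = (\<Sum>x=1..N. 1/2 - real (x\<^sup>2 mod a) / real a)"
    unfolding floor_defect_def fl sum_subtractf[symmetric] by (intro sum.cong) auto
  also have "\<dots> = (\<Sum>x<N. 1/2 - real ((Suc x)\<^sup>2 mod a) / real a)"
    by (rule sum.reindex_bij_witness[of _ Suc "\<lambda>x. x - 1"]) auto
  finally have "complex_of_real (floor_defect a N) = (\<Sum>x<N. 1/2 - of_nat ((Suc x)\<^sup>2 mod a) / of_nat a)"
    by simp
  also have "\<dots> = (\<Sum>x<N. 1 / (2 * of_nat a) - (\<Sum>h=1..<a. e1 (real h / real a * (real x + 1)\<^sup>2) / (of_nat a * (e1 (- real h / real a) - 1))))"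
  proof (intro sum.cong refl)
    fix x
    have "(\<Sum>h=1..<a. e1 (real h / real a * (real x + 1)\<^sup>2) / (of_nat a * (e1 (- real h / real a) - 1))) =
      (\<Sum>h=1..<a. e1 (real h * real ((Suc x)\<^sup>2) / real a) / (e1 (- real h / real a) - 1)) / of_nat a"
      unfolding sum_divide_distrib by (intro sum.cong refl) (simp add: field_simps)
    thus "1/2 - of_nat ((Suc x)\<^sup>2 mod a) / of_nat a = 1 / (2 * of_nat a) - (\<Sum>h=1..<a. e1 (real h / real a * (real x + 1)\<^sup>2) / (of_nat a * (e1 (- real h / real a) - 1)))"
      unfolding sawtooth_fourier[OF a, of "(Suc x)\<^sup>2"] using a by (simp add: field_simps)
  qed
  also have "\<dots> = of_nat N / (2 * of_nat a) -
    (\<Sum>h=1..<a. (\<Sum>x<N. e1 (real h / real a * (real x + 1)\<^sup>2)) / (of_nat a * (e1 (- real h / real a) - 1)))"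
    unfolding sum_subtractf sum_divide_distrib by (subst (2) sum.swap) simp
  finally show ?thesis .
qed

text \<open>Reducing h/a by d = gcd(h, a) enlarges only N / sqrt q, which picks up the factor sqrt
  d. The other terms increase with q and q <= a.\<close>

lemma quadratic_exp_sum_bound:
  fixes a h N :: nat
  assumes h: "0 < h" "h < a" and N: "N > 0"
  shows "norm (\<Sum>x<N. e1 (real h / real a * (real x + 1)\<^sup>2)) \<le>
    2 * real N * sqrt (real (gcd h a)) / sqrt (real a) + 8 * sqrt (real a) + 12 * sqrt (real (min (6 * N) a)) * (1 + ln (real a))"
proof -
  define d where "d = gcd h a"
  have d: "d > 0" using h by (simp add: d_def)
  define h' q where "h' = h div d" and "q = a div d"
  have hq: "h = h' * d" "a = q * d" by (auto simp: h'_def q_def d_def)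
  have q: "q > 0" using h hq by (auto intro: Nat.gr0I)
  have cop: "coprime h' q" unfolding h'_def q_def d_def using h by (intro div_gcd_coprime) auto
  have "real h / real a = real h' / real q" using d by (simp add: hq)
  hence "norm (\<Sum>x<N. e1 (real h / real a * (real x + 1)\<^sup>2)) \<le>
    2 * real N / sqrt (real q) + 8 * sqrt (real q) + 12 * sqrt (real (min (6 * N) q)) * (1 + ln (real q))"
    using incomplete_gauss_sum_bound[OF q cop N] by simp
  also have "2 * real N / sqrt (real q) = 2 * real N * sqrt (real d) / sqrt (real a)"
    using d by (simp add: hq real_sqrt_mult)
  also have qa: "q \<le> a" using d by (simp add: hq)
  hence "8 * sqrt (real q) \<le> 8 * sqrt (real a)" by simp
  also have "12 * sqrt (real (min (6 * N) q)) * (1 + ln (real q)) \<le> 12 * sqrt (real (min (6 * N) a)) * (1 + ln (real a))"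
    using q qa by (intro mult_mono add_mono) auto
  finally show ?thesis unfolding d_def by simp
qed

text \<open>The coefficient at h is at most 1/(3 min(h, a - h)) in modulus. Since gcd(a - h, a) =
  gcd(h, a), the weights 1/h and 1/(a - h) contribute equally, and everything folds to the weight
  1/h.\<close>

lemma floor_defect_bound_min:
  assumes a: "a > 0" and N: "N > 0"
  shows "\<bar>floor_defect a N\<bar> \<le> real N / (2 * real a) +
    (2 * real N * inv_sqrt_divisor_sum a / sqrt (real a) + 8 * sqrt (real a) + 12 * sqrt (real (min (6 * N) a)) * (1 + ln (real a))) * (1 + ln (real a))"
proof -
  define S where "S h = (\<Sum>x<N. e1 (real h / real a * (real x + 1)\<^sup>2))" for h :: nat
  define R where "R = 8 * sqrt (real a) + 12 * sqrt (real (min (6 * N) a)) * (1 + ln (real a))"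
  define B where "B h = 2 * real N * sqrt (real (gcd h a)) / sqrt (real a) + R" for h :: nat
  have R: "R \<ge> 0" using a by (simp add: R_def)
  have B0: "B h \<ge> 0" for h using R by (simp add: B_def)
  have SB: "norm (S h) \<le> B h" if "h \<in> {1..<a}" for h
    unfolding S_def B_def R_def using quadratic_exp_sum_bound[of h a N] that N by simp
  have termb: "norm (S h / (of_nat a * (e1 (- real h / real a) - 1))) \<le> B h * (1 / real h + 1 / real (a - h)) / 3"
    if h: "h \<in> {1..<a}" for h
  proof -
    define m where "m = real (min h (a - h))"
    have m: "m > 0" "m \<le> real h" "m \<le> real a - real h" using h by (auto simp: m_def min_def)
    have "e1 (- real h / real a) - 1 = (1 - e1 (real h / real a)) / e1 (real h / real a)"
      by (simp add: e1_minus divide_inverse algebra_simps)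
    hence "norm (e1 (- real h / real a) - 1) = norm (1 - e1 (real h / real a))"
      by (simp add: norm_divide)
    also have "\<dots> \<ge> 3 * (m / real a)"
      using m a by (intro norm_1_minus_e1_ge) (auto simp: field_simps)
    finally have "3 * m \<le> real a * norm (e1 (- real h / real a) - 1)"
      using a by (simp add: field_simps)
    hence "norm (S h / (of_nat a * (e1 (- real h / real a) - 1))) \<le> B h / (3 * m)"
      unfolding norm_divide norm_mult using SB[OF h] m B0 by (intro frac_le) auto
    also have "\<dots> = B h / 3 * (1 / m)" by simp
    also have "\<dots> \<le> B h / 3 * (1 / real h + 1 / real (a - h))"
      unfolding m_def using h B0[of h] by (intro mult_left_mono inverse_min_le) auto
    finally show ?thesis by simp
  qed
  have refl: "(\<Sum>h=1..<a. B h / real (a - h)) = (\<Sum>h=1..<a. B h / real h)"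
  proof (rule sum.reindex_bij_witness[of _ "\<lambda>h. a - h" "\<lambda>h. a - h"])
    fix h assume "h \<in> {1..<a}"
    hence "gcd (a - h) a = gcd h a" by (metis atLeastLessThan_iff gcd_diff2_nat gcd.commute less_imp_le gcd_diff1_nat)
    thus "B (a - h) / real (a - h) = B h / real (a - h)" by (simp add: B_def)
  qed auto
  have "\<bar>floor_defect a N\<bar> = norm (complex_of_real (floor_defect a N))" by simp
  also have "\<dots> \<le> real N / (2 * real a) + (\<Sum>h=1..<a. B h * (1 / real h + 1 / real (a - h)) / 3)"
    unfolding floor_defect_fourier[OF a] S_def[symmetric]
    by (intro order.trans[OF norm_triangle_ineq4] add_mono order.trans[OF norm_sum] sum_mono termb)
      (auto simp: norm_divide norm_mult)
  also have "(\<Sum>h=1..<a. B h * (1 / real h + 1 / real (a - h)) / 3) = 2 / 3 * (\<Sum>h=1..<a. B h / real h)"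
    using refl by (simp add: sum_divide_distrib[symmetric] distrib_left sum.distrib)
  also have "\<dots> \<le> (\<Sum>h=1..<a. B h / real h)"
    using sum_nonneg[of "{1..<a}" "\<lambda>h. B h / real h"] B0 by simp
  also have "\<dots> = 2 * real N / sqrt (real a) * (\<Sum>h=1..<a. sqrt (real (gcd h a)) / real h) + R * (\<Sum>h=1..<a. 1 / real h)"
    by (simp add: B_def add_divide_distrib sum.distrib sum_distrib_left)
  also have "\<dots> \<le> 2 * real N / sqrt (real a) * (inv_sqrt_divisor_sum a * (1 + ln (real a))) + R * (1 + ln (real a))"
    using a R by (intro add_mono mult_left_mono sum_sqrt_gcd_le sum_inverse_le) auto
  finally show ?thesis by (simp add: R_def algebra_simps)
qed

lemma floor_defect_bound:
  assumes a: "a \<ge> 3" and N: "N > 0"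
  shows "\<bar>floor_defect a N\<bar> \<le> 40 * (sqrt (real a) * ln (real a)) +
     real N / sqrt (real a) * (75 * inv_sqrt_divisor_sum a * (1 + ln (real a)) ^ 4)"
proof -
  define l where "l = 1 + ln (real a)"
  define F where "F = inv_sqrt_divisor_sum a"
  define A where "A = sqrt (real a)"
  have F: "F \<ge> 1" unfolding F_def using a by (intro inv_sqrt_divisor_sum_ge_1) auto
  have e3: "exp 1 < (3 :: real)" using e_less_272 by simp
  have "ln (exp 1) \<le> ln (real a)" using a e3 by (subst ln_le_cancel_iff) auto
  hence l: "l \<ge> 1" "l \<le> 2 * ln (real a)" by (auto simp: l_def)
  have A: "A > 0" "A * A = real a" "A \<ge> 1" using a by (auto simp: A_def)
  have "l ^ 1 \<le> l ^ 4" using l by (intro power_increasing) auto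
  hence l4: "l \<le> l ^ 4" "1 \<le> l ^ 4" using l by auto
  have t1: "real N / (2 * real a) \<le> real N / A * (F * l ^ 4)"
  proof -
    have "A * 1 \<le> (2 * (A * A)) * 1" using A mult_mono[of 1 A A A] by simp
    hence "real N / (2 * real a) \<le> real N / A" unfolding A(2)[symmetric] using A(1,3)
      by (intro divide_left_mono) auto
    also have "\<dots> \<le> real N / A * (F * l ^ 4)"
      using F l4 A mult_mono[of 1 F 1 "l ^ 4"] mult_left_mono[of 1 "F * l ^ 4" "real N / A"] by simp
    finally show ?thesis .
  qed
  have t2: "2 * real N * F / A * l \<le> 2 * (real N / A * (F * l ^ 4))"
    using mult_left_mono[OF l4(1), of "2 * real N * F / A"] F A by (simp add: mult_ac)
  have t3: "8 * A * l \<le> 16 * (A * ln (real a))"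
    using mult_left_mono[OF l(2), of "8 * A"] A by (simp add: mult_ac)
  \<comment> \<open>The split compares 6 N l^2 with a. In the first case one l is absorbed into sqrt
    a. In the second sqrt a <= 6 N l^2 / sqrt a, and the product of this l^2 with l * l is the
    fourth power in the statement.\<close>
  have t4: "12 * sqrt (real (min (6 * N) a)) * l * l \<le> 24 * (A * ln (real a)) + 72 * (real N / A * (F * l ^ 4))"
  proof (cases "6 * real N * l\<^sup>2 \<le> real a")
    case True
    have "sqrt (real (min (6 * N) a)) * l = sqrt (real (min (6 * N) a) * l\<^sup>2)"
      using l by (simp add: real_sqrt_mult)
    also have "\<dots> \<le> A"
    proof -
      have "real (min (6 * N) a) * l\<^sup>2 \<le> 6 * real N * l\<^sup>2" by (intro mult_right_mono) auto
      thus ?thesis unfolding A_def using True by (intro real_sqrt_le_mono) linarith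
    qed
    finally have "sqrt (real (min (6 * N) a)) * l \<le> A" .
    hence "(sqrt (real (min (6 * N) a)) * l) * l \<le> A * (2 * ln (real a))"
      using l A by (intro mult_mono) auto
    hence "12 * sqrt (real (min (6 * N) a)) * l * l \<le> 24 * (A * ln (real a))" by (simp add: mult_ac)
    moreover have "0 \<le> real N / A * (F * l ^ 4)" using A F l by simp
    ultimately show ?thesis by linarith
  next
    case False
    have "A \<le> 6 * real N * l\<^sup>2 / A" using False A by (simp add: field_simps)
    hence "12 * A * (l * l) \<le> 12 * (6 * real N * l\<^sup>2 / A) * (l * l)"
      using l by (intro mult_right_mono mult_left_mono) auto
    also have "\<dots> = 72 * (real N / A * (1 * l ^ 4))" by (simp add: power2_eq_square power4_eq_xxxx)
    also have "\<dots> \<le> 72 * (real N / A * (F * l ^ 4))"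
      using F A l by (intro mult_left_mono mult_right_mono) auto
    finally have "12 * A * (l * l) \<le> 72 * (real N / A * (F * l ^ 4))" .
    moreover have "12 * sqrt (real (min (6 * N) a)) * (l * l) \<le> 12 * A * (l * l)"
      unfolding A_def using l by (intro mult_right_mono mult_left_mono real_sqrt_le_mono) auto
    moreover have "0 \<le> A * ln (real a)" using A a by simp
    ultimately show ?thesis by (simp add: mult.assoc)
  qed
  have "\<bar>floor_defect a N\<bar> \<le> real N / (2 * real a) +
    (2 * real N * F / A + 8 * A + 12 * sqrt (real (min (6 * N) a)) * l) * l"
    using floor_defect_bound_min[of a N] a N by (simp add: l_def F_def A_def)
  also have "\<dots> = real N / (2 * real a) + 2 * real N * F / A * l + 8 * A * l + 12 * sqrt (real (min (6 * N) a)) * l * l"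
    by (simp add: distrib_right)
  also have "\<dots> \<le> real N / A * (F * l ^ 4) + 2 * (real N / A * (F * l ^ 4)) + 16 * (A * ln (real a))
      + (24 * (A * ln (real a)) + 72 * (real N / A * (F * l ^ 4)))"
    by (intro add_mono t1 t2 t3 t4)
  \<comment> \<open>40 = 16 + 24 and 75 = 1 + 2 + 72 collect the partial bounds \<open>t1\<close> to
    \<open>t4\<close>.\<close>
  also have "\<dots> = 40 * (A * ln (real a)) + 75 * (real N / A * (F * l ^ 4))" by simp
  finally show ?thesis by (simp add: l_def F_def A_def mult_ac)
qed

section \<open>The zeta function on the line Re s = 1\<close>

lemma norm_nat_powr: "norm (of_nat n powr s :: complex) = real n powr Re s"
  by (subst norm_powr_real_powr) auto

lemma summable_nat_powr: "\<sigma> > 1 \<Longrightarrow> summable (\<lambda>n. real n powr (- \<sigma>))"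
  by (subst summable_real_powr_iff) auto

lemma summable_ln_nat_powr:
  assumes "\<sigma> > 1"
  shows "summable (\<lambda>n. ln (real n) * real n powr (- \<sigma>))"
proof (rule summable_comparison_test'[where N = 1])
  define d where "d = (\<sigma> - 1) / 2"
  have d: "d > 0" "d - \<sigma> < - 1" using assms by (auto simp: d_def field_simps)
  show "summable (\<lambda>n. (1 / d) * real n powr (d - \<sigma>))"
    using d by (intro summable_mult) (subst summable_real_powr_iff, auto)
  fix n :: nat assume n: "n \<ge> 1"
  have "ln (real n) * real n powr (- \<sigma>) \<le> (real n powr d / d) * real n powr (- \<sigma>)"
    using n d by (intro mult_right_mono ln_powr_bound) auto
  also have "\<dots> = (1 / d) * real n powr (d - \<sigma>)" by (simp add: powr_add[symmetric])
  finally show "norm (ln (real n) * real n powr (- \<sigma>)) \<le> (1 / d) * real n powr (d - \<sigma>)"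
    using n by simp
qed

lemma summable_mangoldt_powr:
  assumes "\<sigma> > 1"
  shows "summable (\<lambda>n. mangoldt n * real n powr (- \<sigma>))"
proof (rule summable_comparison_test'[OF summable_ln_nat_powr[OF assms], where N = 1])
  fix n :: nat assume "n \<ge> 1"
  thus "norm (mangoldt n * real n powr (- \<sigma>)) \<le> ln (real n) * real n powr (- \<sigma>)"
    by (simp add: mult_right_mono mangoldt_le abs_mult)
qed

text \<open>The index runs over all naturals; the term at 0 vanishes because
  \<open>0 powr z = 0\<close>. The value is meaningful for Re s > 1.\<close>

definition zeta :: "complex \<Rightarrow> complex" where "zeta s = (\<Sum>n. of_nat n powr (- s))"

text \<open>For Re s > 1 this is -zeta'/zeta; in product form, \<open>zeta_deriv\<close> is this
  identity.\<close>

definition zeta_ld :: "complex \<Rightarrow> complex" where "zeta_ld s = (\<Sum>n. mangoldt n * of_nat n powr (- s))"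

lemma summable_zeta: "Re s > 1 \<Longrightarrow> summable (\<lambda>n. norm (of_nat n powr (- s) :: complex))"
  using summable_nat_powr[of "Re s"] by (simp add: norm_nat_powr)

lemma summable_zeta_ld: "Re s > 1 \<Longrightarrow> summable (\<lambda>n. norm (mangoldt n * of_nat n powr (- s) :: complex))"
  using summable_mangoldt_powr[of "Re s"] by (simp add: norm_mult norm_nat_powr)

text \<open>Absolute convergence of the double series over (d, m) permits regrouping by the product
  n = d m.\<close>

lemma dirichlet_convolution_sums:
  fixes f g :: "nat \<Rightarrow> complex"
  assumes f: "summable (\<lambda>n. norm (f n))" "f 0 = 0" and g: "summable (\<lambda>n. norm (g n))" "g 0 = 0"
  shows "(\<lambda>n. \<Sum>d | d dvd n. f d * g (n div d)) sums ((\<Sum>n. f n) * (\<Sum>n. g n))"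
proof -
  have hs: "(f has_sum (\<Sum>n. f n)) UNIV" "(g has_sum (\<Sum>n. g n)) UNIV"
    "((\<lambda>n. norm (f n)) has_sum (\<Sum>n. norm (f n))) UNIV" "((\<lambda>n. norm (g n)) has_sum (\<Sum>n. norm (g n))) UNIV"
    using f g by (intro norm_summable_imp_has_sum summable_sums; simp add: summable_norm_cancel)+
  have "(\<lambda>x. norm (case x of (d, m) \<Rightarrow> f d * g m)) summable_on (UNIV \<times> UNIV)"
  proof (subst Infinite_Sum.abs_summable_on_Sigma_iff, intro conjI ballI)
    fix d
    show "(\<lambda>m. norm (case (d, m) of (d, m) \<Rightarrow> f d * g m)) summable_on UNIV"
      using has_sum_cmult_right[OF hs(4), of "norm (f d)"] by (auto simp: norm_mult summable_on_def)
  next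
    have "infsum (\<lambda>m. norm (case (d, m) of (d, m) \<Rightarrow> f d * g m)) UNIV = norm (f d) * (\<Sum>n. norm (g n))" for d
      using has_sum_cmult_right[OF hs(4), of "norm (f d)"] by (simp add: norm_mult infsumI)
    thus "(\<lambda>d. norm (infsum (\<lambda>m. norm (case (d, m) of (d, m) \<Rightarrow> f d * g m)) UNIV)) summable_on UNIV"
      using has_sum_cmult_left[OF hs(3), of "\<Sum>n. norm (g n)"] suminf_nonneg[OF g(1)]
      by (auto simp: summable_on_def abs_mult)
  qed
  hence "(\<lambda>(d, m). f d * g m) summable_on (UNIV \<times> UNIV)"
    by (rule abs_summable_summable)
  hence "((\<lambda>(d, m). f d * g m) has_sum ((\<Sum>n. f n) * (\<Sum>n. g n))) (UNIV \<times> UNIV)"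
    by (intro has_sum_SigmaI[where g = "\<lambda>d. f d * (\<Sum>n. g n)"])
      (auto intro!: has_sum_cmult_right has_sum_cmult_left hs)
  hence "((\<lambda>(d, m). f d * g m) has_sum ((\<Sum>n. f n) * (\<Sum>n. g n))) ({1..} \<times> {1..})"
    by (subst has_sum_cong_neutral[where T = "UNIV \<times> UNIV" and g = "\<lambda>(d, m). f d * g m"])
      (auto simp: Suc_le_eq f(2) g(2) intro!: Nat.gr0I)
  also have "?this \<longleftrightarrow> ((\<lambda>(n, d). f d * g (n div d)) has_sum ((\<Sum>n. f n) * (\<Sum>n. g n))) (SIGMA n:{1..}. {d. d dvd n})"
    by (rule has_sum_reindex_bij_witness[of _ "\<lambda>(n, d). (d, n div d)" "\<lambda>(d, m). (d * m, d)"])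
      (auto simp: Suc_le_eq dvd_imp_le div_greater_zero_iff intro: Nat.gr0I)
  finally have "((\<lambda>n. \<Sum>d | d dvd n. f d * g (n div d)) has_sum ((\<Sum>n. f n) * (\<Sum>n. g n))) {1..}"
    by (rule has_sum_SigmaD) (auto intro!: has_sum_finite)
  \<comment> \<open>At n = 0 the set of divisors is infinite, and the sum over it is 0 by
    convention.\<close>
  hence "((\<lambda>n. \<Sum>d | d dvd n. f d * g (n div d)) has_sum ((\<Sum>n. f n) * (\<Sum>n. g n))) UNIV"
    by (subst has_sum_cong_neutral[where T = "{1..}" and g = "\<lambda>n. \<Sum>d | d dvd n. f d * g (n div d)"])
      (auto simp: Suc_le_eq f(2) g(2) not_less sum.infinite)
  thus ?thesis by (rule has_sum_imp_sums)
qed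

text \<open>The convolution of \<open>mangoldt\<close> with the constant 1 is ln. The resulting
  series is that of -zeta', which gives the derivative of zeta in \<open>zeta_deriv\<close>.\<close>

lemma zeta_ld_times_zeta:
  assumes s: "Re s > 1"
  shows "(\<lambda>n. of_real (ln (real n)) * of_nat n powr (- s)) sums (zeta_ld s * zeta s)"
proof -
  have "(\<lambda>n. \<Sum>d | d dvd n. (mangoldt d * of_nat d powr (- s)) * of_nat (n div d) powr (- s)) sums (zeta_ld s * zeta s)"
    unfolding zeta_ld_def zeta_def
    by (rule dirichlet_convolution_sums) (use summable_zeta[OF s] summable_zeta_ld[OF s] in auto)
  also have "(\<lambda>n. \<Sum>d | d dvd n. (mangoldt d * of_nat d powr (- s)) * of_nat (n div d) powr (- s)) =
     (\<lambda>n. of_real (ln (real n)) * of_nat n powr (- s))"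
  proof
    fix n :: nat
    show "(\<Sum>d | d dvd n. (mangoldt d * of_nat d powr (- s)) * of_nat (n div d) powr (- s)) = of_real (ln (real n)) * of_nat n powr (- s)"
    proof (cases "n = 0")
      case False
      have "(\<Sum>d | d dvd n. (mangoldt d * of_nat d powr (- s)) * of_nat (n div d) powr (- s)) =
        (\<Sum>d | d dvd n. mangoldt d * of_nat n powr (- s))"
      proof (intro sum.cong refl)
        fix d assume "d \<in> {d. d dvd n}"
        then obtain k where k: "n = d * k" by (auto elim: dvdE)
        have "d > 0" using False k by (auto intro: Nat.gr0I)
        hence "(of_nat d * of_nat (n div d) :: complex) powr (- s) = of_nat d powr (- s) * of_nat (n div d) powr (- s)"
          by (intro powr_times_real) auto
        moreover have "of_nat d * of_nat (n div d) = (of_nat n :: complex)" using k \<open>d > 0\<close> by simp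
        ultimately show "(mangoldt d * of_nat d powr (- s)) * of_nat (n div d) powr (- s) = mangoldt d * of_nat n powr (- s)"
          by simp
      qed
      also have "\<dots> = of_real (ln (real n)) * of_nat n powr (- s)"
        by (simp add: sum_distrib_right[symmetric] mangoldt_sum[OF False])
      finally show ?thesis .
    qed (simp add: sum.infinite)
  qed
  finally show ?thesis .
qed

section \<open>Derivative of zeta and continuation of (s - 1) zeta(s)\<close>

lemma open_halfplane: "open {s. Re s > c}"
  by (rule open_halfspace_Re_gt)

lemma zeta_deriv:
  assumes s: "Re s > 1"
  shows "(zeta has_field_derivative - (zeta_ld s * zeta s)) (at s)"
proof -
  have "\<exists>g g'. \<forall>s\<in>{s. Re s > 1}. ((\<lambda>n. of_nat n powr (- s)) sums g s) \<and>
     ((\<lambda>n. - (of_real (ln (real n)) * of_nat n powr (- s))) sums g' s) \<and> (g has_field_derivative g' s) (at s)"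
  proof (rule series_and_derivative_comparison_local[OF open_halfplane])
    fix n :: nat and s :: complex
    show "((\<lambda>s. of_nat n powr (- s)) has_field_derivative - (of_real (ln (real n)) * of_nat n powr (- s))) (at s)"
    proof (cases "n = 0")
      case False
      thus ?thesis
        using DERIV_chain2[OF has_field_derivative_powr_right[of "of_nat n" "- s"] DERIV_minus[OF DERIV_ident]]
        by (simp add: Ln_of_nat)
    qed simp
  next
    fix s :: complex assume s: "s \<in> {s. 1 < Re s}"
    \<comment> \<open>On the ball of this radius the real part stays at least 1 + d, which gives a
      summable majorant independent of the point.\<close>
    define d where "d = (Re s - 1) / 2"
    have d: "d > 0" "1 + d > 1" using s by (auto simp: d_def)
    have "norm (of_nat n powr (- y) :: complex) \<le> real n powr (- (1 + d))" if y: "y \<in> ball s d" for n y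
    proof (cases "n = 0")
      case False
      have "\<bar>Re s - Re y\<bar> \<le> norm (s - y)" by (metis abs_Re_le_cmod minus_complex.sel(1))
      hence "1 + d \<le> Re y" using y by (auto simp: dist_norm d_def field_simps)
      thus ?thesis using False by (simp add: norm_nat_powr powr_mono)
    qed simp
    thus "\<exists>d h. 0 < d \<and> summable h \<and> (\<forall>\<^sub>F n in sequentially. \<forall>y\<in>ball s d \<inter> {s. 1 < Re s}. norm (of_nat n powr (- y) :: complex) \<le> h n)"
      using d by (intro exI[of _ d] exI[of _ "\<lambda>n. real n powr (- (1 + d))"] conjI summable_nat_powr) auto
  qed
  then obtain g g' where g: "\<And>s. Re s > 1 \<Longrightarrow> (\<lambda>n. of_nat n powr (- s)) sums g s"
    "\<And>s. Re s > 1 \<Longrightarrow> (\<lambda>n. - (of_real (ln (real n)) * of_nat n powr (- s))) sums g' s"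
    "\<And>s. Re s > 1 \<Longrightarrow> (g has_field_derivative g' s) (at s)" by auto
  have gz: "g s = zeta s" if "Re s > 1" for s using g(1)[OF that] by (simp add: zeta_def sums_iff)
  have "g' s = - (zeta_ld s * zeta s)"
    using sums_unique2[OF g(2)[OF s] sums_minus[OF zeta_ld_times_zeta[OF s]]] .
  with g(3)[OF s] have "(g has_field_derivative - (zeta_ld s * zeta s)) (at s)" by simp
  thus ?thesis
    by (rule has_field_derivative_transform_within_open[OF _ open_halfplane[of 1]]) (use gz s in auto)
qed

text \<open>For \<open>n \<ge> 1\<close> this is \<open>(s - 1) \<integral> (n\<^sup>-\<^sup>s - x\<^sup>-\<^sup>s) dx\<close> over \<open>n \<le> x \<le> n + 1\<close>, so that
  \<open>1 + \<Sum> zterm n s\<close> is \<open>(s - 1) \<zeta>(s)\<close> continued to \<open>Re s > 0\<close>.\<close>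
definition zterm :: "nat \<Rightarrow> complex \<Rightarrow> complex" where
  "zterm n s = (s - 1) * of_nat n powr (- s) - (of_nat n powr (1 - s) - of_nat (Suc n) powr (1 - s))"

text \<open>Mean value inequalities on the segment from n to n + 1 replace the integral. The one for
  z^(-s) gains the factor |s| n^(-Re s - 1), which makes the series converge down to Re s >
  0.\<close>

lemma norm_zterm_le:
  assumes n: "n > 0" and s: "Re s > 0"
  shows "norm (zterm n s) \<le> norm (s - 1) * norm s * real n powr (- Re s - 1)"
proof -
  define S where "S = complex_of_real ` {real n..real n + 1}"
  have "convex S"
    unfolding S_def by (intro convex_linear_image bounded_linear.linear[OF bounded_linear_of_real] convex_real_interval)
  moreover have "of_nat n \<in> S"
    unfolding S_def by (rule image_eqI[of _ _ "real n"]) auto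
  moreover have "of_nat (Suc n) \<in> S"
    unfolding S_def by (rule image_eqI[of _ _ "real n + 1"]) auto
  ultimately have S: "convex S" "of_nat n \<in> S" "of_nat (Suc n) \<in> S" by auto
  have pos: "z \<notin> \<real>\<^sub>\<le>\<^sub>0" "z \<in> \<real>" "real n \<le> Re z" if "z \<in> S" for z
    using that n by (auto simp: S_def complex_nonpos_Reals_iff)
  have d1: "norm (of_nat n powr (- s) - z powr (- s)) \<le> norm s * real n powr (- Re s - 1)" if z: "z \<in> S" for z
  proof -
    have "norm (of_nat n powr (- s) - z powr (- s)) \<le> norm s * real n powr (- Re s - 1) * norm (of_nat n - z)"
    proof (rule field_differentiable_bound[OF S(1), where f' = "\<lambda>z. - s * z powr (- s - 1)"])
      fix w assume w: "w \<in> S"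
      show "((\<lambda>z. z powr (- s)) has_field_derivative - s * w powr (- s - 1)) (at w within S)"
        using has_field_derivative_powr[OF pos(1)[OF w], of "- s"] by (rule has_field_derivative_at_within)
      have "norm (w powr (- s - 1)) = Re w powr (- Re s - 1)"
        using pos(2)[OF w] pos(3)[OF w] by (subst norm_powr_real_powr) auto
      also have "\<dots> \<le> real n powr (- Re s - 1)"
        using pos[OF w] n s by (intro powr_mono2') auto
      finally show "norm (- s * w powr (- s - 1)) \<le> norm s * real n powr (- Re s - 1)"
        by (simp add: norm_mult mult_left_mono)
    qed (rule S(2) z)+
    also have "\<dots> \<le> norm s * real n powr (- Re s - 1) * 1"
    proof (intro mult_left_mono)
      obtain x where x: "z = of_real x" "x \<in> {real n..real n + 1}" using z by (auto simp: S_def)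
      have "norm (of_nat n - z) = \<bar>real n - x\<bar>"
        by (metis norm_of_real of_real_diff of_real_of_nat_eq x(1))
      thus "norm (of_nat n - z) \<le> 1" using x by auto
    qed auto
    finally show ?thesis by simp
  qed
  \<comment> \<open>A primitive of (s - 1)(n^(-s) - z^(-s)) whose increment from n to n + 1 is
    exactly \<open>zterm n s\<close>.\<close>
  define F where "F z = (s - 1) * of_nat n powr (- s) * (z - of_nat n) + z powr (1 - s)" for z
  have "norm (F (of_nat (Suc n)) - F (of_nat n)) \<le> norm (s - 1) * (norm s * real n powr (- Re s - 1)) * norm (of_nat (Suc n) - of_nat n :: complex)"
  proof (rule field_differentiable_bound[OF S(1), where f' = "\<lambda>z. (s - 1) * (of_nat n powr (- s) - z powr (- s))"])
    fix z assume z: "z \<in> S"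
    have "((\<lambda>z. z powr (1 - s)) has_field_derivative (1 - s) * z powr (1 - s - 1)) (at z)"
      by (rule has_field_derivative_powr[OF pos(1)[OF z]])
    hence "(F has_field_derivative (s - 1) * of_nat n powr (- s) * (1 - 0) + (1 - s) * z powr (1 - s - 1)) (at z)"
      unfolding F_def by (intro DERIV_add DERIV_cmult DERIV_diff DERIV_ident DERIV_const)
    hence "(F has_field_derivative (s - 1) * (of_nat n powr (- s) - z powr (- s))) (at z)"
      by (simp add: algebra_simps)
    thus "(F has_field_derivative (s - 1) * (of_nat n powr (- s) - z powr (- s))) (at z within S)"
      by (rule has_field_derivative_at_within)
    show "norm ((s - 1) * (of_nat n powr (- s) - z powr (- s))) \<le> norm (s - 1) * (norm s * real n powr (- Re s - 1))"
      unfolding norm_mult by (intro mult_left_mono d1 z) auto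
  qed (rule S)+
  also have "F (of_nat (Suc n)) - F (of_nat n) = zterm n s"
    by (simp add: F_def zterm_def algebra_simps)
  finally show ?thesis by (simp add: mult.assoc)
qed

definition zeta_reg :: "complex \<Rightarrow> complex" where
  "zeta_reg s = 1 + (\<Sum>n. zterm (Suc n) s)"

text \<open>With d = Re s / 2, the terms are O(n^(-d-1)) uniformly on the ball of radius d around s,
  so the series may be differentiated termwise.\<close>

lemma zeta_reg_holomorphic: "zeta_reg holomorphic_on {s. Re s > 0}"
proof -
  have "\<exists>g g'. \<forall>s\<in>{s. Re s > 0}. ((\<lambda>n. zterm (Suc n) s) sums g s) \<and>
     ((\<lambda>n. deriv (zterm (Suc n)) s) sums g' s) \<and> (g has_field_derivative g' s) (at s)"
  proof (rule series_and_derivative_comparison_local[OF open_halfplane])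
    fix n :: nat and s :: complex
    have "(\<lambda>s. (s - 1) * of_nat (Suc n) powr (- s) - (of_nat (Suc n) powr (1 - s) - of_nat (Suc (Suc n)) powr (1 - s))) holomorphic_on UNIV"
      by (intro holomorphic_intros) (simp_all del: of_nat_Suc)
    hence "zterm (Suc n) holomorphic_on UNIV" unfolding zterm_def[abs_def] .
    thus "(zterm (Suc n) has_field_derivative deriv (zterm (Suc n)) s) (at s)"
      using holomorphic_derivI open_UNIV by blast
  next
    fix s :: complex assume s: "s \<in> {s. 0 < Re s}"
    define d where "d = Re s / 2"
    define K where "K = (norm s + d + 1) * (norm s + d)"
    have d: "d > 0" "d \<le> Re s / 2" using s by (auto simp: d_def)
    have bd: "norm (zterm (Suc n) y) \<le> K * real (Suc n) powr (- d - 1)" if y: "y \<in> ball s d" for n y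
    proof -
      have "\<bar>Re s - Re y\<bar> \<le> norm (s - y)" by (metis abs_Re_le_cmod minus_complex.sel(1))
      hence Re: "d \<le> Re y" using y by (auto simp: dist_norm d_def)
      have ny: "norm y \<le> norm s + d" using y norm_triangle_sub[of y s] by (simp add: dist_norm norm_minus_commute)
      have "norm (zterm (Suc n) y) \<le> norm (y - 1) * norm y * real (Suc n) powr (- Re y - 1)"
        using Re d by (intro norm_zterm_le) auto
      also have "\<dots> \<le> K * real (Suc n) powr (- d - 1)"
        unfolding K_def using ny norm_triangle_ineq4[of y 1] Re d
        by (intro mult_mono powr_mono) auto
      finally show ?thesis .
    qed
    have "summable (\<lambda>n. real n powr (- d - 1))" using d by (subst summable_real_powr_iff) auto
    hence "summable (\<lambda>n. real (Suc n) powr (- d - 1))" by (subst summable_Suc_iff)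
    thus "\<exists>d h. 0 < d \<and> summable h \<and> (\<forall>\<^sub>F n in sequentially. \<forall>y\<in>ball s d \<inter> {s. 0 < Re s}. norm (zterm (Suc n) y) \<le> h n)"
      using d bd by (intro exI[of _ d] exI[of _ "\<lambda>n. K * real (Suc n) powr (- d - 1)"] conjI summable_mult) auto
  qed
  then obtain g g' where g: "\<And>s. Re s > 0 \<Longrightarrow> (\<lambda>n. zterm (Suc n) s) sums g s"
    "\<And>s. Re s > 0 \<Longrightarrow> (g has_field_derivative g' s) (at s)" by auto
  have "(\<lambda>s. 1 + g s) holomorphic_on {s. Re s > 0}"
    using g(2) by (intro holomorphic_intros holomorphic_onI) (auto simp: field_differentiable_def intro: has_field_derivative_at_within)
  moreover have "1 + g s = zeta_reg s" if "Re s > 0" for s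
    using g(1)[OF that] by (simp add: zeta_reg_def sums_iff)
  ultimately show ?thesis by (subst holomorphic_cong[OF refl, of _ _ "\<lambda>s. 1 + g s"]) auto
qed

lemma zeta_reg_1: "zeta_reg 1 = 1"
  by (simp add: zeta_reg_def zterm_def del: of_nat_Suc)

text \<open>The telescoping series of n^(1-s) - (n+1)^(1-s) sums to 1 and cancels the summand 1 in
  \<open>zeta_reg\<close>.\<close>

lemma zeta_reg_eq:
  assumes s: "Re s > 1"
  shows "zeta_reg s = (s - 1) * zeta s"
proof -
  have "(\<lambda>n. real n powr (1 - Re s)) \<longlonglongrightarrow> 0"
    using s by (intro tendsto_neg_powr filterlim_real_sequentially) auto
  hence "(\<lambda>n. norm (of_nat n powr (1 - s) :: complex)) \<longlonglongrightarrow> 0" by (simp add: norm_nat_powr)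
  hence "(\<lambda>n. of_nat n powr (1 - s) :: complex) \<longlonglongrightarrow> 0" by (rule tendsto_norm_zero_cancel)
  hence "(\<lambda>n. of_nat (Suc n) powr (1 - s) :: complex) \<longlonglongrightarrow> 0" by (rule LIMSEQ_Suc)
  hence 1: "(\<lambda>n. of_nat (Suc n) powr (1 - s) - of_nat (Suc (Suc n)) powr (1 - s) :: complex) sums (1 - 0)"
    using telescope_sums'[of "\<lambda>n. of_nat (Suc n) powr (1 - s) :: complex" 0] by simp
  have "(\<lambda>n. of_nat n powr (- s)) sums zeta s"
    unfolding zeta_def by (rule summable_sums[OF summable_norm_cancel[OF summable_zeta[OF s]]])
  hence 2: "(\<lambda>n. of_nat (Suc n) powr (- s)) sums zeta s" by (subst sums_Suc_iff) simp
  have "(\<lambda>n. zterm (Suc n) s) sums ((s - 1) * zeta s - (1 - 0))"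
    unfolding zterm_def by (intro sums_diff sums_mult 1 2)
  thus ?thesis by (simp add: zeta_reg_def sums_iff)
qed

section \<open>Logarithmic derivative and nonvanishing for Re s >= 1\<close>

lemma zeta_reg_deriv:
  assumes s: "Re s > 1"
  shows "(s - 1) * deriv zeta_reg s = zeta_reg s - (s - 1) * zeta_reg s * zeta_ld s"
proof -
  have "((\<lambda>s. (s - 1) * zeta s) has_field_derivative ((1 - 0) * zeta s + (- (zeta_ld s * zeta s)) * (s - 1))) (at s)"
    by (intro DERIV_mult DERIV_diff DERIV_ident DERIV_const zeta_deriv s)
  hence "(zeta_reg has_field_derivative ((1 - 0) * zeta s + (- (zeta_ld s * zeta s)) * (s - 1))) (at s)"
    by (rule has_field_derivative_transform_within_open[OF _ open_halfplane[of 1]]) (use s in \<open>auto simp: zeta_reg_eq\<close>)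
  hence "deriv zeta_reg s = zeta s - zeta_ld s * zeta s * (s - 1)" by (simp add: DERIV_imp_deriv)
  thus ?thesis using s by (simp only: zeta_reg_eq) (simp add: algebra_simps)
qed

text \<open>Factoring f = (z - z0)^m g with g(z0) nonzero gives f'/f = m/(z - z0) + g'/g near z0.
  Approaching z0 horizontally from the right extracts the order m of the zero, where m = 0 means
  that there is none.\<close>

lemma logderiv_limit:
  assumes f: "f holomorphic_on S" and S: "open S" "connected S" "z0 \<in> S"
    and nz: "\<exists>z\<in>S. f z \<noteq> 0"
  obtains m :: nat where "((\<lambda>x. of_real x * (deriv f (z0 + of_real x) / f (z0 + of_real x))) \<longlongrightarrow> of_nat m) (at_right 0)"
    "\<forall>\<^sub>F x in at_right 0. f (z0 + of_real x) \<noteq> 0" "m = 0 \<longleftrightarrow> f z0 \<noteq> 0"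
proof (cases "f z0 = 0")
  case False
  have lim: "((\<lambda>x. z0 + of_real x) \<longlongrightarrow> z0) (at_right 0)"
    by (auto intro!: tendsto_eq_intros)
  have "isCont f z0" "isCont (deriv f) z0"
    using f S holomorphic_deriv[OF f S(1)] by (auto dest!: holomorphic_on_imp_continuous_on simp: continuous_on_eq_continuous_at)
  hence l: "((\<lambda>x. f (z0 + of_real x)) \<longlongrightarrow> f z0) (at_right 0)" "((\<lambda>x. deriv f (z0 + of_real x)) \<longlongrightarrow> deriv f z0) (at_right 0)"
    using lim by (auto intro: isCont_tendsto_compose)
  have "((\<lambda>x. of_real x * (deriv f (z0 + of_real x) / f (z0 + of_real x))) \<longlongrightarrow> of_real 0 * (deriv f z0 / f z0)) (at_right 0)"
    by (intro tendsto_intros l False)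
  thus ?thesis using that[of 0] False tendsto_imp_eventually_ne[OF l(1) False] by simp
next
  case True
  have "\<not> f constant_on S" using True nz S(3) by (metis constant_on_def)
  with f S True obtain g r n where n: "0 < n" "0 < r" "ball z0 r \<subseteq> S" "g holomorphic_on ball z0 r"
    "\<And>w. w \<in> ball z0 r \<Longrightarrow> f w = (w - z0) ^ n * g w" "\<And>w. w \<in> ball z0 r \<Longrightarrow> g w \<noteq> 0"
    by (rule holomorphic_factor_zero_nonconstant) (rule that)
  have mem: "z0 + of_real x \<in> ball z0 r" if "0 < x" "x < r" for x using that by (simp add: dist_norm)
  have dg: "(g has_field_derivative deriv g w) (at w)" if "w \<in> ball z0 r" for w
    using n(4) that by (intro holomorphic_derivI[of _ "ball z0 r"]) auto
  have df: "deriv f w = of_nat n * (w - z0) ^ (n - 1) * g w + (w - z0) ^ n * deriv g w" if w: "w \<in> ball z0 r" for w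
  proof -
    have "((\<lambda>w. (w - z0) ^ n * g w) has_field_derivative of_nat n * (w - z0) ^ (n - 1) * g w + (w - z0) ^ n * deriv g w) (at w)"
      by (auto intro!: derivative_eq_intros dg w)
    hence "(f has_field_derivative of_nat n * (w - z0) ^ (n - 1) * g w + (w - z0) ^ n * deriv g w) (at w)"
      by (rule has_field_derivative_transform_within_open[of _ _ _ "ball z0 r"]) (use w n in auto)
    thus ?thesis by (rule DERIV_imp_deriv)
  qed
  have eq: "of_real x * (deriv f (z0 + of_real x) / f (z0 + of_real x)) =
     of_nat n + of_real x * (deriv g (z0 + of_real x) / g (z0 + of_real x))" if x: "0 < x" "x < r" for x
  proof -
    have "(of_real x :: complex) ^ n = of_real x * of_real x ^ (n - 1)" using n(1)
      by (metis power_Suc Suc_diff_1)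
    moreover have "g (z0 + of_real x) \<noteq> 0" using n(6) mem[OF x] by blast
    moreover have "(of_real x :: complex) \<noteq> 0" using x by simp
    ultimately show ?thesis
      unfolding df[OF mem[OF x]] n(5)[OF mem[OF x]] by (simp add: field_simps)
  qed
  have ev: "\<forall>\<^sub>F x in at_right 0. 0 < x \<and> x < r"
    using n(2) eventually_at_right_less[of 0] by (auto simp: eventually_at_right_field intro!: exI[of _ r])
  have lim: "((\<lambda>x. z0 + of_real x) \<longlongrightarrow> z0) (at_right 0)"
    by (auto intro!: tendsto_eq_intros)
  have z0: "z0 \<in> ball z0 r" using n by simp
  have "isCont g z0" "isCont (deriv g) z0"
    using n(4) z0 holomorphic_deriv[OF n(4)] by (auto dest!: holomorphic_on_imp_continuous_on simp: continuous_on_eq_continuous_at)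
  hence l: "((\<lambda>x. g (z0 + of_real x)) \<longlongrightarrow> g z0) (at_right 0)" "((\<lambda>x. deriv g (z0 + of_real x)) \<longlongrightarrow> deriv g z0) (at_right 0)"
    using lim by (auto intro: isCont_tendsto_compose)
  have "((\<lambda>x. of_nat n + of_real x * (deriv g (z0 + of_real x) / g (z0 + of_real x))) \<longlongrightarrow> of_nat n + of_real 0 * (deriv g z0 / g z0)) (at_right 0)"
    using n(6)[OF z0] by (intro tendsto_intros l)
  hence "((\<lambda>x. of_nat n + of_real x * (deriv g (z0 + of_real x) / g (z0 + of_real x))) \<longlongrightarrow> of_nat n) (at_right 0)" by simp
  hence L: "((\<lambda>x. of_real x * (deriv f (z0 + of_real x) / f (z0 + of_real x))) \<longlongrightarrow> of_nat n) (at_right 0)"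
    by (rule Lim_transform_eventually) (use ev eq in \<open>auto elim!: eventually_mono\<close>)
  have "\<forall>\<^sub>F x in at_right 0. f (z0 + of_real x) \<noteq> 0"
    using ev by eventually_elim (use n(5,6) mem in auto)
  with L True n(1) show ?thesis by (intro that[of n]) auto
qed

lemma Re_nat_powr: "Re (of_nat n powr (- (Complex \<sigma> t))) = real n powr (- \<sigma>) * cos (t * ln (real n))"
proof (cases "n = 0")
  case False
  have "of_nat n powr (- (Complex \<sigma> t)) = exp (- (Complex \<sigma> t) * of_real (ln (real n)))"
    using False by (simp add: powr_def Ln_of_nat)
  also have "- (Complex \<sigma> t) * of_real (ln (real n)) = Complex (- \<sigma> * ln (real n)) (- t * ln (real n))"
    by (simp add: complex_eq_iff)
  finally show ?thesis using False by (simp add: exp_eq_polar powr_def Re_exp)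
qed simp

lemma zeta_ld_sums: "Re s > 1 \<Longrightarrow> (\<lambda>n. mangoldt n * of_nat n powr (- s)) sums zeta_ld s"
  unfolding zeta_ld_def by (intro summable_sums) (rule summable_norm_cancel[OF summable_zeta_ld])

lemma zeta_sums: "Re s > 1 \<Longrightarrow> (\<lambda>n. of_nat n powr (- s)) sums zeta s"
  unfolding zeta_def by (intro summable_sums) (rule summable_norm_cancel[OF summable_zeta])

lemma Re_zeta_ld_sums:
  assumes "\<sigma> > 1"
  shows "(\<lambda>n. mangoldt n * real n powr (- \<sigma>) * cos (t * ln (real n))) sums Re (zeta_ld (Complex \<sigma> t))"
proof -
  have "(\<lambda>n. Re (mangoldt n * of_nat n powr (- Complex \<sigma> t))) sums Re (zeta_ld (Complex \<sigma> t))"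
    using assms by (intro sums_Re zeta_ld_sums) auto
  moreover have "Re (mangoldt n * of_nat n powr (- Complex \<sigma> t)) = mangoldt n * real n powr (- \<sigma>) * cos (t * ln (real n))" for n
  proof -
    have "Re (complex_of_real (mangoldt n) * w) = mangoldt n * Re w" for w
      by (simp del: of_real_mangoldt)
    hence "Re (mangoldt n * of_nat n powr (- Complex \<sigma> t)) = mangoldt n * Re (of_nat n powr (- Complex \<sigma> t))"
      by (simp only: of_real_mangoldt)
    thus ?thesis by (simp only: Re_nat_powr mult.assoc)
  qed
  ultimately show ?thesis by (simp only:)
qed

text \<open>3 + 4 cos t + cos 2t = 2 (1 + cos t)^2, summed against nonnegative weights. Working with
  \<open>zeta_ld\<close> makes the inequality linear, so that it passes directly to the orders of
  zeros.\<close>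

lemma mertens_341:
  assumes "\<sigma> > 1"
  shows "0 \<le> Re (3 * zeta_ld (Complex \<sigma> 0) + 4 * zeta_ld (Complex \<sigma> t) + zeta_ld (Complex \<sigma> (2 * t)))"
proof -
  have "(\<lambda>n. 3 * (mangoldt n * real n powr (- \<sigma>) * cos (0 * ln (real n))) + 4 * (mangoldt n * real n powr (- \<sigma>) * cos (t * ln (real n)))
     + mangoldt n * real n powr (- \<sigma>) * cos (2 * t * ln (real n))) sums
     (3 * Re (zeta_ld (Complex \<sigma> 0)) + 4 * Re (zeta_ld (Complex \<sigma> t)) + Re (zeta_ld (Complex \<sigma> (2 * t))))"
    by (intro sums_add sums_mult Re_zeta_ld_sums assms)
  moreover have "0 \<le> 3 * (mangoldt n * real n powr (- \<sigma>) * cos (0 * ln (real n))) + 4 * (mangoldt n * real n powr (- \<sigma>) * cos (t * ln (real n)))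
     + mangoldt n * real n powr (- \<sigma>) * cos (2 * t * ln (real n))" for n
  proof -
    have "0 \<le> mangoldt n * real n powr (- \<sigma>) * (2 * (1 + cos (t * ln (real n)))\<^sup>2)"
      by (intro mult_nonneg_nonneg mangoldt_nonneg) auto
    also have "2 * (1 + cos (t * ln (real n)))\<^sup>2 = 3 + 4 * cos (t * ln (real n)) + cos (2 * (t * ln (real n)))"
      using cos_double_cos[of "t * ln (real n)"] by (simp add: power2_eq_square algebra_simps)
    finally show ?thesis by (simp add: algebra_simps)
  qed
  ultimately have "0 \<le> 3 * Re (zeta_ld (Complex \<sigma> 0)) + 4 * Re (zeta_ld (Complex \<sigma> t)) + Re (zeta_ld (Complex \<sigma> (2 * t)))"
    by (metis (no_types, lifting) sums_le sums_zero)
  thus ?thesis by simp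
qed

lemma zeta_reg_logderiv:
  assumes "Re s > 1" "zeta_reg s \<noteq> 0"
  shows "zeta_ld s = 1 / (s - 1) - deriv zeta_reg s / zeta_reg s"
proof -
  have "s \<noteq> 1" using assms by auto
  thus ?thesis using zeta_reg_deriv[OF assms(1)] assms(2) by (simp add: field_simps)
qed

text \<open>Here m is the order of \<open>zeta_reg\<close> at z0. The limit is minus the order of
  zeta there; the extra 1 at z0 = 1 is the pole, carried by the summand 1/(s - 1) of
  \<open>zeta_ld\<close>.\<close>

lemma zeta_ld_limit:
  assumes "Re z0 \<ge> 1"
  obtains m :: nat where "((\<lambda>x. of_real x * zeta_ld (z0 + of_real x)) \<longlongrightarrow> (if z0 = 1 then 1 else 0) - of_nat m) (at_right 0)"
    "m = 0 \<longleftrightarrow> zeta_reg z0 \<noteq> 0"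
proof -
  have conn: "connected {s. Re s > 0}" by (intro convex_connected convex_halfspace_Re_gt)
  have nz: "\<exists>z\<in>{s. Re s > 0}. zeta_reg z \<noteq> 0"
    by (rule bexI[of _ 1]) (auto simp: zeta_reg_1)
  obtain m :: nat where m: "((\<lambda>x. of_real x * (deriv zeta_reg (z0 + of_real x) / zeta_reg (z0 + of_real x))) \<longlongrightarrow> of_nat m) (at_right 0)"
    "\<forall>\<^sub>F x in at_right 0. zeta_reg (z0 + of_real x) \<noteq> 0" "m = 0 \<longleftrightarrow> zeta_reg z0 \<noteq> 0"
    by (rule logderiv_limit[OF zeta_reg_holomorphic open_halfplane conn _ nz, of z0]) (use assms in auto)
  have pole: "((\<lambda>x. of_real x * (1 / (z0 + of_real x - 1))) \<longlongrightarrow> (if z0 = 1 then 1 else 0)) (at_right (0::real))"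
  proof (cases "z0 = 1")
    case True
    have "\<forall>\<^sub>F x in at_right (0::real). 1 = of_real x * (1 / (z0 + of_real x - 1))"
      using eventually_at_right_less[of 0] by eventually_elim (simp add: True)
    hence "((\<lambda>x. of_real x * (1 / (z0 + of_real x - 1))) \<longlongrightarrow> 1) (at_right (0::real))"
      by (rule Lim_transform_eventually[OF tendsto_const])
    thus ?thesis using True by simp
  next
    case False
    have "((\<lambda>x. of_real x * (1 / (z0 + of_real x - 1))) \<longlongrightarrow> of_real 0 * (1 / (z0 + of_real 0 - 1))) (at_right (0::real))"
      using False by (intro tendsto_intros) auto
    thus ?thesis using False by simp
  qed
  have "((\<lambda>x. of_real x * (1 / (z0 + of_real x - 1)) - of_real x * (deriv zeta_reg (z0 + of_real x) / zeta_reg (z0 + of_real x)))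
    \<longlongrightarrow> (if z0 = 1 then 1 else 0) - of_nat m) (at_right 0)"
    by (intro tendsto_diff pole m)
  moreover have "\<forall>\<^sub>F x in at_right 0. of_real x * (1 / (z0 + of_real x - 1)) - of_real x * (deriv zeta_reg (z0 + of_real x) / zeta_reg (z0 + of_real x))
     = of_real x * zeta_ld (z0 + of_real x)"
    using m(2) eventually_at_right_less[of 0]
  proof eventually_elim
    case (elim x)
    hence "zeta_ld (z0 + of_real x) = 1 / (z0 + of_real x - 1) - deriv zeta_reg (z0 + of_real x) / zeta_reg (z0 + of_real x)"
      using assms by (intro zeta_reg_logderiv) auto
    thus ?case by (simp add: right_diff_distrib)
  qed
  ultimately have "((\<lambda>x. of_real x * zeta_ld (z0 + of_real x)) \<longlongrightarrow> (if z0 = 1 then 1 else 0) - of_nat m) (at_right 0)"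
    by (rule Lim_transform_eventually)
  thus ?thesis using that m(3) by blast
qed

text \<open>The bound is independent of x. It forces x * \<open>zeta_ld\<close> (s + x) to tend to
  0, which excludes zeros with Re s > 1.\<close>

lemma zeta_ld_bound:
  assumes "Re s > 1" "x \<ge> 0"
  shows "norm (zeta_ld (s + of_real x)) \<le> (\<Sum>n. mangoldt n * real n powr (- Re s))"
proof -
  have "norm (zeta_ld (s + of_real x)) \<le> (\<Sum>n. norm (mangoldt n * of_nat n powr (- (s + of_real x)) :: complex))"
    unfolding zeta_ld_def using assms by (intro summable_norm summable_zeta_ld) auto
  also have "\<dots> \<le> (\<Sum>n. mangoldt n * real n powr (- Re s))"
  proof (intro suminf_le allI)
    fix n
    show "norm (mangoldt n * of_nat n powr (- (s + of_real x)) :: complex) \<le> mangoldt n * real n powr (- Re s)"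
      using assms by (cases "n = 0") (auto simp: norm_mult norm_nat_powr mangoldt_nonneg intro!: mult_left_mono powr_mono)
  qed (use assms summable_zeta_ld[of "s + of_real x"] summable_mangoldt_powr[of "Re s"] in auto)
  finally show ?thesis .
qed

text \<open>A zero of order m >= 1 would make x * \<open>zeta_ld\<close> (s + x) tend to -m. For Re
  s > 1 this contradicts boundedness. At s = 1 + i t the limit of the 3-4-1 inequality is 3 (1 - m0)
  - 4 m - m2 >= 0, with m0 and m2 the orders at 1 and 1 + 2 i t, which is impossible.\<close>

lemma zeta_reg_nonzero:
  assumes "Re s \<ge> 1"
  shows "zeta_reg s \<noteq> 0"
proof
  assume zero: "zeta_reg s = 0"
  hence s1: "s \<noteq> 1" using zeta_reg_1 by auto
  obtain m :: nat where m: "((\<lambda>x. of_real x * zeta_ld (s + of_real x)) \<longlongrightarrow> (if s = 1 then 1 else 0) - of_nat m) (at_right 0)"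
    "m = 0 \<longleftrightarrow> zeta_reg s \<noteq> 0"
    using zeta_ld_limit[OF assms] .
  have mpos: "m > 0" using m(2) zero by simp
  show False
  proof (cases "Re s > 1")
    case True
    define B where "B = (\<Sum>n. mangoldt n * real n powr (- Re s))"
    have "((\<lambda>x. \<bar>x\<bar> * B) \<longlongrightarrow> \<bar>0\<bar> * B) (at_right (0::real))" by (intro tendsto_intros)
    hence "((\<lambda>x. \<bar>x\<bar> * B) \<longlongrightarrow> 0) (at_right (0::real))" by simp
    hence "((\<lambda>x. of_real x * zeta_ld (s + of_real x)) \<longlongrightarrow> 0) (at_right 0)"
    proof (rule Lim_null_comparison[rotated])
      show "\<forall>\<^sub>F x in at_right 0. norm (of_real x * zeta_ld (s + of_real x)) \<le> \<bar>x\<bar> * B"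
        using eventually_at_right_less[of 0]
        by eventually_elim (auto simp: norm_mult B_def intro!: mult_left_mono zeta_ld_bound True)
    qed
    from tendsto_unique[OF _ m(1) this] mpos s1 show False by simp
  next
    case False
    define t where "t = Im s"
    have s: "s = Complex 1 t" using False assms by (simp add: complex_eq_iff t_def)
    have lim: "((\<lambda>x. x * Re (zeta_ld (Complex (1 + x) u))) \<longlongrightarrow> (if u = 0 then 1 else 0) - real k) (at_right 0)"
      if "((\<lambda>x. of_real x * zeta_ld (Complex 1 u + of_real x)) \<longlongrightarrow> (if Complex 1 u = 1 then 1 else 0) - of_nat k) (at_right 0)" for u k
    proof -
      have "((\<lambda>x. Re (of_real x * zeta_ld (Complex 1 u + of_real x))) \<longlongrightarrow> Re ((if Complex 1 u = 1 then 1 else 0) - of_nat k)) (at_right 0)"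
        by (intro tendsto_Re that)
      moreover have "Complex 1 u + of_real x = Complex (1 + x) u" for x by (simp add: complex_eq_iff)
      moreover have "Complex 1 u = 1 \<longleftrightarrow> u = 0" by (simp add: complex_eq_iff)
      ultimately show ?thesis by (cases "u = 0") simp_all
    qed
    obtain m0 :: nat where m0: "((\<lambda>x. of_real x * zeta_ld (Complex 1 0 + of_real x)) \<longlongrightarrow> (if Complex 1 0 = 1 then 1 else 0) - of_nat m0) (at_right 0)"
      by (rule zeta_ld_limit[of "Complex 1 0"]) auto
    obtain m2 :: nat where m2: "((\<lambda>x. of_real x * zeta_ld (Complex 1 (2 * t) + of_real x)) \<longlongrightarrow> (if Complex 1 (2 * t) = 1 then 1 else 0) - of_nat m2) (at_right 0)"
      by (rule zeta_ld_limit[of "Complex 1 (2 * t)"]) auto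
    have t0: "t \<noteq> 0" using s1 s by (auto simp: complex_eq_iff)
    have "((\<lambda>x. 3 * (x * Re (zeta_ld (Complex (1 + x) 0))) + 4 * (x * Re (zeta_ld (Complex (1 + x) t))) + x * Re (zeta_ld (Complex (1 + x) (2 * t))))
      \<longlongrightarrow> 3 * ((if (0::real) = 0 then 1 else 0) - real m0) + 4 * ((if t = 0 then 1 else 0) - real m) + ((if 2 * t = 0 then 1 else 0) - real m2)) (at_right 0)"
      using m(1) m0 m2 unfolding s by (intro tendsto_intros lim)
    hence "0 \<le> 3 * ((if (0::real) = 0 then 1 else 0) - real m0) + 4 * ((if t = 0 then 1 else 0) - real m) + ((if 2 * t = 0 then 1 else 0) - real m2)"
    proof (rule tendsto_lowerbound)
      show "\<forall>\<^sub>F x in at_right 0. 0 \<le> 3 * (x * Re (zeta_ld (Complex (1 + x) 0))) + 4 * (x * Re (zeta_ld (Complex (1 + x) t))) + x * Re (zeta_ld (Complex (1 + x) (2 * t)))"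
        using eventually_at_right_less[of 0]
      proof eventually_elim
        case (elim x)
        hence "0 \<le> x * Re (3 * zeta_ld (Complex (1 + x) 0) + 4 * zeta_ld (Complex (1 + x) t) + zeta_ld (Complex (1 + x) (2 * t)))"
          by (intro mult_nonneg_nonneg mertens_341) auto
        thus ?case by (simp add: algebra_simps)
      qed
    qed simp
    thus False using mpos t0 by simp
  qed
qed

text \<open>Both \<open>zeta_ld\<close> and \<open>zeta\<close> have a simple pole with residue 1 at
  1. The formula has these poles cancelled by hand, the difference quotient being completed at 1 by
  the derivative, so it makes sense up to the line Re s = 1.\<close>

definition zeta_diff :: "complex \<Rightarrow> complex" where
  "zeta_diff s = - (if s = 1 then deriv zeta_reg 1 else (zeta_reg s - zeta_reg 1) / (s - 1)) - deriv zeta_reg s / zeta_reg s"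

lemma zeta_diff_eq:
  assumes "Re s > 1"
  shows "zeta_diff s = zeta_ld s - zeta s"
proof -
  have s: "s \<noteq> 1" "zeta_reg s \<noteq> 0" using assms zeta_reg_nonzero[of s] by auto
  have "- ((zeta_reg s - zeta_reg 1) / (s - 1)) = 1 / (s - 1) - zeta s"
    using s(1) by (simp add: zeta_reg_1 zeta_reg_eq[OF assms] field_simps)
  thus ?thesis using zeta_reg_logderiv[OF assms s(2)] s(1) by (simp add: zeta_diff_def)
qed

text \<open>The difference quotient has a removable singularity at 1; the other quotient is where
  the nonvanishing of \<open>zeta_reg\<close> on the closed half-plane enters.\<close>

lemma continuous_zeta_diff: "continuous_on {s. Re s \<ge> 1} zeta_diff"
proof -
  have sub: "{s. Re s \<ge> 1} \<subseteq> {s. Re s > 0}" by auto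
  have "(\<lambda>s. if s = 1 then deriv zeta_reg 1 else (zeta_reg s - zeta_reg 1) / (s - 1)) holomorphic_on {s. Re s > 0}"
    by (rule pole_lemma[OF zeta_reg_holomorphic]) (simp add: interior_open[OF open_halfplane])
  hence 1: "continuous_on {s. Re s \<ge> 1} (\<lambda>s. if s = 1 then deriv zeta_reg 1 else (zeta_reg s - zeta_reg 1) / (s - 1))"
    by (rule continuous_on_subset[OF holomorphic_on_imp_continuous_on sub])
  have 2: "continuous_on {s. Re s \<ge> 1} zeta_reg"
    by (rule continuous_on_subset[OF holomorphic_on_imp_continuous_on[OF zeta_reg_holomorphic] sub])
  have 3: "continuous_on {s. Re s \<ge> 1} (deriv zeta_reg)"
    by (rule continuous_on_subset[OF holomorphic_on_imp_continuous_on[OF holomorphic_deriv[OF zeta_reg_holomorphic open_halfplane]] sub])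
  show ?thesis unfolding zeta_diff_def[abs_def]
    by (intro continuous_intros 1 2 3) (use zeta_reg_nonzero in auto)
qed

section \<open>The Fejer kernel and the Wiener--Ikehara argument\<close>

text \<open>Shifting t by the half period h = pi / y changes the sign of cis (y t). Adding the
  integral to its shifted form leaves two boundary pieces of length h and the integral of \<phi> t -
  \<phi> (t + h), which is small by uniform continuity.\<close>

lemma riemann_lebesgue:
  fixes \<phi> :: "real \<Rightarrow> complex"
  assumes T: "T > 0" and cont: "continuous_on {0..T} \<phi>"
  shows "((\<lambda>y. integral {0..T} (\<lambda>t. \<phi> t * cis (y * t))) \<longlongrightarrow> 0) at_top"
proof (rule tendstoI)
  fix e :: real assume e: "e > 0"
  have "bounded (\<phi> ` {0..T})" using cont compact_continuous_image compact_imp_bounded by blast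
  then obtain B where B: "B > 0" "\<And>t. t \<in> {0..T} \<Longrightarrow> norm (\<phi> t) \<le> B" by (auto simp: bounded_pos)
  have "uniformly_continuous_on {0..T} \<phi>" using cont by (intro compact_uniformly_continuous) auto
  then obtain d where d: "d > 0" "\<And>t s. t \<in> {0..T} \<Longrightarrow> s \<in> {0..T} \<Longrightarrow> dist s t < d \<Longrightarrow> dist (\<phi> s) (\<phi> t) < e / T"
    using e T unfolding uniformly_continuous_on_def by (metis divide_pos_pos)
  have "((\<lambda>y. pi / y) \<longlongrightarrow> 0) at_top" by (rule tendsto_divide_0[OF tendsto_const filterlim_at_top_imp_at_infinity[OF filterlim_ident]])
  \<comment> \<open>The third bound, e/(2B), keeps both boundary pieces together below e; the
    remaining part is at most e, to be compared with twice the integral.\<close>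
  hence "\<forall>\<^sub>F y in at_top. pi / y < min (min d T) (e / (2 * B))"
    by (rule order_tendstoD) (use d T e B in auto)
  thus "\<forall>\<^sub>F y in at_top. dist (integral {0..T} (\<lambda>t. \<phi> t * cis (y * t))) 0 < e"
    using eventually_gt_at_top[of 0]
  proof eventually_elim
    case (elim y)
    define h where "h = pi / y"
    define F where "F t = \<phi> t * cis (y * t)" for t
    have h: "0 < h" "h < d" "h < T" "h < e / (2 * B)" using elim by (auto simp: h_def)
    have Fc: "continuous_on {0..T} F" unfolding F_def by (intro continuous_intros cont)
    have Fb: "norm (F t) \<le> B" if "t \<in> {0..T}" for t using B(2)[OF that] by (simp add: F_def norm_mult)
    have int: "F integrable_on {0..T}" by (intro integrable_continuous_real Fc)
    have shift: "F (t + h) = - (\<phi> (t + h) * cis (y * t))" for t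
    proof -
      have "y * (t + h) = y * t + pi" using elim by (simp add: h_def field_simps)
      thus ?thesis by (simp add: F_def cis_mult[symmetric])
    qed
    have c1: "continuous_on {0..T - h} (\<lambda>t. \<phi> (t + h) * cis (y * t))"
    proof -
      have "continuous_on {0..T - h} (\<lambda>t. \<phi> (t + h))"
        by (rule continuous_on_compose2[OF cont]) (use h in \<open>auto intro!: continuous_intros\<close>)
      thus ?thesis by (intro continuous_intros)
    qed
    have c2: "continuous_on {0..T - h} F" by (rule continuous_on_subset[OF Fc]) (use h in auto)
    have J1: "integral {0..T} F = integral {0..T - h} F + integral {T - h..T} F"
      using Henstock_Kurzweil_Integration.integral_combine[where a = 0 and c = "T - h" and b = T and f = F] h int by simp
    have "integral {h..T} F = integral {h - h..T - h} (\<lambda>t. F (t + h))" by (rule integral_shift_real_ivl[symmetric])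
    also have "\<dots> = - integral {0..T - h} (\<lambda>t. \<phi> (t + h) * cis (y * t))" by (simp add: shift)
    finally have J2: "integral {0..T} F = integral {0..h} F - integral {0..T - h} (\<lambda>t. \<phi> (t + h) * cis (y * t))"
      using Henstock_Kurzweil_Integration.integral_combine[where a = 0 and c = h and b = T and f = F] h int by simp
    have "integral {0..T} F + integral {0..T} F =
       integral {0..h} F + integral {T - h..T} F + (integral {0..T - h} F - integral {0..T - h} (\<lambda>t. \<phi> (t + h) * cis (y * t)))"
      by (subst (1) J1, subst J2) simp
    also have "integral {0..T - h} F - integral {0..T - h} (\<lambda>t. \<phi> (t + h) * cis (y * t)) =
       integral {0..T - h} (\<lambda>t. F t - \<phi> (t + h) * cis (y * t))"
      by (intro integral_diff[symmetric] integrable_continuous_real c1 c2)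
    finally have eq: "2 * integral {0..T} F = integral {0..h} F + integral {T - h..T} F + integral {0..T - h} (\<lambda>t. F t - \<phi> (t + h) * cis (y * t))"
      by simp
    have b1: "norm (integral {0..h} F) \<le> B * (h - 0)"
      by (intro integral_bound continuous_on_subset[OF Fc] Fb) (use h in auto)
    have b2: "norm (integral {T - h..T} F) \<le> B * (T - (T - h))"
      by (intro integral_bound continuous_on_subset[OF Fc] Fb) (use h in auto)
    have b3: "norm (integral {0..T - h} (\<lambda>t. F t - \<phi> (t + h) * cis (y * t))) \<le> e / T * (T - h - 0)"
    proof (rule integral_bound)
      fix t assume t: "t \<in> {0..T - h}"
      have "F t - \<phi> (t + h) * cis (y * t) = (\<phi> t - \<phi> (t + h)) * cis (y * t)" by (simp add: F_def left_diff_distrib)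
      hence "norm (F t - \<phi> (t + h) * cis (y * t)) = dist (\<phi> t) (\<phi> (t + h))" by (simp add: norm_mult dist_norm)
      also have "\<dots> < e / T" using t h by (intro d(2)) (auto simp: dist_norm)
      finally show "norm (F t - \<phi> (t + h) * cis (y * t)) \<le> e / T" by simp
    qed (use h in \<open>auto intro!: continuous_intros c1 c2\<close>)
    have "e / T * (T - h - 0) \<le> e / T * T" using h e T by (intro mult_left_mono) auto
    hence b3': "norm (integral {0..T - h} (\<lambda>t. F t - \<phi> (t + h) * cis (y * t))) \<le> e" using b3 T by simp
    have hB: "h * B * 2 < e" using h B by (simp add: field_simps)
    have "norm (2 * integral {0..T} F) \<le> norm (integral {0..h} F) + norm (integral {T - h..T} F) + norm (integral {0..T - h} (\<lambda>t. F t - \<phi> (t + h) * cis (y * t)))"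
      unfolding eq by (intro order.trans[OF norm_triangle_ineq] add_mono order.trans[OF norm_triangle_ineq]) auto
    also have "\<dots> \<le> B * h + B * h + e" using b1 b2 b3' by simp
    also have "\<dots> < 2 * e" using hB by (simp add: mult.commute)
    finally show ?case by (simp add: norm_mult F_def[abs_def])
  qed
qed

section \<open>The Fejer kernel and its mass near the origin\<close>

definition fejer :: "real \<Rightarrow> real \<Rightarrow> real" where
  "fejer T u = integral {0..T} (\<lambda>t. (1 - t / T) * cos (u * t))"

lemma fejer_eq:
  assumes T: "T > 0" and u: "u \<noteq> 0"
  shows "fejer T u = (1 - cos (T * u)) / (T * u\<^sup>2)"
proof -
  have "((\<lambda>t. (1 - t / T) * cos (u * t)) has_integral
     (((1 - T / T) * sin (u * T) / u - cos (u * T) / (T * u\<^sup>2)) - ((1 - 0 / T) * sin (u * 0) / u - cos (u * 0) / (T * u\<^sup>2)))) {0..T}"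
  proof (rule fundamental_theorem_of_calculus)
    fix t assume "t \<in> {0..T}"
    have "((\<lambda>t. (1 - t / T) * sin (u * t) / u - cos (u * t) / (T * u\<^sup>2)) has_real_derivative (1 - t / T) * cos (u * t)) (at t)"
      using T u by (auto intro!: derivative_eq_intros simp: field_simps power2_eq_square)
    thus "((\<lambda>t. (1 - t / T) * sin (u * t) / u - cos (u * t) / (T * u\<^sup>2)) has_vector_derivative (1 - t / T) * cos (u * t)) (at t within {0..T})"
      unfolding has_real_derivative_iff_has_vector_derivative[symmetric] by (rule has_field_derivative_at_within)
  qed (use T in simp)
  from integral_unique[OF this] show ?thesis using T by (simp add: fejer_def diff_divide_distrib mult.commute)
qed

lemma fejer_0:
  assumes T: "T > 0"
  shows "fejer T 0 = T / 2"
proof -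
  have "((\<lambda>t. 1 - t / T) has_integral ((T - T\<^sup>2 / (2 * T)) - (0 - 0\<^sup>2 / (2 * T)))) {0..T}"
  proof (rule fundamental_theorem_of_calculus)
    fix t assume "t \<in> {0..T}"
    have "((\<lambda>t. t - t\<^sup>2 / (2 * T)) has_real_derivative 1 - t / T) (at t)"
      using T by (auto intro!: derivative_eq_intros simp: field_simps)
    thus "((\<lambda>t. t - t\<^sup>2 / (2 * T)) has_vector_derivative 1 - t / T) (at t within {0..T})"
      unfolding has_real_derivative_iff_has_vector_derivative[symmetric] by (rule has_field_derivative_at_within)
  qed (use T in simp)
  from integral_unique[OF this] show ?thesis using T by (simp add: fejer_def power2_eq_square)
qed

lemma fejer_nonneg: "T > 0 \<Longrightarrow> 0 \<le> fejer T u"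
  by (cases "u = 0") (auto simp: fejer_eq fejer_0)

lemma fejer_le_inverse_square:
  assumes "T > 0" "u \<noteq> 0"
  shows "fejer T u \<le> 2 / (T * u\<^sup>2)"
proof -
  have "1 - cos (T * u) \<le> 2" using cos_ge_minus_one[of "T * u"] by linarith
  thus ?thesis using assms by (simp add: fejer_eq divide_right_mono)
qed

lemma continuous_fejer_integrand: "continuous_on S (\<lambda>t::real. (1 - t / T) * cos (u * t))"
  by (cases "T = 0") (auto intro!: continuous_intros)

lemma fejer_integrand_le: "T > 0 \<Longrightarrow> t \<in> {0..T} \<Longrightarrow> \<bar>1 - t / T\<bar> \<le> 1" for t :: real
  by (auto simp: abs_le_iff field_simps)

lemma fejer_le:
  assumes "T > 0"
  shows "fejer T u \<le> T"
proof -
  have "norm (integral {0..T} (\<lambda>t. (1 - t / T) * cos (u * t))) \<le> 1 * (T - 0)"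
    using assms fejer_integrand_le[OF assms] abs_cos_le_one[of "u * t" for t]
    by (intro integral_bound continuous_fejer_integrand) (auto simp: abs_mult intro!: mult_le_one)
  thus ?thesis by (simp add: fejer_def)
qed

lemma abs_cos_diff_le: "\<bar>cos x - cos y\<bar> \<le> \<bar>x - y\<bar>" for x y :: real
proof -
  have "norm (cos x - cos y) \<le> 1 * norm (x - y)"
    by (rule field_differentiable_bound[of UNIV cos "\<lambda>x. - sin x"])
      (auto intro!: derivative_eq_intros)
  thus ?thesis by simp
qed

text \<open>Needed to compare the kernel at ln n with its values on the whole interval up to ln (n +
  1).\<close>

lemma fejer_lipschitz:
  assumes T: "T > 0"
  shows "\<bar>fejer T u - fejer T v\<bar> \<le> T\<^sup>2 * \<bar>u - v\<bar>"
proof -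
  have "fejer T u - fejer T v = integral {0..T} (\<lambda>t. (1 - t / T) * cos (u * t) - (1 - t / T) * cos (v * t))"
    unfolding fejer_def by (intro integral_diff[symmetric] integrable_continuous_real continuous_fejer_integrand)
  moreover have "norm (integral {0..T} (\<lambda>t. (1 - t / T) * cos (u * t) - (1 - t / T) * cos (v * t))) \<le> (T * \<bar>u - v\<bar>) * (T - 0)"
  proof (rule integral_bound)
    fix t assume t: "t \<in> {0..T}"
    have "norm ((1 - t / T) * cos (u * t) - (1 - t / T) * cos (v * t)) = \<bar>1 - t / T\<bar> * \<bar>cos (u * t) - cos (v * t)\<bar>"
      by (simp add: abs_mult[symmetric] right_diff_distrib)
    also have "\<dots> \<le> 1 * \<bar>u * t - v * t\<bar>" by (intro mult_mono fejer_integrand_le T t abs_cos_diff_le) auto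
    also have "\<dots> = t * \<bar>u - v\<bar>" using t by (simp add: abs_mult left_diff_distrib[symmetric])
    also have "\<dots> \<le> T * \<bar>u - v\<bar>" using t by (intro mult_right_mono) auto
    finally show "norm ((1 - t / T) * cos (u * t) - (1 - t / T) * cos (v * t)) \<le> T * \<bar>u - v\<bar>" .
  qed (use T in \<open>auto intro!: continuous_on_diff continuous_fejer_integrand\<close>)
  ultimately show ?thesis by (simp add: power2_eq_square mult_ac)
qed

lemma continuous_fejer:
  assumes T: "T > 0"
  shows "continuous_on S (fejer T)"
proof -
  have "(T\<^sup>2)-lipschitz_on S (fejer T)"
    by (rule lipschitz_onI) (use fejer_lipschitz[OF T] in \<open>auto simp: dist_real_def\<close>)
  thus ?thesis by (rule lipschitz_on_continuous_on)
qed

lemma fejer_minus: "fejer T (- u) = fejer T u" by (simp add: fejer_def)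

lemma fejer_integrable: "T > 0 \<Longrightarrow> fejer T integrable_on {a..b}"
  by (intro integrable_continuous_real continuous_fejer)

text \<open>cos(u t) >= 1/2 for |u t| <= 1 < pi/3, so at least half of the value T/2 at the origin
  remains.\<close>

lemma fejer_ge:
  assumes T: "T > 0" and u: "\<bar>u\<bar> \<le> 1 / T"
  shows "T / 4 \<le> fejer T u"
proof -
  have "T / 4 = fejer T 0 / 2" using T by (simp add: fejer_0)
  also have "\<dots> = integral {0..T} (\<lambda>t. (1 - t / T) * (1 / 2))"
    unfolding fejer_def by (subst integral_mult_left) simp
  also have "\<dots> \<le> fejer T u"
    unfolding fejer_def
  proof (intro integral_le integrable_continuous_real continuous_fejer_integrand)
    show "continuous_on {0..T} (\<lambda>t. (1 - t / T) * (1 / 2))" using T by (intro continuous_intros) auto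
    fix t assume t: "t \<in> {0..T}"
    have "\<bar>u * t\<bar> \<le> 1 / T * T" unfolding abs_mult using t T u by (intro mult_mono) auto
    hence "\<bar>u * t\<bar> \<le> 1" using T by simp
    hence "cos (pi / 3) \<le> cos \<bar>u * t\<bar>" using pi_gt3 by (intro cos_monotone_0_pi_le) auto
    hence "1 / 2 \<le> cos (u * t)" by (simp add: cos_60)
    moreover have "0 \<le> 1 - t / T" using t T by simp
    ultimately show "(1 - t / T) * (1 / 2) \<le> (1 - t / T) * cos (u * t)" by (intro mult_left_mono)
  qed
  finally show ?thesis .
qed

text \<open>The central mass serves as normalising constant: the kernel has mass at most 4/(T r)
  outside [-r, r], and \<open>mangoldt_log_interval\<close> divides by this mass, so the full
  integral is never evaluated.\<close>

definition fejer_mass :: "real \<Rightarrow> real \<Rightarrow> real" where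
  "fejer_mass T r = integral {- r..r} (fejer T)"

lemma fejer_mass_ge:
  assumes T: "T > 0" and r: "T * r \<ge> 1"
  shows "1 / 2 \<le> fejer_mass T r"
proof -
  have r': "1 / T \<le> r" using assms by (simp add: field_simps)
  have "1 / 2 = integral {- (1 / T)..1 / T} (\<lambda>_. T / 4)" using T by simp
  also have "\<dots> \<le> integral {- (1 / T)..1 / T} (fejer T)"
    using T by (intro integral_le fejer_integrable fejer_ge) auto
  also have "\<dots> \<le> fejer_mass T r"
    unfolding fejer_mass_def using r' T by (intro integral_subset_le fejer_integrable ballI fejer_nonneg) auto
  finally show ?thesis .
qed

lemma fejer_tail:
  assumes T: "T > 0" and r: "0 < r" "r \<le> R"
  shows "integral {r..R} (fejer T) \<le> 2 / (T * r)"
proof -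
  have "((\<lambda>u. 2 / (T * u\<^sup>2)) has_integral (- 2 / (T * R) - (- 2 / (T * r)))) {r..R}"
  proof (rule fundamental_theorem_of_calculus)
    fix u assume u: "u \<in> {r..R}"
    have "((\<lambda>u. - 2 / (T * u)) has_real_derivative 2 / (T * u\<^sup>2)) (at u)"
      using T r u by (auto intro!: derivative_eq_intros simp: power2_eq_square field_simps)
    thus "((\<lambda>u. - 2 / (T * u)) has_vector_derivative 2 / (T * u\<^sup>2)) (at u within {r..R})"
      unfolding has_real_derivative_iff_has_vector_derivative[symmetric] by (rule has_field_derivative_at_within)
  qed (use r in simp)
  moreover have "(fejer T has_integral integral {r..R} (fejer T)) {r..R}"
    using fejer_integrable[OF T] by (rule integrable_integral)
  ultimately have "integral {r..R} (fejer T) \<le> - 2 / (T * R) - (- 2 / (T * r))"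
    using has_integral_le[of "fejer T" "integral {r..R} (fejer T)" "{r..R}"] r fejer_le_inverse_square[OF T] by auto
  also have "\<dots> \<le> 2 / (T * r)" using T r by simp
  finally show ?thesis .
qed

lemma fejer_integral_le:
  assumes T: "T > 0" and r: "r > 0"
  shows "integral {p..q} (fejer T) \<le> fejer_mass T r + 4 / (T * r)"
proof -
  define R where "R = max r (max \<bar>p\<bar> \<bar>q\<bar>)"
  have R: "r \<le> R" "{p..q} \<subseteq> {- R..R}" unfolding R_def by auto
  have "integral {p..q} (fejer T) \<le> integral {- R..R} (fejer T)"
    using R T by (intro integral_subset_le fejer_integrable ballI fejer_nonneg) auto
  also have "\<dots> = integral {- R..- r} (fejer T) + integral {- r..r} (fejer T) + integral {r..R} (fejer T)"
    using Henstock_Kurzweil_Integration.integral_combine[where a = "- R" and c = "- r" and b = R and f = "fejer T"]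
      Henstock_Kurzweil_Integration.integral_combine[where a = "- r" and c = r and b = R and f = "fejer T"] R r fejer_integrable[OF T] by simp
  also have "integral {- R..- r} (fejer T) = integral {r..R} (fejer T)"
    using Henstock_Kurzweil_Integration.integral_reflect_real[of R r "fejer T"] by (simp add: fejer_minus)
  also have "\<dots> + integral {- r..r} (fejer T) + integral {r..R} (fejer T) \<le> 2 / (T * r) + integral {- r..r} (fejer T) + 2 / (T * r)"
    using R by (intro add_mono fejer_tail T r) auto
  finally show ?thesis by (simp add: fejer_mass_def)
qed

section \<open>Smoothed sums of mangoldt\<close>

definition wi_integral :: "real \<Rightarrow> real \<Rightarrow> real \<Rightarrow> real" where
  "wi_integral T d y = integral {0..T} (\<lambda>t. (1 - t / T) * Re (zeta_diff (Complex (1 + d) t) * cis (y * t)))"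

lemma continuous_zeta_diff_compose:
  assumes "continuous_on S f" "continuous_on S g" "\<And>x. x \<in> S \<Longrightarrow> 1 \<le> f x"
  shows "continuous_on S (\<lambda>x. zeta_diff (Complex (f x) (g x)))"
proof (rule continuous_on_compose2[OF continuous_zeta_diff])
  show "continuous_on S (\<lambda>x. Complex (f x) (g x))"
    unfolding Complex_eq by (intro continuous_intros assms)
qed (use assms in auto)

lemma wi_integral_tendsto_at_top:
  assumes T: "T > 0"
  shows "(wi_integral T 0 \<longlongrightarrow> 0) at_top"
proof -
  define \<phi> where "\<phi> t = of_real (1 - t / T) * zeta_diff (Complex 1 t)" for t :: real
  have c: "continuous_on {0..T} \<phi>"
    unfolding \<phi>_def using T by (intro continuous_intros continuous_zeta_diff_compose) auto
  have "((\<lambda>y. Re (integral {0..T} (\<lambda>t. \<phi> t * cis (y * t)))) \<longlongrightarrow> Re 0) at_top"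
    by (intro tendsto_Re riemann_lebesgue T c)
  moreover have "Re (integral {0..T} (\<lambda>t. \<phi> t * cis (y * t))) = wi_integral T 0 y" for y
  proof -
    have "(\<lambda>t. \<phi> t * cis (y * t)) integrable_on {0..T}"
      by (intro integrable_continuous_real continuous_intros c)
    hence "Re (integral {0..T} (\<lambda>t. \<phi> t * cis (y * t))) = integral {0..T} (\<lambda>t. Re (\<phi> t * cis (y * t)))"
      by (subst integral_linear[OF _ bounded_linear_Re, symmetric]) (simp_all add: comp_def)
    also have "\<dots> = wi_integral T 0 y"
      unfolding wi_integral_def \<phi>_def by (intro integral_cong) (simp add: algebra_simps diff_divide_distrib)
    finally show ?thesis .
  qed
  ultimately show ?thesis by simp
qed

text \<open>\<open>zeta_diff\<close> is jointly continuous in (d, t) on a compact rectangle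
  including the edge d = 0. The integral therefore passes to the line Re s = 1, where the series are
  no longer available.\<close>

lemma wi_integral_tendsto_0:
  assumes T: "T > 0"
  shows "((\<lambda>d. wi_integral T d y) \<longlongrightarrow> wi_integral T 0 y) (at_right 0)"
proof -
  have "continuous_on {0..1} (\<lambda>d. integral (cbox 0 T) (\<lambda>t. (1 - t / T) * Re (zeta_diff (Complex (1 + d) t) * cis (y * t))))"
  proof (rule integral_continuous_on_param)
    show "continuous_on ({0..1} \<times> cbox 0 T) (\<lambda>(d, t). (1 - t / T) * Re (zeta_diff (Complex (1 + d) t) * cis (y * t)))"
      unfolding case_prod_unfold using T by (intro continuous_intros continuous_zeta_diff_compose) auto
  qed
  hence "continuous_on {0..1} (\<lambda>d. wi_integral T d y)" by (simp add: wi_integral_def)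
  hence "((\<lambda>d. wi_integral T d y) \<longlongrightarrow> wi_integral T 0 y) (at 0 within {0..1})"
    by (simp add: continuous_on_def)
  thus ?thesis by (simp add: at_within_Icc_at_right)
qed

text \<open>At s = 1 + d + i t the real part of n^(-s) cis (y t) is n^(-1-d) cos((y - ln n) t), and
  its integral against 1 - t/T is the kernel. For d > 0 the Weierstrass test justifies exchanging
  sum and integral.\<close>

lemma wi_sums:
  assumes T: "T > 0" and d: "d > 0"
  shows "(\<lambda>n. (mangoldt n - 1) * real n powr (- (1 + d)) * fejer T (y - ln (real n))) sums wi_integral T d y"
proof -
  define c where "c n = (mangoldt n - 1) * real n powr (- (1 + d))" for n
  define f where "f n t = c n * ((1 - t / T) * cos ((y - ln (real n)) * t))" for n t
  have sM: "summable (\<lambda>n. mangoldt n * real n powr (- (1 + d)) + real n powr (- (1 + d)))"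
    using d by (intro summable_add summable_mangoldt_powr summable_nat_powr) auto
  have cb: "\<bar>c n\<bar> \<le> mangoldt n * real n powr (- (1 + d)) + real n powr (- (1 + d))" for n
  proof -
    have "\<bar>mangoldt n - 1 :: real\<bar> \<le> mangoldt n + 1" using mangoldt_nonneg[of n] by linarith
    hence "\<bar>c n\<bar> \<le> (mangoldt n + 1) * real n powr (- (1 + d))"
      unfolding c_def abs_mult by (intro mult_mono) auto
    thus ?thesis by (simp add: distrib_right)
  qed
  have ptw: "(\<lambda>n. f n t) sums ((1 - t / T) * Re (zeta_diff (Complex (1 + d) t) * cis (y * t)))" for t
  proof -
    define s where "s = Complex (1 + d) t"
    have s: "Re s > 1" using d by (simp add: s_def)
    have "(\<lambda>n. mangoldt n * of_nat n powr (- s) - of_nat n powr (- s)) sums zeta_diff s"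
      unfolding zeta_diff_eq[OF s] by (intro sums_diff zeta_ld_sums zeta_sums s)
    hence "(\<lambda>n. (1 - t / T) * Re ((mangoldt n * of_nat n powr (- s) - of_nat n powr (- s)) * cis (y * t)))
       sums ((1 - t / T) * Re (zeta_diff s * cis (y * t)))"
      by (intro sums_mult sums_Re sums_mult2)
    moreover have "(1 - t / T) * Re ((mangoldt n * of_nat n powr (- s) - of_nat n powr (- s)) * cis (y * t)) = f n t" for n
    proof (cases "n = 0")
      case False
      have "of_nat n powr (- s) = exp (- s * of_real (ln (real n)))"
        using False by (simp add: powr_def Ln_of_nat)
      also have "- s * of_real (ln (real n)) = of_real (- (1 + d) * ln (real n)) + \<i> * of_real (- t * ln (real n))"
        by (simp add: complex_eq_iff s_def algebra_simps)
      also have "exp \<dots> = of_real (real n powr (- (1 + d))) * cis (- t * ln (real n))"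
      proof -
        have pw: "real n powr (- (1 + d)) = exp (- (1 + d) * ln (real n))" using False by (simp add: powr_def)
        show ?thesis unfolding pw by (simp only: exp_add exp_of_real cis_conv_exp)
      qed
      finally have p: "of_nat n powr (- s) * cis (y * t) = of_real (real n powr (- (1 + d))) * cis ((y - ln (real n)) * t)"
        by (simp add: mult.assoc cis_mult algebra_simps)
      have "(mangoldt n * of_nat n powr (- s) - of_nat n powr (- s)) * cis (y * t) = (mangoldt n - 1) * (of_nat n powr (- s) * cis (y * t))"
        by (simp add: algebra_simps)
      also have "\<dots> = of_real (c n) * cis ((y - ln (real n)) * t)"
        unfolding p by (simp add: c_def)
      finally show ?thesis by (simp add: f_def)
    qed (simp add: f_def c_def)
    ultimately show ?thesis by (simp add: s_def)
  qed
  have ul: "uniform_limit {0..T} (\<lambda>n t. \<Sum>i<n. f i t) (\<lambda>t. \<Sum>i. f i t) sequentially"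
  proof (rule Weierstrass_m_test[OF _ sM])
    fix n t assume t: "t \<in> {0..T}"
    have "norm (f n t) \<le> \<bar>c n\<bar> * (1 * 1)"
      unfolding f_def real_norm_def abs_mult using fejer_integrand_le[OF T t]
      by (intro mult_mono) auto
    thus "norm (f n t) \<le> mangoldt n * real n powr (- (1 + d)) + real n powr (- (1 + d))"
      using cb[of n] by simp
  qed
  obtain I J where IJ: "\<And>n. ((\<lambda>t. \<Sum>i<n. f i t) has_integral I n) {0..T}" "((\<lambda>t. \<Sum>i. f i t) has_integral J) {0..T}" "(I \<longlongrightarrow> J) sequentially"
    by (rule uniform_limit_integral[OF ul]) (auto simp: f_def intro!: continuous_on_sum continuous_on_mult continuous_on_const continuous_fejer_integrand)
  have "I = (\<lambda>n. \<Sum>i<n. c i * fejer T (y - ln (real i)))"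
  proof
    fix n
    have "integral {0..T} (\<lambda>t. \<Sum>i<n. f i t) = (\<Sum>i<n. integral {0..T} (f i))"
      by (intro integral_sum) (auto simp: f_def[abs_def] intro!: integrable_continuous_real continuous_on_mult continuous_on_const continuous_fejer_integrand)
    also have "\<dots> = (\<Sum>i<n. c i * fejer T (y - ln (real i)))"
      by (simp add: f_def[abs_def] fejer_def)
    finally show "I n = (\<Sum>i<n. c i * fejer T (y - ln (real i)))" using integral_unique[OF IJ(1)] by simp
  qed
  moreover have "J = wi_integral T d y"
    unfolding wi_integral_def using integral_unique[OF IJ(2)] ptw by (simp add: sums_iff)
  ultimately show ?thesis using IJ(3) unfolding sums_def c_def[symmetric] by (simp only:)
qed

text \<open>For d > 0 the sum with \<open>mangoldt\<close> is \<open>wi_integral T d y\<close> plus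
  the sum without it, and the latter is at most B because n^(-1-d) <= 1/n. The terms outside A are
  nonnegative and are dropped, so d -> 0 is taken on a finite sum.\<close>

lemma mangoldt_fejer_sum_le:
  assumes T: "T > 0" and A: "finite A" "0 \<notin> A"
    and B: "\<And>M. (\<Sum>n=1..M. fejer T (y - ln (real n)) / real n) \<le> B"
  shows "(\<Sum>n\<in>A. mangoldt n / real n * fejer T (y - ln (real n))) \<le> wi_integral T 0 y + B"
proof -
  have step: "(\<Sum>n\<in>A. mangoldt n * real n powr (- (1 + d)) * fejer T (y - ln (real n))) \<le> wi_integral T d y + B"
    if d: "d > 0" for d
  proof -
    define g where "g n = real n powr (- (1 + d)) * fejer T (y - ln (real n))" for n
    have g0: "0 \<le> g n" for n using T by (simp add: g_def fejer_nonneg)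
    have sg: "summable g"
    proof (rule summable_comparison_test')
      show "summable (\<lambda>n. real n powr (- (1 + d)) * T)"
        using d by (intro summable_mult2 summable_nat_powr) auto
      show "norm (g n) \<le> real n powr (- (1 + d)) * T" for n
        using fejer_nonneg[OF T] fejer_le[OF T] by (auto simp: g_def abs_mult intro!: mult_left_mono)
    qed
    have gB: "(\<Sum>n. g n) \<le> B"
    proof (rule suminf_le_const[OF sg])
      fix M
      have "(\<Sum>n<M. g n) \<le> (\<Sum>n\<in>insert 0 {1..M}. g n)"
        using g0 by (intro sum_mono2) auto
      also have "\<dots> = (\<Sum>n=1..M. g n)" by (simp add: g_def)
      also have "\<dots> \<le> (\<Sum>n=1..M. fejer T (y - ln (real n)) / real n)"
      proof (rule sum_mono)
        fix n assume n: "n \<in> {1..M}"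
        have "real n powr (- (1 + d)) \<le> real n powr (- 1)" using n d by (intro powr_mono) auto
        also have "\<dots> = 1 / real n" using n by (simp add: powr_minus divide_inverse)
        finally show "g n \<le> fejer T (y - ln (real n)) / real n"
          unfolding g_def using mult_right_mono[OF _ fejer_nonneg[OF T]] by fastforce
      qed
      also have "\<dots> \<le> B" by (rule B)
      finally show "(\<Sum>n<M. g n) \<le> B" .
    qed
    have s: "(\<lambda>n. mangoldt n * g n) sums (wi_integral T d y + (\<Sum>n. g n))"
    proof -
      have "(\<lambda>n. (mangoldt n - 1) * real n powr (- (1 + d)) * fejer T (y - ln (real n)) + g n) sums (wi_integral T d y + (\<Sum>n. g n))"
        by (intro sums_add wi_sums T d summable_sums sg)
      thus ?thesis by (simp add: g_def algebra_simps)
    qed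
    have "(\<Sum>n\<in>A. mangoldt n * g n) \<le> (\<Sum>n. mangoldt n * g n)"
      using s A(1) g0 mangoldt_nonneg by (intro sum_le_suminf) (auto simp: sums_iff)
    also have "\<dots> \<le> wi_integral T d y + B" using s gB by (simp add: sums_iff)
    finally show ?thesis by (simp add: g_def mult.assoc)
  qed
  have "((\<lambda>d. \<Sum>n\<in>A. mangoldt n * real n powr (- (1 + d)) * fejer T (y - ln (real n))) \<longlongrightarrow>
     (\<Sum>n\<in>A. mangoldt n * real n powr (- (1 + 0)) * fejer T (y - ln (real n)))) (at_right 0)"
    using A(2) by (intro tendsto_intros) (auto intro: Nat.gr0I)
  moreover have "((\<lambda>d. wi_integral T d y + B) \<longlongrightarrow> wi_integral T 0 y + B) (at_right 0)"
    by (intro tendsto_intros wi_integral_tendsto_0 T)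
  moreover have "\<forall>\<^sub>F d in at_right 0. (\<Sum>n\<in>A. mangoldt n * real n powr (- (1 + d)) * fejer T (y - ln (real n))) \<le> wi_integral T d y + B"
    using eventually_at_right_less[of 0] by eventually_elim (rule step)
  ultimately have "(\<Sum>n\<in>A. mangoldt n * real n powr (- (1 + 0)) * fejer T (y - ln (real n))) \<le> wi_integral T 0 y + B"
    by (intro tendsto_le[of "at_right 0"]) auto
  also have "(\<Sum>n\<in>A. mangoldt n * real n powr (- (1 + 0)) * fejer T (y - ln (real n))) = (\<Sum>n\<in>A. mangoldt n / real n * fejer T (y - ln (real n)))"
    by (intro sum.cong refl) (simp add: powr_minus divide_inverse)
  finally show ?thesis .
qed

text \<open>The left-hand side is a Riemann sum for \<open>\<integral> K(y - v) dv\<close> with \<open>v = ln n\<close>.\<close>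
lemma fejer_riemann_sum_le:
  assumes T: "T > 0" and e: "e > 0" and c: "\<And>p q. integral {p..q} (fejer T) \<le> c"
  shows "\<forall>\<^sub>F y in at_top. \<forall>M. (\<Sum>n=1..M. fejer T (y - ln (real n)) / real n) \<le> c + e"
proof -
  \<comment> \<open>From n0 on the discretisation errors telescope to at most 2 (T + T^2) / n0. The
    finitely many terms with n < n0 fade as y grows, because the kernel decays like 1/u^2.\<close>
  obtain n0 :: nat where n0: "n0 \<ge> 1" "(T + T\<^sup>2) * 2 / real n0 < e / 2"
  proof -
    obtain k :: nat where "(T + T\<^sup>2) * 2 / (e / 2) < real k" using reals_Archimedean2 by blast
    hence "(T + T\<^sup>2) * 2 < e / 2 * real (Suc k)" using e by (simp add: field_simps)
    thus ?thesis using that[of "Suc k"] by (simp add: field_simps)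
  qed
  define L where "L = ln (real n0)"
  have "((\<lambda>y. real n0 * (2 / (T * (y - L)\<^sup>2))) \<longlongrightarrow> 0) at_top"
    using T by real_asymp
  hence "\<forall>\<^sub>F y in at_top. real n0 * (2 / (T * (y - L)\<^sup>2)) < e / 2"
    by (rule order_tendstoD) (use e in simp)
  thus ?thesis using eventually_gt_at_top[of L]
  proof eventually_elim
    case (elim y)
    define K where "K n = fejer T (y - ln (real n))" for n
    have small: "(\<Sum>n=1..<n0. K n / real n) \<le> e / 2"
    proof -
      have "(\<Sum>n=1..<n0. K n / real n) \<le> (\<Sum>n=1..<n0. 2 / (T * (y - L)\<^sup>2))"
      proof (rule sum_mono)
        fix n assume n: "n \<in> {1..<n0}"
        have l: "ln (real n) \<le> L" unfolding L_def using n by simp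
        have "K n / real n \<le> K n / 1" using n T by (intro divide_left_mono) (auto simp: K_def fejer_nonneg)
        also have "K n / 1 \<le> 2 / (T * (y - ln (real n))\<^sup>2)"
          using fejer_le_inverse_square[OF T, of "y - ln (real n)"] l elim by (simp add: K_def)
        also have "\<dots> \<le> 2 / (T * (y - L)\<^sup>2)"
          using l elim T by (intro divide_left_mono mult_left_mono power_mono mult_pos_pos) auto
        finally show "K n / real n \<le> 2 / (T * (y - L)\<^sup>2)" .
      qed
      also have "\<dots> \<le> real n0 * (2 / (T * (y - L)\<^sup>2))"
        using T by (simp add: of_nat_diff divide_right_mono)
      finally show ?thesis using elim by simp
    qed
    \<comment> \<open>The interval has length w between 1/(n+1) and 1/n. The T-part of the error
      replaces the weight 1/n by w, the T^2-part is the Lipschitz variation of the kernel; both are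
      given the telescoping form 1/n - 1/(n+1).\<close>
    have term_le: "K n / real n \<le> integral {y - ln (real (Suc n))..y - ln (real n)} (fejer T) + (T + T\<^sup>2) * (1 / real n - 1 / real (Suc n)) * 2"
      if n: "n \<ge> 1" for n
    proof -
      define w where "w = ln (real (Suc n)) - ln (real n)"
      have w1: "w \<le> 1 / real n"
      proof -
        have "real (Suc n) = real n * (1 + 1 / real n)" using n by (simp add: field_simps)
        hence "w = ln (1 + 1 / real n)" using n unfolding w_def by (subst \<open>real (Suc n) = _\<close>, subst ln_mult) (auto simp: add_pos_nonneg)
        also have "\<dots> \<le> 1 / real n" by (intro ln_add_one_self_le_self) simp
        finally show ?thesis .
      qed
      have w2: "1 / real (Suc n) \<le> w"
      proof -
        have "ln (real n / real (Suc n)) \<le> real n / real (Suc n) - 1" using n by (intro ln_le_minus_one) auto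
        also have "\<dots> = - (1 / real (Suc n))" by (simp add: field_simps)
        finally show ?thesis using n by (simp add: w_def ln_div)
      qed
      have Kn: "0 \<le> K n" "K n \<le> T" using T by (auto simp: K_def fejer_nonneg fejer_le)
      have "(K n - T\<^sup>2 * (1 / real n)) * w = integral {y - ln (real (Suc n))..y - ln (real n)} (\<lambda>_. K n - T\<^sup>2 * (1 / real n))"
        using n by (simp add: w_def)
      also have "\<dots> \<le> integral {y - ln (real (Suc n))..y - ln (real n)} (fejer T)"
      proof (intro integral_le fejer_integrable T)
        fix v assume v: "v \<in> {y - ln (real (Suc n))..y - ln (real n)}"
        have "\<bar>fejer T (y - ln (real n)) - fejer T v\<bar> \<le> T\<^sup>2 * \<bar>(y - ln (real n)) - v\<bar>"
          by (rule fejer_lipschitz[OF T])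
        also have "\<dots> \<le> T\<^sup>2 * (1 / real n)" using v w1 by (intro mult_left_mono) (auto simp: w_def)
        finally show "K n - T\<^sup>2 * (1 / real n) \<le> fejer T v" by (simp add: K_def)
      qed auto
      finally have I: "K n * w \<le> integral {y - ln (real (Suc n))..y - ln (real n)} (fejer T) + T\<^sup>2 * (1 / real n) * w"
        by (simp add: left_diff_distrib)
      have inv: "1 / real n * (1 / real n) \<le> (1 / real n - 1 / real (Suc n)) * 2"
      proof -
        have "1 / real n * (1 / real n) = 2 / (real n * (2 * real n))" by simp
        also have "\<dots> \<le> 2 / (real n * real (Suc n))" using n by (intro divide_left_mono mult_left_mono) auto
        also have "\<dots> = (1 / real n - 1 / real (Suc n)) * 2" using n by (simp add: divide_simps)
        finally show ?thesis .
      qed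
      have "T\<^sup>2 * (1 / real n) * w \<le> T\<^sup>2 * (1 / real n) * (1 / real n)" using w1 by (intro mult_left_mono) auto
      also have "\<dots> \<le> T\<^sup>2 * ((1 / real n - 1 / real (Suc n)) * 2)"
        using inv by (simp only: mult.assoc) (intro mult_left_mono, auto)
      finally have a: "T\<^sup>2 * (1 / real n) * w \<le> T\<^sup>2 * ((1 / real n - 1 / real (Suc n)) * 2)" .
      have pos: "0 \<le> 1 / real n - 1 / real (Suc n)" using n by (simp add: field_simps)
      have "K n * (1 / real n - w) \<le> T * (1 / real n - 1 / real (Suc n))"
        using Kn w1 w2 by (intro mult_mono) auto
      also have "\<dots> \<le> T * ((1 / real n - 1 / real (Suc n)) * 2)"
        using pos T by (intro mult_left_mono) auto
      finally have b: "K n / real n - K n * w \<le> T * ((1 / real n - 1 / real (Suc n)) * 2)"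
        by (simp add: right_diff_distrib)
      have "K n / real n \<le> integral {y - ln (real (Suc n))..y - ln (real n)} (fejer T)
          + (T * ((1 / real n - 1 / real (Suc n)) * 2) + T\<^sup>2 * ((1 / real n - 1 / real (Suc n)) * 2))"
        using I a b by linarith
      also have "T * ((1 / real n - 1 / real (Suc n)) * 2) + T\<^sup>2 * ((1 / real n - 1 / real (Suc n)) * 2) = (T + T\<^sup>2) * (1 / real n - 1 / real (Suc n)) * 2"
        by (simp only: distrib_right mult.assoc)
      finally show ?thesis .
    qed
    have tel: "(\<Sum>n=n0..<N. K n / real n) \<le> integral {y - ln (real N)..y - ln (real n0)} (fejer T) + (T + T\<^sup>2) * (1 / real n0 - 1 / real N) * 2"
      if "N \<ge> n0" for N
      using that
    proof (induction N rule: nat_induct_at_least)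
      case (Suc N)
      have N1: "N \<ge> 1" using Suc n0 by simp
      have "(\<Sum>n=n0..<Suc N. K n / real n) = (\<Sum>n=n0..<N. K n / real n) + K N / real N" using Suc by simp
      also have "\<dots> \<le> (integral {y - ln (real N)..y - ln (real n0)} (fejer T) + (T + T\<^sup>2) * (1 / real n0 - 1 / real N) * 2)
        + (integral {y - ln (real (Suc N))..y - ln (real N)} (fejer T) + (T + T\<^sup>2) * (1 / real N - 1 / real (Suc N)) * 2)"
        by (intro add_mono Suc.IH term_le N1)
      also have "\<dots> = (integral {y - ln (real (Suc N))..y - ln (real N)} (fejer T) + integral {y - ln (real N)..y - ln (real n0)} (fejer T))
        + (T + T\<^sup>2) * (1 / real n0 - 1 / real (Suc N)) * 2" by (simp only: distrib_right right_diff_distrib) argo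
      also have "integral {y - ln (real (Suc N))..y - ln (real N)} (fejer T) + integral {y - ln (real N)..y - ln (real n0)} (fejer T)
         = integral {y - ln (real (Suc N))..y - ln (real n0)} (fejer T)"
        using N1 Suc.hyps n0 by (intro Henstock_Kurzweil_Integration.integral_combine fejer_integrable T) auto
      finally show ?case .
    qed simp
    show ?case
    proof
      fix M
      define N where "N = max n0 (Suc M)"
      have N: "N \<ge> n0" "N \<ge> 1" using n0 by (auto simp: N_def)
      have "(\<Sum>n=1..M. K n / real n) \<le> (\<Sum>n=1..<N. K n / real n)"
        using T by (intro sum_mono2) (auto simp: N_def K_def fejer_nonneg)
      also have "\<dots> = (\<Sum>n=1..<n0. K n / real n) + (\<Sum>n=n0..<N. K n / real n)"
        using N n0 by (intro sum.atLeastLessThan_concat[symmetric]) auto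
      also have "\<dots> \<le> e / 2 + (c + (T + T\<^sup>2) * (1 / real n0 - 1 / real N) * 2)"
        using tel[OF N(1)] c[of "y - ln (real N)" "y - ln (real n0)"] small by linarith
      also have "(T + T\<^sup>2) * (1 / real n0 - 1 / real N) * 2 \<le> (T + T\<^sup>2) * (1 / real n0) * 2"
        using T by (intro mult_right_mono mult_left_mono) auto
      also have "(T + T\<^sup>2) * (1 / real n0) * 2 \<le> e / 2" using n0 by simp
      finally show "(\<Sum>n=1..M. fejer T (y - ln (real n)) / real n) \<le> c + e" by (simp add: K_def)
    qed
  qed
qed

text \<open>The smoothed inequality is integrated over z from y - r to y + \<eta> + r. Each n with
  ln n in [y, y + \<eta>] then receives the whole central mass \<kappa>, while the upper bound
  integrates to (\<kappa> + s/2)(\<eta> + 2r).\<close>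

lemma mangoldt_log_interval:
  assumes \<eta>: "\<eta> > 0" and e: "e > 0"
  shows "\<forall>\<^sub>F y in at_top. \<forall>A. finite A \<longrightarrow> 0 \<notin> A \<longrightarrow> (\<forall>n\<in>A. y \<le> ln (real n) \<and> ln (real n) \<le> y + \<eta>) \<longrightarrow>
    (\<Sum>n\<in>A. mangoldt n / real n) \<le> (1 + e) * \<eta>"
proof -
  \<comment> \<open>Below, r = \<eta> s / 2 makes the enlarged length \<eta>(1 + s), and T makes the
    tails 4/(T r) = s/4. As \<kappa> >= 1/2, the additive error s/2 is at most s \<kappa>. Finally
    (1 + s)^2 <= 1 + 3s <= 1 + e.\<close>
  define s where "s = min 1 (e / 3)"
  have s: "0 < s" "s \<le> 1" "3 * s \<le> e" using e by (auto simp: s_def)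
  define r where "r = \<eta> * s / 2"
  have r: "r > 0" using \<eta> s by (simp add: r_def)
  define T where "T = 16 / (r * s)"
  have T: "T > 0" "T * r \<ge> 1" "4 / (T * r) = s / 4" using r s by (auto simp: T_def field_simps)
  define \<kappa> where "\<kappa> = fejer_mass T r"
  have \<kappa>: "\<kappa> \<ge> 1 / 2" unfolding \<kappa>_def by (rule fejer_mass_ge[OF T(1,2)])
  have c: "integral {p..q} (fejer T) \<le> \<kappa> + s / 4" for p q
    using fejer_integral_le[OF T(1) r, of p q] unfolding \<kappa>_def T(3) .
  have "\<forall>\<^sub>F z in at_top. \<forall>M. (\<Sum>n=1..M. fejer T (z - ln (real n)) / real n) \<le> \<kappa> + s / 4 + s / 8"
    using s by (intro fejer_riemann_sum_le T c) auto
  moreover have "\<forall>\<^sub>F z in at_top. wi_integral T 0 z < s / 8"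
    using s by (intro order_tendstoD[OF wi_integral_tendsto_at_top[OF T(1)]]) auto
  ultimately have "\<forall>\<^sub>F z in at_top. (\<forall>M. (\<Sum>n=1..M. fejer T (z - ln (real n)) / real n) \<le> \<kappa> + s / 4 + s / 8) \<and> wi_integral T 0 z < s / 8"
    by eventually_elim auto
  then obtain z0 where z0: "\<And>z. z \<ge> z0 \<Longrightarrow> (\<forall>M. (\<Sum>n=1..M. fejer T (z - ln (real n)) / real n) \<le> \<kappa> + s / 4 + s / 8) \<and> wi_integral T 0 z < s / 8"
    unfolding eventually_at_top_linorder by blast
  \<comment> \<open>The errors from the tails, the Riemann sum and the Fourier integral add up to
    s/4 + s/8 + s/8.\<close>
  have W: "(\<Sum>n\<in>A. mangoldt n / real n * fejer T (z - ln (real n))) \<le> \<kappa> + s / 2"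
    if "z \<ge> z0" "finite A" "0 \<notin> A" for z A
    using mangoldt_fejer_sum_le[OF T(1) that(2,3), of z "\<kappa> + s / 4 + s / 8"] z0[OF that(1)] by force
  show ?thesis
    using eventually_ge_at_top[of "z0 + r"]
  proof eventually_elim
    case (elim y)
    show ?case
    proof (intro allI impI)
      fix A assume A: "finite A" "0 \<notin> A" "\<forall>n\<in>A. y \<le> ln (real n) \<and> ln (real n) \<le> y + \<eta>"
      define I where "I = {y - r..y + \<eta> + r}"
      have cont: "continuous_on I (\<lambda>z. fejer T (z - ln (real n)))" for n
        by (rule continuous_on_compose2[OF continuous_fejer[OF T(1), of UNIV]]) (auto intro!: continuous_intros)
      have "\<kappa> * (\<Sum>n\<in>A. mangoldt n / real n) = (\<Sum>n\<in>A. mangoldt n / real n * \<kappa>)"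
        by (simp add: sum_distrib_left mult.commute)
      also have "\<dots> \<le> (\<Sum>n\<in>A. mangoldt n / real n * integral I (\<lambda>z. fejer T (z - ln (real n))))"
      proof (intro sum_mono mult_left_mono)
        fix n assume n: "n \<in> A"
        have "integral I (\<lambda>z. fejer T (z - ln (real n))) = integral {y - r - ln (real n)..y + \<eta> + r - ln (real n)} (fejer T)"
          unfolding I_def
          using integral_shift_real_ivl[of "y - r" "ln (real n)" "y + \<eta> + r" "\<lambda>z. fejer T (z - ln (real n))"] by simp
        also have "\<dots> \<ge> \<kappa>"
          unfolding \<kappa>_def fejer_mass_def using A(3) n r
          by (intro integral_subset_le fejer_integrable T ballI fejer_nonneg) auto
        finally show "\<kappa> \<le> integral I (\<lambda>z. fejer T (z - ln (real n)))" .
      qed (simp add: mangoldt_nonneg)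
      also have "\<dots> = integral I (\<lambda>z. \<Sum>n\<in>A. mangoldt n / real n * fejer T (z - ln (real n)))"
        using A(1) cont unfolding I_def
        by (subst integral_sum) (auto intro!: integrable_continuous_real continuous_on_mult continuous_on_const simp del: times_divide_eq_left)
      also have "\<dots> \<le> integral I (\<lambda>_. \<kappa> + s / 2)"
        unfolding I_def using elim A cont[unfolded I_def]
        by (intro integral_le integrable_continuous_real continuous_on_sum continuous_on_mult continuous_on_const W) auto
      also have "\<dots> = (\<kappa> + s / 2) * (\<eta> + 2 * r)"
        unfolding I_def using \<eta> r by simp
      also have "\<dots> \<le> (\<kappa> * (1 + s)) * (\<eta> + 2 * r)"
      proof (rule mult_right_mono)
        have "s * (1 / 2) \<le> s * \<kappa>" using \<kappa> s by (intro mult_left_mono) auto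
        thus "\<kappa> + s / 2 \<le> \<kappa> * (1 + s)" by (simp add: algebra_simps)
      qed (use \<eta> r in auto)
      also have "\<dots> = \<kappa> * ((1 + s) * (\<eta> * (1 + s)))" by (simp add: r_def algebra_simps)
      finally have "(\<Sum>n\<in>A. mangoldt n / real n) \<le> (1 + s) * (\<eta> * (1 + s))" using \<kappa> by simp
      also have "\<dots> = \<eta> * (1 + 2 * s + s * s)" by (simp add: algebra_simps)
      also have "\<dots> \<le> \<eta> * (1 + e)"
      proof (rule mult_left_mono)
        have "s * s \<le> s * 1" using s by (intro mult_left_mono) auto
        thus "1 + 2 * s + s * s \<le> 1 + e" using s by linarith
      qed (use \<eta> in simp)
      finally show "(\<Sum>n\<in>A. mangoldt n / real n) \<le> (1 + e) * \<eta>" by (simp add: mult.commute)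
    qed
  qed
qed

text \<open>Strong induction from n to about n exp(-\<eta>): the block in between is a logarithmic
  interval of length \<eta> and contributes at most n (1 + e/2) \<eta>. The constant C absorbs the n
  below the threshold.\<close>

lemma sum_mangoldt_upper:
  assumes e: "e > 0"
  obtains C :: real where "C \<ge> 0" "\<And>n. (\<Sum>k=1..n. mangoldt k) \<le> (1 + e) * real n + C"
proof -
  \<comment> \<open>\<eta> solves (1 + e/2)(1 + \<eta>) = 1 + e. With exp(-\<eta>) <= 1/(1 +
    \<eta>), the share e/2 of the block and the share 1 + e/2 of the induction hypothesis add up to
    1 + e.\<close>
  define \<eta> where "\<eta> = (e / 2) / (1 + e / 2)"
  have \<eta>: "\<eta> > 0" "(1 + e / 2) * (1 + \<eta>) = 1 + e" using e by (auto simp: \<eta>_def field_simps)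
  have key: "(1 + e / 2) * \<eta> + (1 + e) * exp (- \<eta>) \<le> 1 + e"
  proof -
    have "exp (- \<eta>) \<le> 1 / (1 + \<eta>)" using exp_ge_add_one_self[of \<eta>] \<eta> by (simp add: exp_minus field_simps)
    hence "(1 + e) * exp (- \<eta>) \<le> (1 + e) * (1 / (1 + \<eta>))" using e by (intro mult_left_mono) auto
    also have "\<dots> = 1 + e / 2" using \<eta>(1) by (simp add: \<eta>(2)[symmetric])
    finally have "(1 + e) * exp (- \<eta>) \<le> 1 + e / 2" .
    moreover have "(1 + e / 2) * \<eta> = e / 2" using \<eta>(2) by (simp add: distrib_left)
    ultimately show ?thesis by linarith
  qed
  obtain y0 where y0: "\<And>y A. y \<ge> y0 \<Longrightarrow> finite A \<Longrightarrow> 0 \<notin> A \<Longrightarrow> (\<forall>n\<in>A. y \<le> ln (real n) \<and> ln (real n) \<le> y + \<eta>) \<Longrightarrow>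
    (\<Sum>n\<in>A. mangoldt n / real n) \<le> (1 + e / 2) * \<eta>"
    using mangoldt_log_interval[OF \<eta>(1), of "e / 2"] e unfolding eventually_at_top_linorder by auto
  define n1 where "n1 = nat \<lceil>exp (y0 + \<eta>)\<rceil>"
  define C where "C = (\<Sum>k=1..n1. mangoldt k :: real)"
  have C0: "C \<ge> 0" unfolding C_def by (intro sum_nonneg mangoldt_nonneg)
  have "(\<Sum>k=1..n. mangoldt k) \<le> (1 + e) * real n + C" for n
  proof (induction n rule: less_induct)
    case (less n)
    show ?case
    proof (cases "n \<le> n1")
      case True
      have "(\<Sum>k=1..n. mangoldt k) \<le> C" unfolding C_def using True by (intro sum_mono2 mangoldt_nonneg) auto
      thus ?thesis using e by (simp add: add_increasing)
    next
      case False
      hence n: "n > 0" by simp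
      have "exp (y0 + \<eta>) \<le> real n1" unfolding n1_def by (rule real_nat_ceiling_ge)
      hence "exp (y0 + \<eta>) \<le> real n" using False by linarith
      hence "ln (exp (y0 + \<eta>)) \<le> ln (real n)" using n by (subst ln_le_cancel_iff) auto
      hence yn: "ln (real n) - \<eta> \<ge> y0" by simp
      \<comment> \<open>Rounding down ensures that every k >= m + 1 exceeds n exp(-\<eta>) and so
        lies in the logarithmic interval.\<close>
      define m where "m = nat \<lfloor>real n * exp (- \<eta>)\<rfloor>"
      have m1: "real m \<le> real n * exp (- \<eta>)" unfolding m_def by (rule of_nat_floor) simp
      have m2: "real n * exp (- \<eta>) < real m + 1" unfolding m_def by linarith
      have "real n * exp (- \<eta>) < real n * 1" using n \<eta> by (intro mult_strict_left_mono) auto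
      hence mn: "m < n" using m1 by linarith
      have "(\<Sum>k=1..n. mangoldt k) = (\<Sum>k=1..m. mangoldt k) + (\<Sum>k=m+1..n. mangoldt k :: real)"
        using sum.ub_add_nat[of 1 m "mangoldt :: nat \<Rightarrow> real" "n - m"] mn by simp
      also have "(\<Sum>k=m+1..n. mangoldt k :: real) \<le> (\<Sum>k=m+1..n. real n * (mangoldt k / real k))"
      proof (rule sum_mono)
        fix k assume k: "k \<in> {m+1..n}"
        have "mangoldt k * 1 \<le> mangoldt k * (real n / real k)" using k by (intro mult_left_mono mangoldt_nonneg) auto
        thus "mangoldt k \<le> real n * (mangoldt k / real k)" by (simp add: mult.commute)
      qed
      also have "\<dots> = real n * (\<Sum>k=m+1..n. mangoldt k / real k)" by (simp add: sum_distrib_left)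
      also have "\<dots> \<le> real n * ((1 + e / 2) * \<eta>)"
      proof (intro mult_left_mono y0[OF yn] ballI)
        fix k assume k: "k \<in> {m+1..n}"
        have "real n * exp (- \<eta>) \<le> real k" using k m2 by auto
        hence "ln (real n * exp (- \<eta>)) \<le> ln (real k)" using n k by (subst ln_le_cancel_iff) auto
        thus "ln (real n) - \<eta> \<le> ln (real k) \<and> ln (real k) \<le> ln (real n) - \<eta> + \<eta>"
          using n k by (simp add: ln_mult)
      qed auto
      also have "(\<Sum>k=1..m. mangoldt k) \<le> (1 + e) * real m + C" by (rule less[OF mn])
      also have "(1 + e) * real m \<le> (1 + e) * (real n * exp (- \<eta>))" using m1 e by (intro mult_left_mono) auto
      finally have "(\<Sum>k=1..n. mangoldt k) \<le> real n * ((1 + e / 2) * \<eta> + (1 + e) * exp (- \<eta>)) + C"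
        by (simp add: algebra_simps)
      also have "\<dots> \<le> real n * (1 + e) + C" using key by (intro add_right_mono mult_left_mono) auto
      finally show ?thesis by (simp add: mult.commute)
    qed
  qed
  with C0 show ?thesis using that by blast
qed

lemma theta_upper:
  assumes e: "e > 0"
  obtains C :: real where "C \<ge> 0" "\<And>n. (\<Sum>k=2..n. if prime k then ln (real k) else 0) \<le> (1 + e) * real n + C"
proof -
  obtain C :: real where C: "C \<ge> 0" "\<And>n. (\<Sum>k=1..n. mangoldt k) \<le> (1 + e) * real n + C"
    using sum_mangoldt_upper[OF e] by blast
  have "(\<Sum>k=2..n. if prime k then ln (real k) else 0) \<le> (1 + e) * real n + C" for n
  proof -
    have "(\<Sum>k=2..n. if prime k then ln (real k) else 0) \<le> (\<Sum>k=2..n. mangoldt k)"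
      by (intro sum_mono) (auto simp: mangoldt_nonneg)
    also have "\<dots> \<le> (\<Sum>k=1..n. mangoldt k)" by (intro sum_mono2 mangoldt_nonneg) auto
    finally show ?thesis using C(2)[of n] by simp
  qed
  thus ?thesis using that C(1) by blast
qed

section \<open>Maximal order of the divisor sum\<close>

text \<open>Splitting off one prime: a divisor of p^k m is p^j e with j <= k and e dividing m, so p
  contributes a finite geometric series. Allowing any P that contains the prime factors lets the
  induction pass primes with k = 0.\<close>

lemma inv_sqrt_divisor_sum_le_prod:
  assumes "finite P" "\<And>p. p \<in> P \<Longrightarrow> prime p" "n > 0" "prime_factors n \<subseteq> P"
  shows "inv_sqrt_divisor_sum n \<le> (\<Prod>p\<in>P. 1 / (1 - 1 / sqrt (real p)))"
  using assms
proof (induction P arbitrary: n rule: finite_induct)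
  case empty
  hence "n = 1" by (auto simp: prime_factorization_empty_iff)
  thus ?case by (simp add: inv_sqrt_divisor_sum_def)
next
  case (insert p P)
  have p: "prime p" using insert by auto
  define k where "k = multiplicity p n"
  obtain m where m: "n = p ^ k * m" "\<not> p dvd m"
    using multiplicity_decompose'[of n p] insert.prems p unfolding k_def by (metis neq0_conv not_prime_unit)
  have m0: "m > 0" using m insert.prems by (auto intro: Nat.gr0I)
  have "prime_factors m \<subseteq> P"
  proof
    fix r assume r: "r \<in> prime_factors m"
    hence "r \<in> prime_factors n" using m insert.prems(2) by (auto simp: in_prime_factors_iff)
    moreover have "r \<noteq> p" using r m(2) by (auto simp: in_prime_factors_iff)
    ultimately show "r \<in> P" using insert.prems(3) by auto
  qed
  hence IH: "inv_sqrt_divisor_sum m \<le> (\<Prod>p\<in>P. 1 / (1 - 1 / sqrt (real p)))"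
    using insert m0 by auto
  define q where "q = 1 / sqrt (real p)"
  have q: "0 \<le> q" "q < 1" using prime_gt_1_nat[OF p] by (auto simp: q_def)
  have fin: "finite ({..k} \<times> {e. e dvd m})" using m0 by simp
  have "{d. d dvd n} \<subseteq> (\<lambda>(j, e). p ^ j * e) ` ({..k} \<times> {e. e dvd m})"
  proof
    fix d assume "d \<in> {d. d dvd n}"
    hence "d dvd p ^ k * m" using m by simp
    then obtain b c where bc: "d = b * c" "b dvd p ^ k" "c dvd m" using division_decomp by blast
    then obtain j where "j \<le> k" "b = p ^ j" using divides_primepow_nat[OF p] by auto
    thus "d \<in> (\<lambda>(j, e). p ^ j * e) ` ({..k} \<times> {e. e dvd m})" using bc by force
  qed
  hence "inv_sqrt_divisor_sum n \<le> (\<Sum>d\<in>(\<lambda>(j, e). p ^ j * e) ` ({..k} \<times> {e. e dvd m}). 1 / sqrt (real d))"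
    unfolding inv_sqrt_divisor_sum_def using fin by (intro sum_mono2) auto
  also have "\<dots> \<le> (\<Sum>x\<in>{..k} \<times> {e. e dvd m}. ((\<lambda>d. 1 / sqrt (real d)) \<circ> (\<lambda>(j, e). p ^ j * e)) x)"
    using fin by (intro sum_image_le) auto
  also have "\<dots> = (\<Sum>x\<in>{..k} \<times> {e. e dvd m}. case x of (j, e) \<Rightarrow> q ^ j * (1 / sqrt (real e)))"
    by (intro sum.cong refl) (auto simp: q_def real_sqrt_mult real_sqrt_power power_divide)
  also have "\<dots> = (\<Sum>j\<le>k. q ^ j) * inv_sqrt_divisor_sum m"
    by (simp add: inv_sqrt_divisor_sum_def sum_product sum.cartesian_product)
  also have "\<dots> \<le> 1 / (1 - q) * (\<Prod>p\<in>P. 1 / (1 - 1 / sqrt (real p)))"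
  proof (intro mult_mono IH)
    have "(\<Sum>j\<le>k. q ^ j) = (1 - q ^ Suc k) / (1 - q)" using q by (simp add: sum_gp0)
    also have "\<dots> \<le> 1 / (1 - q)" using q by (intro divide_right_mono) auto
    finally show "(\<Sum>j\<le>k. q ^ j) \<le> 1 / (1 - q)" .
  qed (use q in \<open>auto simp: inv_sqrt_divisor_sum_def intro!: sum_nonneg\<close>)
  finally show ?case using insert by (simp add: q_def)
qed

text \<open>1/(1 - q) = 1 + q/(1 - q) <= exp(q + q^2/(1 - q)), and 1/(1 - q) <= 4. The range q <=
  3/4 covers 1/sqrt p from p = 2 on.\<close>

lemma inverse_1_minus_le_exp:
  fixes q :: real
  assumes "0 \<le> q" "q \<le> 3 / 4"
  shows "1 / (1 - q) \<le> exp (q + 4 * q\<^sup>2)"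
proof -
  have "1 / (1 - q) = 1 + q / (1 - q)" using assms by (simp add: field_simps)
  also have "\<dots> \<le> exp (q / (1 - q))" by (rule exp_ge_add_one_self)
  also have "q / (1 - q) = q + q\<^sup>2 * (1 / (1 - q))" using assms by (simp add: field_simps power2_eq_square)
  also have "exp \<dots> \<le> exp (q + q\<^sup>2 * 4)"
    using assms by (intro exp_le_cancel_iff[THEN iffD2] add_left_mono mult_left_mono) (auto simp: field_simps)
  finally show ?thesis by (simp add: mult.commute)
qed

lemma ln_inv_sqrt_divisor_sum_le:
  assumes n: "n > 0"
  shows "ln (inv_sqrt_divisor_sum n) \<le> (\<Sum>p\<in>prime_factors n. 1 / sqrt (real p) + 4 / real p)"
proof -
  have "inv_sqrt_divisor_sum n \<le> (\<Prod>p\<in>prime_factors n. 1 / (1 - 1 / sqrt (real p)))"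
    using n by (intro inv_sqrt_divisor_sum_le_prod) auto
  also have "\<dots> \<le> (\<Prod>p\<in>prime_factors n. exp (1 / sqrt (real p) + 4 / real p))"
  proof (intro prod_mono conjI)
    fix p assume p: "p \<in> prime_factors n"
    hence p2: "p \<ge> 2" by (auto dest: in_prime_factors_imp_prime prime_ge_2_nat)
    have "4 / 3 \<le> sqrt (real p)" using p2 by (intro real_le_rsqrt) (auto simp: power2_eq_square)
    moreover have "0 < sqrt (real p)" using p2 by simp
    ultimately have s: "1 / sqrt (real p) \<le> 3 / 4" by (simp add: field_simps)
    thus "0 \<le> 1 / (1 - 1 / sqrt (real p))" by simp
    show "1 / (1 - 1 / sqrt (real p)) \<le> exp (1 / sqrt (real p) + 4 / real p)"
      using inverse_1_minus_le_exp[OF _ s] by (simp add: power_divide)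
  qed
  also have "\<dots> = exp (\<Sum>p\<in>prime_factors n. 1 / sqrt (real p) + 4 / real p)" by (simp add: exp_sum)
  finally show ?thesis
    using inv_sqrt_divisor_sum_ge_1[OF n] by (metis exp_gt_zero less_le_trans ln_exp ln_le_cancel_iff zero_less_one)
qed

section \<open>Extremal sums over the prime factors of n\<close>

lemma sum_ln_prime_factors_le:
  assumes n: "n > 0"
  shows "(\<Sum>p\<in>prime_factors n. ln (real p)) \<le> ln (real n)"
proof -
  \<comment> \<open>On primes \<open>mangoldt\<close> is ln; the other divisors only add nonnegative
    terms to the divisor sum of \<open>mangoldt\<close>, which is ln n.\<close>
  have "(\<Sum>p\<in>prime_factors n. ln (real p)) = (\<Sum>p\<in>prime_factors n. mangoldt p)"
    by (intro sum.cong refl) (auto dest: in_prime_factors_imp_prime)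
  also have "\<dots> \<le> (\<Sum>d | d dvd n. mangoldt d)"
    using n by (intro sum_mono2 mangoldt_nonneg) auto
  also have "\<dots> = ln (real n)" using mangoldt_sum[of n, where ?'a = real] n by simp
  finally show ?thesis .
qed

text \<open>The greedy bound: replacing each factor beyond the cutoff by its share of \<open>\<Sum> ln p\<close>.\<close>
lemma sum_inverse_prime_factors_le:
  fixes f :: "real \<Rightarrow> real" and L :: real
  assumes n: "n > 0" and L: "ln (real n) = L" "L > 1"
    and f: "\<And>x. x \<ge> 2 \<Longrightarrow> 0 < f x" "\<And>x y. 2 \<le> x \<Longrightarrow> x \<le> y \<Longrightarrow> f x \<le> f y" "f L > 0"
    and fL: "\<And>x. x \<ge> L \<Longrightarrow> f L \<le> f x" "\<And>x. 2 \<le> x \<Longrightarrow> x \<le> L \<Longrightarrow> f x \<le> f L"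
  shows "(\<Sum>p\<in>prime_factors n. ln (real p) / f (real p)) \<le>
    L / f L + (\<Sum>k=2..nat \<lfloor>L\<rfloor>. (if prime k then ln (real k) else 0) * (1 / f (real k) - 1 / f L))"
proof -
  \<comment> \<open>The excess of the weight over its value at the cutoff. The cutoff L is natural
    because theta(L) is about L: the primes up to L nearly exhaust the budget ln n = L.\<close>
  define w where "w k = 1 / f (real k) - 1 / f L" for k :: nat
  define Q where "Q = {p \<in> prime_factors n. real p \<le> L}"
  have w: "0 \<le> w k" if "2 \<le> k" "real k \<le> L" for k
  proof -
    have "2 \<le> real k" using that by simp
    thus ?thesis unfolding w_def using f(1)[of "real k"] fL(2)[of "real k"] that by (simp add: frac_le)
  qed
  have p2: "2 \<le> p" if "p \<in> prime_factors n" for p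
    using that by (auto dest: in_prime_factors_imp_prime prime_ge_2_nat)
  have "(\<Sum>p\<in>prime_factors n. ln (real p) / f (real p)) \<le> (\<Sum>p\<in>prime_factors n. ln (real p) / f L + (if real p \<le> L then ln (real p) * w p else 0))"
  proof (rule sum_mono)
    fix p assume p: "p \<in> prime_factors n"
    show "ln (real p) / f (real p) \<le> ln (real p) / f L + (if real p \<le> L then ln (real p) * w p else 0)"
    proof (cases "real p \<le> L")
      case False
      hence "ln (real p) / f (real p) \<le> ln (real p) / f L"
        using p2[OF p] f(3) f(1)[of "real p"] fL(1)[of "real p"] by (intro divide_left_mono mult_pos_pos) auto
      thus ?thesis using False by simp
    qed (simp add: w_def algebra_simps)
  qed
  also have "\<dots> = (\<Sum>p\<in>prime_factors n. ln (real p)) / f L + (\<Sum>p\<in>Q. ln (real p) * w p)"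
    unfolding Q_def by (subst sum.inter_filter) (simp_all add: sum.distrib sum_divide_distrib)
  also have "(\<Sum>p\<in>prime_factors n. ln (real p)) / f L \<le> L / f L"
    using sum_ln_prime_factors_le[OF n] L f(3) by (intro divide_right_mono) auto
  also have "(\<Sum>p\<in>Q. ln (real p) * w p) = (\<Sum>k\<in>Q. (if prime k then ln (real k) else 0) * w k)"
    unfolding Q_def by (intro sum.cong refl) (auto dest: in_prime_factors_imp_prime)
  also have "\<dots> \<le> (\<Sum>k=2..nat \<lfloor>L\<rfloor>. (if prime k then ln (real k) else 0) * w k)"
  proof (rule sum_mono2)
    show "Q \<subseteq> {2..nat \<lfloor>L\<rfloor>}" using p2 unfolding Q_def by (auto simp: le_nat_floor)
    fix k assume "k \<in> {2..nat \<lfloor>L\<rfloor>} - Q"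
    hence k: "2 \<le> k" "k \<le> nat \<lfloor>L\<rfloor>" by auto
    hence "real k \<le> L" using L by linarith
    thus "0 \<le> (if prime k then ln (real k) else 0) * w k" using w[OF k(1)] k by simp
  qed auto
  finally show ?thesis by (simp add: w_def)
qed

text \<open>Summation by parts with decreasing nonnegative weights preserves one-sided information,
  so upper bounds on the partial sums of b suffice. The induction keeps the last partial sum and
  replaces all earlier ones by D.\<close>

lemma abel_upper:
  fixes b w :: "nat \<Rightarrow> real"
  assumes D: "\<And>n. (\<Sum>k=2..n. b k) \<le> D" "D \<ge> 0"
    and w: "\<And>k. 2 \<le> k \<Longrightarrow> Suc k \<le> Y \<Longrightarrow> w (Suc k) \<le> w k" "\<And>k. 2 \<le> k \<Longrightarrow> k \<le> Y \<Longrightarrow> 0 \<le> w k" and Y: "Y \<ge> 2"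
  shows "(\<Sum>k=2..Y. b k * w k) \<le> D * w 2"
proof -
  have "(\<Sum>k=2..n. b k * w k) \<le> (\<Sum>k=2..n. b k) * w n + D * (w 2 - w n)" if "2 \<le> n" "n \<le> Y" for n
    using that
  proof (induction n rule: nat_induct_at_least)
    case base
    show ?case by simp
  next
    case (Suc n)
    have "(\<Sum>k=2..Suc n. b k * w k) = (\<Sum>k=2..n. b k * w k) + b (Suc n) * w (Suc n)" using Suc.hyps by simp
    also have "\<dots> \<le> (\<Sum>k=2..n. b k) * w n + D * (w 2 - w n) + b (Suc n) * w (Suc n)" using Suc by simp
    also have "(\<Sum>k=2..n. b k) * w n = (\<Sum>k=2..n. b k) * w (Suc n) + (\<Sum>k=2..n. b k) * (w n - w (Suc n))"
      by (simp add: right_diff_distrib)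
    also have "(\<Sum>k=2..n. b k) * (w n - w (Suc n)) \<le> D * (w n - w (Suc n))"
      using w(1)[of n] Suc by (intro mult_right_mono D) auto
    finally have "(\<Sum>k=2..Suc n. b k * w k) \<le> ((\<Sum>k=2..n. b k) + b (Suc n)) * w (Suc n) + D * (w 2 - w (Suc n))"
      by (simp add: algebra_simps)
    thus ?case using Suc.hyps by simp
  qed
  from this[of Y] have "(\<Sum>k=2..Y. b k * w k) \<le> (\<Sum>k=2..Y. b k) * w Y + D * (w 2 - w Y)" using Y by simp
  also have "\<dots> \<le> D * w Y + D * (w 2 - w Y)" using D(1) w(2) Y by (intro add_right_mono mult_right_mono) auto
  finally show ?thesis by (simp add: right_diff_distrib)
qed

text \<open>2 sqrt x / ln x has derivative (1 - 2/ln x) / (sqrt x ln x), so its increments dominate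
  the summands up to the factor 1 + e once ln x is large; C collects the terms before that.\<close>

lemma sum_inverse_sqrt_ln_le:
  assumes e: "e > 0"
  obtains C :: real where "C \<ge> 0"
    "\<And>Y. Y \<ge> 2 \<Longrightarrow> (\<Sum>n=2..Y. 1 / (sqrt (real n) * ln (real n))) \<le> (1 + e) * (2 * sqrt (real Y) / ln (real Y)) + C"
proof -
  define g where "g x = 2 * sqrt x / ln x" for x :: real
  \<comment> \<open>Beyond n0 one has ln x >= 2 (1 + e)/e, which is equivalent to (1 + e)(1 - 2/ln
    x) >= 1.\<close>
  define n0 where "n0 = max 2 (nat \<lceil>exp (2 * (1 + e) / e)\<rceil>)"
  have n0: "n0 \<ge> 2" by (simp add: n0_def)
  have big: "1 \<le> (1 + e) * (1 - 2 / ln x)" if "real n0 \<le> x" for x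
  proof -
    have "exp (2 * (1 + e) / e) \<le> real n0" unfolding n0_def by (rule order.trans[OF real_nat_ceiling_ge]) simp
    hence "exp (2 * (1 + e) / e) \<le> x" using that by (rule order.trans)
    moreover have "x > 0" using that n0 by linarith
    ultimately have l1: "2 * (1 + e) / e \<le> ln x" by (simp add: ln_ge_iff)
    have "2 * (1 + e) / e > 0" using e by simp
    hence lx: "ln x > 0" using l1 by linarith
    have "2 * (1 + e) \<le> ln x * e" using l1 e by (simp add: pos_divide_le_eq)
    hence "(1 + e) * (2 / ln x) \<le> e" using lx by (simp add: pos_divide_le_eq mult.commute)
    thus ?thesis by (simp add: right_diff_distrib)
  qed
  define C where "C = (\<Sum>n=2..n0. 1 / (sqrt (real n) * ln (real n)))"
  have C0: "C \<ge> 0" unfolding C_def by (intro sum_nonneg) auto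
  have step: "1 / (sqrt (real (Suc n)) * ln (real (Suc n))) \<le> (1 + e) * (g (real (Suc n)) - g (real n))" if n: "n \<ge> n0" for n
  proof -
    have "\<exists>z. real n < z \<and> z < real (Suc n) \<and> g (real (Suc n)) - g (real n) = (real (Suc n) - real n) * (1 / (sqrt z * ln z) * (1 - 2 / ln z))"
    proof (rule MVT2)
      fix x assume x: "real n \<le> x" "x \<le> real (Suc n)"
      hence x2: "x \<ge> 2" using n n0 by linarith
      hence lx: "ln x > 0" by simp
      have sx: "sqrt x * sqrt x = x" "sqrt x > 0" using x2 by auto
      have "(g has_real_derivative ((2 * (inverse (sqrt x) / 2)) * ln x - 2 * sqrt x * (1 / x)) / (ln x * ln x)) (at x)"
        unfolding g_def using x2 lx
        by (auto intro!: derivative_eq_intros)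
      also have "((2 * (inverse (sqrt x) / 2)) * ln x - 2 * sqrt x * (1 / x)) / (ln x * ln x) = 1 / (sqrt x * ln x) * (1 - 2 / ln x)"
      proof -
        have "sqrt x * (1 / x) = sqrt x / (sqrt x * sqrt x)" unfolding sx(1) by simp
        also have "\<dots> = 1 / sqrt x" using sx(2) by (intro nonzero_divide_mult_cancel_left) linarith
        finally have "sqrt x * (1 / x) = 1 / sqrt x" .
        thus ?thesis using lx sx(2) by (simp add: field_simps)
      qed
      finally show "(g has_real_derivative 1 / (sqrt x * ln x) * (1 - 2 / ln x)) (at x)" .
    qed simp
    then obtain z where z: "real n < z" "z < real (Suc n)" "g (real (Suc n)) - g (real n) = 1 / (sqrt z * ln z) * (1 - 2 / ln z)"
      by auto
    have z2: "z > 2" using z n n0 by linarith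
    have "1 / (sqrt (real (Suc n)) * ln (real (Suc n))) \<le> 1 / (sqrt z * ln z)"
      using z z2 by (intro divide_left_mono mult_mono mult_pos_pos) auto
    also have "\<dots> = 1 / (sqrt z * ln z) * 1" by simp
    also have "\<dots> \<le> 1 / (sqrt z * ln z) * ((1 + e) * (1 - 2 / ln z))"
      using big[of z] z z2 n by (intro mult_left_mono) auto
    also have "\<dots> = (1 + e) * (g (real (Suc n)) - g (real n))" unfolding z(3) by simp
    finally show ?thesis .
  qed
  have g0: "g (real n) \<ge> 0" if "n \<ge> 2" for n using that by (simp add: g_def)
  have large: "(\<Sum>n=2..Y. 1 / (sqrt (real n) * ln (real n))) \<le> (1 + e) * (g (real Y) - g (real n0)) + C" if "Y \<ge> n0" for Y
    using that
  proof (induction Y rule: nat_induct_at_least)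
    case (Suc Y)
    thus ?case using step[of Y] n0 by (simp add: algebra_simps)
  qed (simp add: C_def)
  have "(\<Sum>n=2..Y. 1 / (sqrt (real n) * ln (real n))) \<le> (1 + e) * g (real Y) + C" if "Y \<ge> 2" for Y
  proof (cases "Y \<ge> n0")
    case True
    have "(1 + e) * (g (real Y) - g (real n0)) \<le> (1 + e) * g (real Y)" using g0[OF n0] e by (intro mult_left_mono) auto
    thus ?thesis using large[OF True] by linarith
  next
    case False
    have "(\<Sum>n=2..Y. 1 / (sqrt (real n) * ln (real n))) \<le> C" unfolding C_def using False by (intro sum_mono2) auto
    thus ?thesis using g0[OF that] e by (simp add: add_increasing)
  qed
  thus ?thesis using that[of C] C0 by (simp add: g_def)
qed

text \<open>With f x = sqrt x ln x and R = sqrt L / ln L, the greedy bound is R plus the sum over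
  primes of ln p times the excess weight. Abel summation replaces ln p on primes by 1 + d on all
  integers, and the excess weights sum to about 2R - R; in total 2R. Quantifying over n with ln n =
  L lets the asymptotics run in a real variable.\<close>

lemma sum_inverse_sqrt_prime_factors_le:
  assumes e: "e > 0"
  obtains K :: real where "K \<ge> 0"
    "\<forall>\<^sub>F L in at_top. \<forall>n>0. ln (real n) = L \<longrightarrow>
      (\<Sum>p\<in>prime_factors n. 1 / sqrt (real p)) \<le> (2 + e) * (sqrt L / ln L) + K"
proof -
  \<comment> \<open>The final coefficient is 2 + 5d + 6d^2 + 2d^3, which is at most 2 + 13d for d <=
    1.\<close>
  define d where "d = min 1 (e / 14)"
  have d: "0 < d" "d \<le> 1" "14 * d \<le> e" using e by (auto simp: d_def)
  obtain C :: real where C: "C \<ge> 0" "\<And>n. (\<Sum>k=2..n. if prime k then ln (real k) else 0) \<le> (1 + d) * real n + C"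
    using theta_upper[OF d(1)] by blast
  obtain C2 :: real where C2: "C2 \<ge> 0"
    "\<And>Y. Y \<ge> 2 \<Longrightarrow> (\<Sum>n=2..Y. 1 / (sqrt (real n) * ln (real n))) \<le> (1 + d) * (2 * sqrt (real Y) / ln (real Y)) + C2"
    using sum_inverse_sqrt_ln_le[OF d(1)] by blast
  define f where "f x = sqrt x * ln x" for x :: real
  define K where "K = (C + (1 + d)) * (1 / f 2) + (1 + d) * (C2 + 2)"
  have f2: "f 2 > 0" by (simp add: f_def)
  have K0: "K \<ge> 0" unfolding K_def using C(1) C2(1) d f2 by (intro add_nonneg_nonneg mult_nonneg_nonneg) auto
  \<comment> \<open>Rounding L down to Y only guarantees Y >= L - 1, so ln (L - 1) appears where ln
    L is wanted.\<close>
  have "((\<lambda>L::real. ln L / ln (L - 1)) \<longlongrightarrow> 1) at_top" by real_asymp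
  hence ev: "\<forall>\<^sub>F L::real in at_top. ln L / ln (L - 1) < 1 + d" by (rule order_tendstoD) (use d in auto)
  have "\<forall>\<^sub>F L in at_top. \<forall>n>0. ln (real n) = L \<longrightarrow>
      (\<Sum>p\<in>prime_factors n. 1 / sqrt (real p)) \<le> (2 + e) * (sqrt L / ln L) + K"
    using ev eventually_ge_at_top[of 5]
  proof eventually_elim
    case (elim L)
    define Y where "Y = nat \<lfloor>L\<rfloor>"
    have Y: "Y \<ge> 2" "real Y \<le> L" "L - 1 \<le> real Y" using elim unfolding Y_def by linarith+
    have lnL: "ln L > 0" "ln (L - 1) > 0" using elim by auto
    define R where "R = sqrt L / ln L"
    have R0: "R \<ge> 0" using lnL elim by (simp add: R_def)
    have fpos: "0 < f x" if "x \<ge> 2" for x using that by (simp add: f_def)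
    have fmono: "f x \<le> f y" if "2 \<le> x" "x \<le> y" for x y
      unfolding f_def using that by (intro mult_mono) auto
    have fL: "f L > 0" "L / f L = R"
    proof -
      show "f L > 0" using elim by (intro fpos) auto
      have "L = sqrt L * sqrt L" using elim by simp
      thus "L / f L = R" unfolding f_def R_def using elim by (metis mult_divide_mult_cancel_left_if real_sqrt_eq_zero_cancel_iff not_numeral_le_zero)
    qed
    have inv_fL: "1 / f L \<le> 1"
    proof -
      have "1 * 1 \<le> sqrt L * ln L" using elim ln_ge_iff[of L 1] e_less_272 by (intro mult_mono) auto
      thus ?thesis using fL(1) by (simp add: f_def)
    qed
    define c where "c k = (if prime k then ln (real k) else 0)" for k :: nat
    define w where "w k = 1 / f (real k) - 1 / f L" for k :: nat
    have w0: "0 \<le> w k" if "2 \<le> k" "k \<le> Y" for k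
    proof -
      have "real k \<le> L" "2 \<le> real k" using that Y by auto
      thus ?thesis unfolding w_def using fpos[of "real k"] fmono[of "real k" L] by (simp add: frac_le)
    qed
    \<comment> \<open>Subtracting the density 1 + d leaves partial sums bounded above by a constant.
      A sum starting at 2 has n - 1 terms, hence the extra 1 + d.\<close>
    have abel: "(\<Sum>k=2..Y. (c k - (1 + d)) * w k) \<le> (C + (1 + d)) * w 2"
    proof (rule abel_upper[OF _ _ _ w0 Y(1)])
      fix n
      show "(\<Sum>k=2..n. c k - (1 + d)) \<le> C + (1 + d)"
      proof -
        have "(\<Sum>k=2..n. c k - (1 + d)) = (\<Sum>k=2..n. c k) - real (Suc n - 2) * (1 + d)"
          by (simp add: sum_subtractf)
        also have "\<dots> \<le> ((1 + d) * real n + C) - (real n - 1) * (1 + d)"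
          using C(2)[of n] d unfolding c_def by (intro diff_mono mult_right_mono) auto
        also have "\<dots> = C + (1 + d)" by (simp add: algebra_simps)
        finally show ?thesis .
      qed
    next
      fix k assume k: "2 \<le> k" "Suc k \<le> Y"
      have "2 \<le> real k" using k by simp
      thus "w (Suc k) \<le> w k" unfolding w_def using fpos[of "real k"] fmono[of "real k" "real (Suc k)"] by (simp add: frac_le)
    qed (use C(1) d in auto)
    \<comment> \<open>The part 2R is the sum of 1/(sqrt k ln k); the Y - 1 copies of 1 / f L remove
      R up to the constant 2.\<close>
    have sumw: "(\<Sum>k=2..Y. w k) \<le> (1 + d) * (1 + d) * (2 * R) + C2 - (R - 2)"
    proof -
      have "(\<Sum>k=2..Y. w k) = (\<Sum>k=2..Y. 1 / (sqrt (real k) * ln (real k))) - real (Y - 1) / f L"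
        using Y by (simp add: w_def sum_subtractf f_def)
      also have "\<dots> \<le> ((1 + d) * (2 * sqrt (real Y) / ln (real Y)) + C2) - (R - 2)"
      proof (intro diff_mono C2(2) Y(1))
        have "(L - 2) / f L = R - 2 * (1 / f L)" using fL(2) by (simp add: diff_divide_distrib)
        hence "R - 2 \<le> (L - 2) / f L" using inv_fL by linarith
        also have "\<dots> \<le> real (Y - 1) / f L" using Y fL by (intro divide_right_mono) (auto simp: of_nat_diff)
        finally show "R - 2 \<le> real (Y - 1) / f L" .
      qed
      also have "2 * sqrt (real Y) / ln (real Y) \<le> 2 * sqrt L / ln (L - 1)"
        using Y elim by (intro frac_le) auto
      also have "2 * sqrt L / ln (L - 1) = (ln L / ln (L - 1)) * (2 * R)" using lnL by (simp add: R_def)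
      also have "\<dots> \<le> (1 + d) * (2 * R)" using elim R0 by (intro mult_right_mono) auto
      finally show ?thesis using d by (simp add: mult.assoc)
    qed
    show ?case
    proof (intro allI impI)
      fix n :: nat assume n: "n > 0" "ln (real n) = L"
      have "(\<Sum>p\<in>prime_factors n. 1 / sqrt (real p)) = (\<Sum>p\<in>prime_factors n. ln (real p) / f (real p))"
        by (intro sum.cong refl) (auto simp: f_def dest!: in_prime_factors_imp_prime prime_gt_1_nat)
      also have "\<dots> \<le> L / f L + (\<Sum>k=2..Y. c k * w k)"
        unfolding Y_def c_def w_def
        by (rule sum_inverse_prime_factors_le[OF n]) (use elim fpos fmono fL in auto)
      also have "(\<Sum>k=2..Y. c k * w k) = (\<Sum>k=2..Y. (c k - (1 + d)) * w k) + (1 + d) * (\<Sum>k=2..Y. w k)"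
        by (simp add: sum.distrib[symmetric] sum_distrib_left algebra_simps)
      also have "(\<Sum>k=2..Y. (c k - (1 + d)) * w k) \<le> (C + (1 + d)) * (1 / f 2)"
        using fL C(1) d by (intro order.trans[OF abel] mult_left_mono) (auto simp: w_def)
      also have "(1 + d) * (\<Sum>k=2..Y. w k) \<le> (1 + d) * ((1 + d) * (1 + d) * (2 * R) + C2 - (R - 2))"
        using d by (intro mult_left_mono sumw) auto
      finally have "(\<Sum>p\<in>prime_factors n. 1 / sqrt (real p)) \<le> (1 + 2 * ((1 + d) * (1 + d) * (1 + d)) - (1 + d)) * R + K"
        by (simp add: fL(2) K_def algebra_simps)
      also have "\<dots> \<le> (2 + e) * R + K"
      proof (intro add_right_mono mult_right_mono R0)
        have "d * d \<le> d" "d * (d * d) \<le> d" using d by (auto simp: mult_le_one mult_left_le)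
        moreover have "1 + 2 * ((1 + d) * (1 + d) * (1 + d)) - (1 + d) = 2 + 5 * d + 6 * (d * d) + 2 * (d * (d * d))"
          by (simp add: algebra_simps)
        ultimately show "1 + 2 * ((1 + d) * (1 + d) * (1 + d)) - (1 + d) \<le> 2 + e" using d by linarith
      qed
      finally show "(\<Sum>p\<in>prime_factors n. 1 / sqrt (real p)) \<le> (2 + e) * (sqrt L / ln L) + K"
        by (simp add: R_def)
    qed
  qed
  thus ?thesis using that K0 by blast
qed

text \<open>The greedy bound with f x = x ln x. Replacing the primes up to L by all integers is
  affordable, since O(ln L) is negligible against sqrt L / ln L.\<close>

lemma sum_inverse_prime_factors_le_ln:
  assumes n: "n > 0" "ln (real n) = L" and L: "L \<ge> 3"
  shows "(\<Sum>p\<in>prime_factors n. 1 / real p) \<le> 2 + ln L"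
proof -
  define f where "f x = x * ln x" for x :: real
  have fpos: "0 < f x" if "x \<ge> 2" for x using that by (simp add: f_def)
  have fmono: "f x \<le> f y" if "2 \<le> x" "x \<le> y" for x y
    unfolding f_def using that by (intro mult_mono) auto
  have lnL: "ln L \<ge> 1" using L e_less_272 by (simp add: ln_ge_iff)
  have "(\<Sum>p\<in>prime_factors n. 1 / real p) = (\<Sum>p\<in>prime_factors n. ln (real p) / f (real p))"
    by (intro sum.cong refl) (auto simp: f_def dest!: in_prime_factors_imp_prime prime_gt_1_nat)
  also have "\<dots> \<le> L / f L + (\<Sum>k=2..nat \<lfloor>L\<rfloor>. (if prime k then ln (real k) else 0) * (1 / f (real k) - 1 / f L))"
    by (rule sum_inverse_prime_factors_le[OF n]) (use L fpos fmono in auto)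
  also have "\<dots> \<le> L / f L + (\<Sum>k=2..nat \<lfloor>L\<rfloor>. 1 / real k)"
  proof (intro add_left_mono sum_mono)
    fix k assume k: "k \<in> {2..nat \<lfloor>L\<rfloor>}"
    have "(if prime k then ln (real k) else 0) * (1 / f (real k) - 1 / f L) \<le> (if prime k then ln (real k) else 0) * (1 / f (real k))"
      using fpos[of L] L k by (intro mult_left_mono) auto
    also have "\<dots> \<le> ln (real k) * (1 / f (real k))"
      using fpos[of "real k"] k by (intro mult_right_mono) auto
    also have "\<dots> = 1 / real k" using k by (simp add: f_def)
    finally show "(if prime k then ln (real k) else 0) * (1 / f (real k) - 1 / f L) \<le> 1 / real k" .
  qed
  also have "(\<Sum>k=2..nat \<lfloor>L\<rfloor>. 1 / real k) \<le> (\<Sum>k=1..nat \<lfloor>L\<rfloor>. 1 / real k)" by (intro sum_mono2) auto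
  also have "\<dots> \<le> 1 + ln (real (nat \<lfloor>L\<rfloor>))" using L by (intro sum_inverse_le') (simp add: le_nat_floor)
  also have "ln (real (nat \<lfloor>L\<rfloor>)) \<le> ln L" using L by (subst ln_le_cancel_iff) (auto simp: le_nat_floor)
  also have "L / f L = 1 / ln L" using L by (simp add: f_def)
  also have "1 / ln L \<le> 1" using lnL by simp
  finally show ?thesis by simp
qed

text \<open>For a >= 3, \<epsilon> a is the least nonnegative value for which the divisor sum with
  its constant and logarithms is at most exp((2 + \<epsilon> a) sqrt L / ln L), L = ln a. Besides
  the main part of the prime sum, every contribution to the logarithm is O(ln L), which is o(sqrt L
  / ln L).\<close>

lemma exponent_error_tendsto_0:
  defines "\<epsilon> \<equiv> \<lambda>a::nat. max 0 (ln (75 * inv_sqrt_divisor_sum a * (1 + ln (real a)) ^ 4) / (sqrt (ln (real a)) / ln (ln (real a))) - 2)"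
  shows "\<epsilon> \<longlonglongrightarrow> 0"
proof (rule tendstoI)
  fix e :: real assume e: "e > 0"
  obtain K where K: "K \<ge> 0" "\<forall>\<^sub>F L in at_top. \<forall>n>0. ln (real n) = L \<longrightarrow>
      (\<Sum>p\<in>prime_factors n. 1 / sqrt (real p)) \<le> (2 + e / 2) * (sqrt L / ln L) + K"
    using sum_inverse_sqrt_prime_factors_le[of "e / 2"] e by auto
  have "((\<lambda>L. (K + 4 * (2 + ln L) + ln 75 + 4 * ln (1 + L)) / (sqrt L / ln L)) \<longlongrightarrow> 0) at_top"
    by real_asymp
  hence "\<forall>\<^sub>F L in at_top. (K + 4 * (2 + ln L) + ln 75 + 4 * ln (1 + L)) / (sqrt L / ln L) < e / 2"
    by (rule order_tendstoD) (use e in auto)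
  with K(2) have "\<forall>\<^sub>F L in at_top. \<forall>n>0. ln (real n) = L \<longrightarrow> \<epsilon> n < e"
    using eventually_ge_at_top[of 3]
  proof eventually_elim
    case (elim L)
    show ?case
    proof (intro allI impI)
      fix n :: nat assume n: "n > 0" "ln (real n) = L"
      define R where "R = sqrt L / ln L"
      have R: "R > 0" using elim by (simp add: R_def)
      define F where "F = inv_sqrt_divisor_sum n"
      have F: "F \<ge> 1" unfolding F_def by (rule inv_sqrt_divisor_sum_ge_1[OF n(1)])
      have "ln F \<le> (\<Sum>p\<in>prime_factors n. 1 / sqrt (real p) + 4 / real p)"
        unfolding F_def by (rule ln_inv_sqrt_divisor_sum_le[OF n(1)])
      also have "\<dots> = (\<Sum>p\<in>prime_factors n. 1 / sqrt (real p)) + 4 * (\<Sum>p\<in>prime_factors n. 1 / real p)"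
        by (simp add: sum.distrib sum_distrib_left)
      also have "\<dots> \<le> ((2 + e / 2) * R + K) + 4 * (2 + ln L)"
        using elim n unfolding R_def by (intro add_mono mult_left_mono sum_inverse_prime_factors_le_ln[OF n]) auto
      finally have lnF: "ln F \<le> ((2 + e / 2) * R + K) + 4 * (2 + ln L)" .
      have "ln (75 * F * (1 + L) ^ 4) = ln 75 + ln F + 4 * ln (1 + L)"
        using F elim by (simp add: ln_mult ln_realpow)
      also have "\<dots> \<le> (2 + e / 2) * R + (K + 4 * (2 + ln L) + ln 75 + 4 * ln (1 + L))" using lnF by simp
      also have "\<dots> < (2 + e / 2) * R + e / 2 * R"
        using elim(2) R unfolding R_def[symmetric] by (simp add: pos_divide_less_eq)
      finally have "ln (75 * F * (1 + L) ^ 4) / R < 2 + e" using R by (simp add: pos_divide_less_eq algebra_simps)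
      thus "\<epsilon> n < e" using e by (simp add: \<epsilon>_def F_def R_def n(2))
    qed
  qed
  moreover have "filterlim (\<lambda>a. ln (real a)) at_top sequentially" by real_asymp
  ultimately have "\<forall>\<^sub>F a in sequentially. \<forall>n>0. ln (real n) = ln (real a) \<longrightarrow> \<epsilon> n < e"
    unfolding filterlim_iff by blast
  thus "\<forall>\<^sub>F a in sequentially. dist (\<epsilon> a) 0 < e"
    using eventually_gt_at_top[of 0]
  proof eventually_elim
    case (elim a)
    hence "\<epsilon> a < e" by auto
    moreover have "\<epsilon> a \<ge> 0" by (simp add: \<epsilon>_def)
    ultimately show ?case by simp
  qed
qed

theorem theorem1:
  shows "\<exists>(C::real) (\<epsilon> :: nat \<Rightarrow> real).
    \<epsilon> \<longlonglongrightarrow> 0 \<and>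
    (\<forall>(a::nat) (b::nat). a \<ge> 3 \<longrightarrow> b \<ge> 1 \<longrightarrow>
      \<bar>(\<Sum>x=1..b. real_of_int \<lfloor>(real x)\<^sup>2 / real a\<rfloor>)
        - (\<Sum>x=1..b. ((real x)\<^sup>2 / real a - 1 / 2))\<bar>
      \<le> C * \<bar>sqrt (real a) * ln (real a)
             + real b * real a powr
                 (- 1 / 2 + (2 + \<epsilon> a) / (sqrt (ln (real a)) * ln (ln (real a))))\<bar>)"
proof -
  define \<epsilon> where "\<epsilon> a = max 0 (ln (75 * inv_sqrt_divisor_sum a * (1 + ln (real a)) ^ 4) / (sqrt (ln (real a)) / ln (ln (real a))) - 2)" for a :: nat
  have lim: "\<epsilon> \<longlonglongrightarrow> 0" using exponent_error_tendsto_0 unfolding \<epsilon>_def[abs_def] .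
  have bound: "\<bar>floor_defect a b\<bar> \<le> 40 * \<bar>sqrt (real a) * ln (real a) + real b * real a powr
                 (- 1 / 2 + (2 + \<epsilon> a) / (sqrt (ln (real a)) * ln (ln (real a))))\<bar>"
    if a: "a \<ge> 3" and b: "b \<ge> 1" for a b :: nat
  proof -
    define L where "L = ln (real a)"
    define G where "G = 75 * inv_sqrt_divisor_sum a * (1 + L) ^ 4"
    \<comment> \<open>a >= 3 > e gives ln a > 1 and so ln (ln a) > 0; multiplying and dividing by
      \<open>R\<close> below relies on this.\<close>
    have "exp 1 < real a" using a e_less_272 by simp
    hence "ln (exp 1) < ln (real a)" using a by (subst ln_less_cancel_iff) auto
    hence L: "L > 1" by (simp add: L_def)
    hence lnL: "ln L > 0" by simp
    have "1 \<le> inv_sqrt_divisor_sum a" using a by (intro inv_sqrt_divisor_sum_ge_1) auto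
    hence G: "G > 0" using L by (simp add: G_def)
    define R where "R = sqrt L / ln L"
    have R: "R > 0" using L lnL by (simp add: R_def)
    have "ln G / R \<le> 2 + \<epsilon> a" by (simp add: \<epsilon>_def G_def L_def R_def)
    hence "ln G \<le> (2 + \<epsilon> a) * R" using R by (simp add: pos_divide_le_eq)
    hence "G \<le> exp ((2 + \<epsilon> a) * R)" using G by (metis exp_le_cancel_iff exp_ln)
    \<comment> \<open>As a powr t = exp(t ln a), the exponent of a is (2 + \<epsilon> a) R / L, and
      R / L = 1 / (sqrt L ln L).\<close>
    also have "(2 + \<epsilon> a) * R = (2 + \<epsilon> a) / (sqrt L * ln L) * L"
    proof -
      have "R = L / (sqrt L * ln L)" unfolding R_def using L
        by (metis divide_divide_eq_left less_imp_le less_trans real_div_sqrt zero_less_one)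
      thus ?thesis by simp
    qed
    also have "exp \<dots> = real a powr ((2 + \<epsilon> a) / (sqrt L * ln L))"
      using a by (simp add: powr_def L_def)
    finally have GE: "G \<le> real a powr ((2 + \<epsilon> a) / (sqrt L * ln L))" .
    have sq: "1 / sqrt (real a) = real a powr (- 1 / 2)"
      using a by (simp add: powr_half_sqrt[symmetric] powr_minus_divide)
    have "real b / sqrt (real a) * G = real b * (1 / sqrt (real a) * G)" by simp
    also have "\<dots> \<le> real b * (1 / sqrt (real a) * real a powr ((2 + \<epsilon> a) / (sqrt L * ln L)))"
      by (intro mult_left_mono GE) auto
    also have "1 / sqrt (real a) * real a powr ((2 + \<epsilon> a) / (sqrt L * ln L)) = real a powr (- 1 / 2 + (2 + \<epsilon> a) / (sqrt L * ln L))"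
      unfolding sq by (rule powr_add[symmetric])
    finally have main: "real b / sqrt (real a) * G \<le> real b * real a powr (- 1 / 2 + (2 + \<epsilon> a) / (sqrt L * ln L))" .
    have "\<bar>floor_defect a b\<bar> \<le> 40 * (sqrt (real a) * L) + real b / sqrt (real a) * G"
      unfolding L_def G_def using floor_defect_bound[of a b] a b by simp
    also have "\<dots> \<le> 40 * (sqrt (real a) * L) + real b * real a powr (- 1 / 2 + (2 + \<epsilon> a) / (sqrt L * ln L))"
      by (intro add_left_mono main)
    also have "\<dots> \<le> 40 * (sqrt (real a) * L + real b * real a powr (- 1 / 2 + (2 + \<epsilon> a) / (sqrt L * ln L)))"
      by (simp add: distrib_left)
    also have "\<dots> \<le> 40 * \<bar>sqrt (real a) * L + real b * real a powr (- 1 / 2 + (2 + \<epsilon> a) / (sqrt L * ln L))\<bar>"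
      by (intro mult_left_mono abs_ge_self) auto
    finally show ?thesis unfolding L_def .
  qed
  show ?thesis
    using lim bound unfolding floor_defect_def by blast
qed

end
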